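(* Let $V^{\mathrm{an}}=\{(s_1,s_2)\in\mathbb{C}^2 : s_1s_2(1-s_1)(1-s_2)(s_1-s_2)(1-s_1s_2)\neq 0\}$, let $(x,y)\in V^{\mathrm{an}}$, and let $\gamma_0\in\pi_1^{\mathrm{top}}(V^{\mathrm{an}};\vec v,(x,y))$ be a homotopy class of paths from the tangential base point $\vec v$ (over $(t^2,t)$) to $(x,y)$. Define the path system $\{\gamma_i\}_{i=1,\dots,9}$ associated with $\gamma_0$ by $$\gamma_i:=\delta_i\cdot f_i(\gamma_0)\in\pi_1^{\mathrm{top}}\big(\mathbb{P}^1(\mathbb{C})\setminus\{0,1,\infty\};\overrightarrow{01},f_i(x,y)\big),$$ with the maps $f_i$ and the paths $\delta_i$ given in the context. Then the following Spence--Kummer equation holds: \begin{align*} &Li_3\Big(\tfrac{x(1-y)^2}{y(1-x)^2};\gamma_1\Big)+Li_3(xy;\gamma_2)+Li_3\Big(\tfrac{x}{y};\gamma_3\Big)-2Li_3\Big(\tfrac{x(1-y)}{y(1-x)};\gamma_4\Big)-2Li_3\Big(\tfrac{x(1-y)}{x-1};\gamma_5\Big)\\ &-2Li_3\Big(\tfrac{1-y}{1-x};\gamma_6\Big)-2Li_3\Big(\tfrac{1-y}{y(x-1)};\gamma_7\Big)-2Li_3(x;\gamma_8)-2Li_3(y;\gamma_9)+2\zeta(3)\\ &=\log^2(y;\gamma_9)\log\Big(\tfrac{1-y}{1-x};\gamma_6\Big)-\tfrac{\pi^2}{3}\log(y;\gamma_9)-\tfrac13\log^3(y;\gamma_9).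 \end{align*}
   Context: **Paths.** For a complex space $W$ and two (possibly tangential) base points $*,*'$, $\pi_1^{\mathrm{top}}(W;*,*')$ is the set of homotopy classes of topological paths on $W$ from $*$ to $*'$. Paths are composed from left to right: $\gamma\cdot\gamma'$ means first $\gamma$, then $\gamma'$. **Tangential base points on $\mathbb{P}^1(\mathbb{C})\setminus\{0,1,\infty\}$.** $\overrightarrow{ab}$ is the tangential base point at $a$ pointing towards $b$ along the real segment of $\mathbb{P}^1(\mathbb{R})\setminus\{0,1,\infty\}$ joining $a$ and $b$: $\overrightarrow{01}$ is at $0$ in the positive real direction, $\overrightarrow{10}$ is at $1$ pointing towards $0$ along $(0,1)$, $\overrightarrow{0\infty}$ is at $0$ in the negative real direction, $\overrightarrow{\infty 0}$ is at $\infty$ pointing towards $0$ along the negative reals. **Base point $\vec v$.** $\vec v$ is the tangential base point of $V^{\mathrm{an}}$ over the point $(t^2,t)$, i.e. a path starting at $\vec v$ starts as $t\mapsto(t^2,t)$ for small real $t>0$. **Maps.** $f_1,\dots,f_9:V^{\mathrm{an}}\to\mathbb{P}^1(\mathbb{C})\setminus\{0,1,\infty\}$ are $f_1=\frac{s_1(1-s_2)^2}{s_2(1-s_1)^2}$, $f_2=s_1s_2$, $f_3=\frac{s_1}{s_2}$, $f_4=\frac{s_1(1-s_2)}{s_2(1-s_1)}$, $f_5=\frac{s_1(1-s_2)}{s_1-1}$, $f_6=\frac{1-s_2}{1-s_1}$, $f_7=\frac{1-s_2}{s_2(s_1-1)}$, $f_8=s_1$, $f_9=s_2$. At $(t^2,t)$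 their values are $\frac{t}{(1+t)^2},\,t^3,\,t,\,\frac{t}{1+t},\,\frac{-t^2}{1+t},\,\frac1{1+t},\,\frac{-1}{t(1+t)},\,t^2,\,t$; accordingly $f_i(\vec v)$ is identified with $\overrightarrow{01}$ for $i=1,2,3,4,8,9$, with $\overrightarrow{0\infty}$ for $i=5$, with $\overrightarrow{10}$ for $i=6$, and with $\overrightarrow{\infty0}$ for $i=7$. **Paths $\delta_i$ from $\overrightarrow{01}$ to $f_i(\vec v)$.** $\delta_i$ is trivial for $i=1,2,3,4,8,9$. $\delta_5=\delta_{\overrightarrow{0\infty}}$ is the half-turn around $0$ through the upper half-plane (counterclockwise) from $\overrightarrow{01}$ to $\overrightarrow{0\infty}$. $\delta_6=\delta_{\overrightarrow{10}}$ is the straight path along $(0,1)$ from $\overrightarrow{01}$ to $\overrightarrow{10}$. $\delta_7=\delta_{\overrightarrow{\infty0}}$ is the path from $\overrightarrow{01}$ to $\overrightarrow{\infty0}$ through the upper half-plane. **Logarithm and polylogarithms along a path.** For $\gamma\in\pi_1^{\mathrm{top}}(\mathbb{P}^1(\mathbb{C})\setminus\{0,1,\infty\};\overrightarrow{01},z)$, put $\log(z;\gamma):=\int_{\delta_{\overrightarrow{10}}^{-1}\cdot\gamma}\frac{dt}{t}$ (i.e. the continuation along $\gamma$ of the logarithm that is real on $(0,1)$ near $0$), $Li_1(z;\gamma):=\int_\gamma\frac{dt}{1-t}$, and, for $k\ge2$, $Li_k(z;\gamma):=\int_\gamma\frac1t Li_{k-1}(t;\gamma_t)\,dt$, where $\gamma_t$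 is the initial part of $\gamma$ up to $t$. $\log^m(\cdot)$ denotes the $m$-th power, and $\zeta(3)=Li_3(\overrightarrow{10};\delta_{\overrightarrow{10}})$ is the Riemann zeta value. *)

theory Defs
  imports "HOL-Complex_Analysis.Complex_Analysis"
begin

subsection \<open>Homotopy classes of paths with tangential base points\<close>

text \<open>
  A base point of a space W, ordinary or tangential, is given by the filter of its (germs of)
  neighbourhoods: \<^term>\<open>nhds z\<close> for an ordinary point z of W, and the filter of germs of the
  given ray for a tangential base point. Thus a path starting at the tangential base point 01
  runs, for small times, through positive real numbers tending to 0. Since the base point of a
  tangential path is not in W, a path is a function on the open unit interval, constrained at the
  two ends by the filters; its values outside the open interval are irrelevant.
\<close>

definition base_paths :: "'a::topological_space set \<Rightarrow> 'a filter \<Rightarrow> 'a filter \<Rightarrow> (real \<Rightarrow> 'a) set"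
  where "base_paths W S T =
    {p. continuous_on {0<..<1} p \<and> p ` {0<..<1} \<subseteq> W \<and>
        filterlim p S (at_right 0) \<and> filterlim p T (at_left 1)}"

text \<open>
  The end conditions are imposed uniformly in the homotopy parameter (the first coordinate). For
  \<^term>\<open>nhds z\<close> this says that the homotopy extends continuously by the constant z; for a
  tangential base point, that near this end all the paths of the homotopy stay on the ray.
\<close>

definition path_homotopic ::
    "'a::topological_space set \<Rightarrow> 'a filter \<Rightarrow> 'a filter \<Rightarrow> (real \<Rightarrow> 'a) \<Rightarrow> (real \<Rightarrow> 'a) \<Rightarrow> bool"
  where "path_homotopic W S T p q \<longleftrightarrow>
    p \<in> base_paths W S T \<and> q \<in> base_paths W S T \<and>
    (\<exists>H :: real \<times> real \<Rightarrow> 'a.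
       continuous_on ({0..1} \<times> {0<..<1}) H \<and> H ` ({0..1} \<times> {0<..<1}) \<subseteq> W \<and>
       (\<forall>t\<in>{0<..<1}. H (0, t) = p t \<and> H (1, t) = q t) \<and>
       filterlim H S (principal {0..1} \<times>\<^sub>F at_right 0) \<and>
       filterlim H T (principal {0..1} \<times>\<^sub>F at_left 1))"

definition path_class ::
    "'a::topological_space set \<Rightarrow> 'a filter \<Rightarrow> 'a filter \<Rightarrow> (real \<Rightarrow> 'a) \<Rightarrow> (real \<Rightarrow> 'a) set"
  where "path_class W S T p = {q. path_homotopic W S T p q}"

definition pi1 ::
    "'a::topological_space set \<Rightarrow> 'a filter \<Rightarrow> 'a filter \<Rightarrow> (real \<Rightarrow> 'a) set set"
  where "pi1 W S T = base_paths W S T // {(p, q). path_homotopic W S T p q}"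

text \<open>
  Composition of homotopy classes, from left to right, at a base point T that may be tangential,
  so that representatives cannot literally be concatenated. A path p represents the product of
  A and B iff there is a path r from the midpoint of p to T such that the first half of p
  followed by r is in A, and the reverse of r followed by the second half of p is in B. The
  detour through r and back is null-homotopic, so this p is in the product; conversely every
  p in the product is obtained, with r (up to homotopy) the reverse of the first half of p
  followed by a path in A. As A and B are full homotopy classes, the result is one as well.
\<close>

definition path_mult ::
    "(real \<Rightarrow> 'a::real_normed_vector) set \<Rightarrow> (real \<Rightarrow> 'a) set \<Rightarrow> (real \<Rightarrow> 'a) set"  (infixl "\<odot>" 70)
  where "A \<odot> B =
    {p. \<exists>r. r 0 = p (1/2) \<and> subpath 0 (1/2) p +++ r \<in> A \<and>
            reversepath r +++ subpath (1/2) 1 p \<in> B}"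

definition path_inv :: "(real \<Rightarrow> 'a::topological_space) set \<Rightarrow> (real \<Rightarrow> 'a) set"
  where "path_inv A = reversepath ` A"

text \<open>The image under f of a class A of paths, as a class of paths in W from S to T.\<close>

definition path_push ::
    "('a::topological_space \<Rightarrow> 'b::topological_space) \<Rightarrow> 'b set \<Rightarrow> 'b filter \<Rightarrow> 'b filter \<Rightarrow>
     (real \<Rightarrow> 'a) set \<Rightarrow> (real \<Rightarrow> 'b) set"
  where "path_push f W S T A = (\<Union>p\<in>A. path_class W S T (f \<circ> p))"


subsection \<open>The projective line minus three points\<close>

definition P1_minus :: "complex set"
  where "P1_minus = - {0, 1}"

definition base_01 :: "complex filter"
  where "base_01 = filtermap complex_of_real (at_right 0)"

definition base_10 :: "complex filter"
  where "base_10 = filtermap complex_of_real (at_left 1)"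

definition base_0inf :: "complex filter"
  where "base_0inf = filtermap complex_of_real (at_left 0)"

definition base_inf0 :: "complex filter"
  where "base_inf0 = filtermap complex_of_real at_bot"

text \<open>
  The argument of the half-turns below: 0 during the first third of the time, then increasing
  to pi, then pi during the last third. This makes the half-turns start and end on the real rays.
\<close>

definition half_turn_arg :: "real \<Rightarrow> real"
  where "half_turn_arg t = pi * max 0 (min 1 (3 * t - 1))"

text \<open>The trivial path at 01 is represented by a path going out along (0,1) and back.\<close>

definition delta_01 :: "(real \<Rightarrow> complex) set"
  where "delta_01 = path_class P1_minus base_01 base_01 (\<lambda>t. of_real (t * (1 - t)))"

definition delta_0inf :: "(real \<Rightarrow> complex) set"
  where "delta_0inf = path_class P1_minus base_01 base_0inf
           (\<lambda>t. of_real (t * (1 - t)) * cis (half_turn_arg t))"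

definition delta_10 :: "(real \<Rightarrow> complex) set"
  where "delta_10 = path_class P1_minus base_01 base_10 (\<lambda>t. of_real t)"

definition delta_inf0 :: "(real \<Rightarrow> complex) set"
  where "delta_inf0 = path_class P1_minus base_01 base_inf0
           (\<lambda>t. of_real (t / (1 - t)) * cis (half_turn_arg t))"


subsection \<open>Logarithm and polylogarithms along a path\<close>

text \<open>
  \<open>Li_along k p s\<close> is the iterated integral along the initial part of the piecewise continuously
  differentiable path p up to time s; the value for k = 0 is the usual convention and is not used.
\<close>

fun Li_along :: "nat \<Rightarrow> (real \<Rightarrow> complex) \<Rightarrow> real \<Rightarrow> complex" where
  "Li_along 0 p s = p s / (1 - p s)"
| "Li_along (Suc 0) p s =
     integral {0..s} (\<lambda>u. 1 / (1 - p u) * vector_derivative p (at u))"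
| "Li_along (Suc (Suc k)) p s =
     integral {0..s} (\<lambda>u. 1 / p u * Li_along (Suc k) p u * vector_derivative p (at u))"

text \<open>
  Integrals over a homotopy class ending at z are integrals over a piecewise continuously
  differentiable representative on the closed unit interval; the value does not depend on the
  choice of the representative.
\<close>

definition smooth_rep :: "(real \<Rightarrow> complex) set \<Rightarrow> complex \<Rightarrow> (real \<Rightarrow> complex)"
  where "smooth_rep A z = (SOME p. p \<in> A \<and> valid_path p \<and> pathfinish p = z)"

definition Li :: "nat \<Rightarrow> complex \<Rightarrow> (real \<Rightarrow> complex) set \<Rightarrow> complex"
  where "Li k z A = Li_along k (smooth_rep A z) 1"

definition log_path :: "complex \<Rightarrow> (real \<Rightarrow> complex) set \<Rightarrow> complex"
  where "log_path z A = contour_integral (smooth_rep (path_inv delta_10 \<odot> A) z) (\<lambda>t. 1 / t)"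

definition zeta3 :: complex
  where "zeta3 = (\<Sum>n. 1 / of_nat (Suc n) ^ 3)"


subsection \<open>The Spence--Kummer path system\<close>

definition V_an :: "(complex \<times> complex) set"
  where "V_an = {(s1, s2). s1 * s2 * (1 - s1) * (1 - s2) * (s1 - s2) * (1 - s1 * s2) \<noteq> 0}"

definition base_v :: "(complex \<times> complex) filter"
  where "base_v = filtermap (\<lambda>t::real. (of_real t ^ 2, of_real t)) (at_right 0)"

text \<open>The index i ranges over 1, ..., 9.\<close>

definition SK_map :: "nat \<Rightarrow> complex \<times> complex \<Rightarrow> complex"
  where "SK_map i = (\<lambda>(s1, s2).
    [ s1 * (1 - s2)^2 / (s2 * (1 - s1)^2),
      s1 * s2,
      s1 / s2,
      s1 * (1 - s2) / (s2 * (1 - s1)),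
      s1 * (1 - s2) / (s1 - 1),
      (1 - s2) / (1 - s1),
      (1 - s2) / (s2 * (s1 - 1)),
      s1,
      s2 ] ! (i - 1))"

definition SK_base :: "nat \<Rightarrow> complex filter"
  where "SK_base i = (if i = 5 then base_0inf else if i = 6 then base_10
                      else if i = 7 then base_inf0 else base_01)"

definition SK_delta :: "nat \<Rightarrow> (real \<Rightarrow> complex) set"
  where "SK_delta i = (if i = 5 then delta_0inf else if i = 6 then delta_10
                       else if i = 7 then delta_inf0 else delta_01)"

end

theory Submission
  imports Defs "HOL-Real_Asymp.Real_Asymp"
begin

text \<open>
  The functions log, \<open>Li\<^sub>1\<close>, \<open>Li\<^sub>2\<close>, \<open>Li\<^sub>3\<close> together solve one triangular linear system on the projective
  line minus three points: the derivatives are \<open>1/z\<close>, \<open>1/(1-z)\<close>, \<open>Li\<^sub>1/z\<close>, \<open>Li\<^sub>2/z\<close>. All integrals in the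
  Spence-Kummer equation are components of the continuation of a single solution, the principal
  branch on \<open>(0,1)\<close>. So the equation is a statement about the continuations \<open>l\<^sub>i, q\<^sub>i, P\<^sub>i, T\<^sub>i\<close> of log,
  \<open>Li\<^sub>1\<close>, \<open>Li\<^sub>2\<close>, \<open>Li\<^sub>3\<close> along the nine paths \<open>f\<^sub>i(\<gamma>\<^sub>0)\<close>, and it is proved by differentiation.

  All \<open>f\<^sub>i\<close> and \<open>1 - f\<^sub>i\<close> are products of powers of \<open>x, y, 1-x, 1-y, y-x, 1-xy\<close> up to sign. Hence \<open>l\<^sub>i\<close> and
  \<open>q\<^sub>i\<close> are, up to \<open>i pi\<close>, integral linear forms in six logarithms. As \<open>dT\<^sub>i = P\<^sub>i dl\<^sub>i\<close>, the derivative of the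
  difference of the two sides of the equation is a combination of three expressions in the \<open>P\<^sub>i\<close> and
  products of two logarithms; as \<open>dP\<^sub>i = q\<^sub>i dl\<^sub>i\<close>, the linear relations among the logarithms make the
  derivatives of these three expressions vanish (\<open>SK_dilog_defect_constant\<close>, \<open>SK_defect_constant\<close>).
  So all differences are constant along \<open>\<gamma>\<^sub>0\<close>, and the constants are read off from the curve
  \<open>(t\<^sup>2, t)\<close> as t tends to 0: there seven of the \<open>f\<^sub>i\<close> tend to 0, where \<open>Li\<^sub>2\<close> and \<open>Li\<^sub>3\<close> vanish; \<open>f\<^sub>6\<close> tends
  to 1, which produces \<open>zeta(2)\<close> and \<open>zeta(3)\<close>; and \<open>f\<^sub>7\<close> tends to minus infinity, where the inversion
  formulas for \<open>Li\<^sub>2\<close> and \<open>Li\<^sub>3\<close> give the logarithmic terms (\<open>SK_base_dilog\<close>, \<open>SK_base_defect\<close>).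

  It remains to identify the integrals over homotopy classes with these continuations. The solutions
  of the system form a locally constant family, and such a family is trivial over a convex set
  (\<open>parallel_section_exists\<close>). Over an interval this is continuation along a path that is merely
  continuous; over the rectangle on which a homotopy is defined it is homotopy invariance
  (\<open>transports_homotopic\<close>). The paths \<open>\<delta>\<^sub>i\<close> stay in a region on which the principal branch extends to
  a single-valued solution, so they transport it to itself, and the product of paths composes
  transports (\<open>transports_path_mult\<close>). Along a piecewise continuously differentiable path the
  fundamental theorem of calculus turns the iterated integrals into components of the continuation
  (\<open>Li_along_eq_transport\<close>). Finally each of the classes has such a path (\<open>smooth_element_exists\<close>,
  \<open>smooth_log_element_exists\<close>): an explicit piece near the tangential base point, followed by a
  polynomial approximation of \<open>f\<^sub>i(\<gamma>\<^sub>0)\<close>.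
\<close>

section \<open>Locally constant families over convex sets\<close>

text \<open>
  Here \<open>T a b v\<close> is the transport of \<open>v\<close> from the fibre over \<open>a\<close> to the fibre over \<open>b\<close>. It is
  meaningful only for \<open>a\<close> and \<open>b\<close> close to each other, so the cocycle condition is a local one.
\<close>

definition flat_within :: "'a set \<Rightarrow> ('a \<Rightarrow> 'a \<Rightarrow> 'v \<Rightarrow> 'v) \<Rightarrow> bool"
  where "flat_within B T \<longleftrightarrow> (\<forall>a\<in>B. \<forall>b\<in>B. \<forall>c\<in>B. \<forall>v. T b c (T a b v) = T a c v)"

definition flat_on :: "'a::metric_space set \<Rightarrow> ('a \<Rightarrow> 'a \<Rightarrow> 'v \<Rightarrow> 'v) \<Rightarrow> bool"
  where "flat_on R T \<longleftrightarrow>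
    (\<forall>r\<in>R. (\<forall>v. T r r v = v) \<and> (\<exists>d>0. flat_within (R \<inter> ball r d) T))"

definition parallel_on :: "'a::metric_space set \<Rightarrow> ('a \<Rightarrow> 'a \<Rightarrow> 'v \<Rightarrow> 'v) \<Rightarrow> ('a \<Rightarrow> 'v) \<Rightarrow> bool"
  where "parallel_on R T \<phi> \<longleftrightarrow> (\<forall>r\<in>R. \<exists>d>0. \<forall>s\<in>R \<inter> ball r d. \<phi> s = T r s (\<phi> r))"

lemma flat_withinD:
  "flat_within B T \<Longrightarrow> a \<in> B \<Longrightarrow> b \<in> B \<Longrightarrow> c \<in> B \<Longrightarrow> T b c (T a b v) = T a c v"
  unfolding flat_within_def by blast

lemma flat_onE:
  assumes "flat_on R T" "r \<in> R"
  obtains d where "d > 0" "flat_within (R \<inter> ball r d) T"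
  using assms unfolding flat_on_def by blast

lemma flat_on_refl: "flat_on R T \<Longrightarrow> r \<in> R \<Longrightarrow> T r r v = v"
  unfolding flat_on_def by blast

lemma parallel_onE:
  assumes "parallel_on R T \<phi>" "r \<in> R"
  obtains d where "d > 0" "\<forall>s\<in>R \<inter> ball r d. \<phi> s = T r s (\<phi> r)"
  using assms unfolding parallel_on_def by blast

text \<open>
  Near each point both sections are determined by their value at that point, and transport back to
  that point is injective by the cocycle condition; so the set on which they agree is open and closed.
\<close>

lemma parallel_on_unique:
  assumes R: "connected R" and flat: "flat_on R T"
    and p: "parallel_on R T \<phi>" "parallel_on R T \<psi>"
    and "a \<in> R" "\<phi> a = \<psi> a" "b \<in> R"
  shows "\<phi> b = \<psi> b"
proof (rule connected_induction_simple[where P = "\<lambda>r. \<phi> r = \<psi> r", OF R \<open>a \<in> R\<close> \<open>b \<in> R\<close> \<open>\<phi> a = \<psi> a\<close>])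
  fix r assume r: "r \<in> R"
  obtain d1 where d1: "d1 > 0" "\<forall>s\<in>R \<inter> ball r d1. \<phi> s = T r s (\<phi> r)"
    using parallel_onE[OF p(1) r] by blast
  obtain d2 where d2: "d2 > 0" "\<forall>s\<in>R \<inter> ball r d2. \<psi> s = T r s (\<psi> r)"
    using parallel_onE[OF p(2) r] by blast
  obtain d3 where d3: "d3 > 0" "flat_within (R \<inter> ball r d3) T"
    using flat_onE[OF flat r] by blast
  define d where "d = min d1 (min d2 d3)"
  have "\<phi> y = \<psi> y" if "x \<in> R \<inter> ball r d" "y \<in> R \<inter> ball r d" "\<phi> x = \<psi> x" for x y
  proof -
    have inv: "T x r (T r x v) = v" for v
      using flat_withinD[OF d3(2), of r x r v] that r d3(1) flat_on_refl[OF flat r] by (auto simp: d_def)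
    have "\<phi> r = T x r (\<phi> x)" "\<psi> r = T x r (\<psi> x)"
      using bspec[OF d1(2), of x] bspec[OF d2(2), of x] that(1) inv by (simp_all add: d_def)
    then have "\<phi> r = \<psi> r" using that(3) by simp
    moreover have "\<phi> y = T r y (\<phi> r)" "\<psi> y = T r y (\<psi> r)"
      using bspec[OF d1(2), of y] bspec[OF d2(2), of y] that(2) by (simp_all add: d_def)
    ultimately show ?thesis by simp
  qed
  note step = this
  show "\<exists>U. openin (top_of_set R) U \<and> r \<in> U \<and> (\<forall>x\<in>U. \<forall>y\<in>U. \<phi> x = \<psi> x \<longrightarrow> \<phi> y = \<psi> y)"
  proof (intro exI[of _ "R \<inter> ball r d"] conjI ballI impI)
    show "openin (top_of_set R) (R \<inter> ball r d)" by (simp add: openin_open_Int)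
    show "r \<in> R \<inter> ball r d" using r d1(1) d2(1) d3(1) by (simp add: d_def)
  qed (rule step)
qed

text \<open>
  Bolzano's bisection principle: sections over adjacent intervals can be glued, and over a short
  interval transport from the left end point is a section.
\<close>

lemma parallel_on_interval:
  fixes T :: "real \<Rightarrow> real \<Rightarrow> 'v \<Rightarrow> 'v"
  assumes flat: "flat_on {0..1} T"
  shows "\<exists>\<phi>. \<phi> 0 = v \<and> parallel_on {0..1} T \<phi>"
proof -
  define P where "P a b = (0 \<le> a \<longrightarrow> b \<le> 1 \<longrightarrow> (\<forall>v. \<exists>\<phi>. \<phi> a = v \<and> parallel_on {a..b} T \<phi>))" for a b
  have "P 0 1"
  proof (rule Bolzano)
    fix a b c assume ab: "P a b" "P b c" "a \<le> b" "b \<le> c"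
    show "P a c"
      unfolding P_def
    proof (intro impI allI)
      fix v assume "0 \<le> a" "c \<le> 1"
      with ab obtain f where f: "f a = v" "parallel_on {a..b} T f"
        unfolding P_def by (meson order_trans)
      from \<open>0 \<le> a\<close> \<open>c \<le> 1\<close> ab obtain g where g: "g b = f b" "parallel_on {b..c} T g"
        unfolding P_def by (meson order_trans)
      define h where "h s = (if s \<le> b then f s else g s)" for s
      have "parallel_on {a..c} T h"
        unfolding parallel_on_def
      proof
        fix r assume r: "r \<in> {a..c}"
        consider "r < b" | "r = b" | "r > b" by linarith
        then show "\<exists>d>0. \<forall>s\<in>{a..c} \<inter> ball r d. h s = T r s (h r)"
        proof cases
          case 1
          then obtain d where d: "d > 0" "\<forall>s\<in>{a..b} \<inter> ball r d. f s = T r s (f r)"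
            using parallel_onE[OF f(2), of r] r by auto
          show ?thesis
          proof (intro exI[of _ "min d (b - r)"] conjI ballI)
            fix s assume "s \<in> {a..c} \<inter> ball r (min d (b - r))"
            then show "h s = T r s (h r)"
              using bspec[OF d(2), of s] 1 by (auto simp: h_def dist_real_def)
          qed (use d(1) 1 in auto)
        next
          case 2
          obtain d where d: "d > 0" "\<forall>s\<in>{a..b} \<inter> ball r d. f s = T r s (f r)"
            using parallel_onE[OF f(2), of r] r 2 by auto
          obtain e where e: "e > 0" "\<forall>s\<in>{b..c} \<inter> ball r e. g s = T r s (g r)"
            using parallel_onE[OF g(2), of r] r 2 by auto
          show ?thesis
          proof (intro exI[of _ "min d e"] conjI ballI)
            fix s assume "s \<in> {a..c} \<inter> ball r (min d e)"
            then show "h s = T r s (h r)"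
              using bspec[OF d(2), of s] bspec[OF e(2), of s] 2 g(1) by (cases "s \<le> b") (auto simp: h_def)
          qed (use d(1) e(1) in auto)
        next
          case 3
          then obtain d where d: "d > 0" "\<forall>s\<in>{b..c} \<inter> ball r d. g s = T r s (g r)"
            using parallel_onE[OF g(2), of r] r by auto
          show ?thesis
          proof (intro exI[of _ "min d (r - b)"] conjI ballI)
            fix s assume "s \<in> {a..c} \<inter> ball r (min d (r - b))"
            then show "h s = T r s (h r)"
              using bspec[OF d(2), of s] 3 by (auto simp: h_def dist_real_def)
          qed (use d(1) 3 in auto)
        qed
      qed
      moreover have "h a = v" using f ab by (simp add: h_def)
      ultimately show "\<exists>\<phi>. \<phi> a = v \<and> parallel_on {a..c} T \<phi>" by blast
    qed
  next
    fix x :: real assume "0 \<le> x" "x \<le> 1"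
    then obtain d where d: "d > 0" "flat_within ({0..1} \<inter> ball x d) T"
      using flat_onE[OF flat, of x] by auto
    have "P a b" if "a \<le> x" "x \<le> b" "b - a < d" for a b
      unfolding P_def
    proof (intro impI allI)
      fix v assume ab: "0 \<le> a" "b \<le> 1"
      have mem: "{a..b} \<subseteq> {0..1} \<inter> ball x d"
        using that ab by (auto simp: dist_real_def)
      have "parallel_on {a..b} T (\<lambda>s. T a s v)"
        unfolding parallel_on_def
      proof (intro ballI exI[of _ 1] conjI)
        fix r s assume "r \<in> {a..b}" "s \<in> {a..b} \<inter> ball r 1"
        moreover have "a \<in> {a..b}" using that by simp
        ultimately show "T a s v = T r s (T a r v)"
          using mem by (intro flat_withinD[OF d(2), symmetric]) blast+
      qed simp
      moreover have "T a a v = v"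
        using flat_on_refl[OF flat, of a] ab that \<open>x \<le> 1\<close> by simp
      ultimately show "\<exists>\<phi>. \<phi> a = v \<and> parallel_on {a..b} T \<phi>"
        by (intro exI[of _ "\<lambda>s. T a s v"]) auto
    qed
    then show "\<exists>d>0. \<forall>a b. a \<le> x \<and> x \<le> b \<and> b - a < d \<longrightarrow> P a b"
      using d(1) by blast
  qed auto
  then show ?thesis by (simp add: P_def)
qed

text \<open>
  A Lebesgue number for the covering by balls on which the cocycle condition holds.
\<close>

lemma flat_on_compact_uniform:
  assumes flat: "flat_on R T" and K: "compact K" "K \<subseteq> R"
  obtains e where "e > 0" "\<forall>r\<in>K. flat_within (R \<inter> ball r e) T"
proof -
  define G where "G = {B. open B \<and> flat_within (R \<inter> B) T}"
  have "K \<subseteq> \<Union>G"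
  proof
    fix r assume "r \<in> K"
    then obtain d where "d > 0" "flat_within (R \<inter> ball r d) T"
      using flat_onE[OF flat, of r] K by blast
    then have "ball r d \<in> G" "r \<in> ball r d" unfolding G_def by auto
    then show "r \<in> \<Union>G" by blast
  qed
  moreover have "\<And>B. B \<in> G \<Longrightarrow> open B" by (simp add: G_def)
  ultimately obtain e where "e > 0" and e: "\<forall>x\<in>K. \<exists>b\<in>G. ball x e \<subseteq> b"
    using Heine_Borel_lemma[OF K(1)] by metis
  show ?thesis
  proof (rule that[OF \<open>e > 0\<close>], rule ballI)
    fix r assume "r \<in> K"
    then obtain B where "B \<in> G" "ball r e \<subseteq> B" using e by blast
    then show "flat_within (R \<inter> ball r e) T" unfolding G_def flat_within_def by blast
  qed
qed

text \<open>
  The value at \<open>r\<close> is obtained by continuation along the segment from \<open>r0\<close> to \<open>r\<close>. For \<open>r'\<close> near \<open>r\<close>,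
  transporting the section over the segment to \<open>r\<close> across to the nearby segment to \<open>r'\<close> gives a
  section there with the same initial value; by uniqueness it is the one used to define the value
  at \<open>r'\<close>, so the two values differ by the transport from \<open>r\<close> to \<open>r'\<close>.
\<close>

theorem parallel_section_exists:
  fixes R :: "'a::real_normed_vector set"
  assumes R: "convex R" and flat: "flat_on R T" and r0: "r0 \<in> R"
  shows "\<exists>\<phi>. \<phi> r0 = v \<and> parallel_on R T \<phi>"
proof -
  define c where "c r s = (1 - s) *\<^sub>R r0 + s *\<^sub>R r" for r and s :: real
  have c_in: "c r s \<in> R" if "r \<in> R" "s \<in> {0..1}" for r s
    unfolding c_def using that R r0 by (intro convexD) auto
  have c_cont: "continuous_on A (c r)" for A r
    unfolding c_def by (intro continuous_intros)
  have c_near: "\<exists>d>0. \<forall>s'\<in>{0..1} \<inter> ball s d. c r s' \<in> R \<inter> ball (c r s) e"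
    if "r \<in> R" "s \<in> {0..1}" "e > 0" for r s e
  proof -
    have "continuous (at s) (c r)"
      using c_cont[of UNIV] by (simp add: continuous_on_eq_continuous_at)
    then obtain d where "d > 0" "\<forall>s'. dist s' s < d \<longrightarrow> dist (c r s') (c r s) < e"
      using \<open>e > 0\<close> unfolding continuous_at_eps_delta by blast
    then show ?thesis using c_in that by (intro exI[of _ d]) (auto simp: dist_commute)
  qed
  have flat_c: "flat_on {0..1} (\<lambda>s s'. T (c r s) (c r s'))" if r: "r \<in> R" for r
    unfolding flat_on_def
  proof (intro ballI conjI allI)
    fix s :: real assume s: "s \<in> {0..1}"
    show "T (c r s) (c r s) v = v" for v
      using flat_on_refl[OF flat] c_in r s by blast
    obtain e where e: "e > 0" "flat_within (R \<inter> ball (c r s) e) T"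
      using flat_onE[OF flat c_in[OF r s]] by blast
    obtain d where "d > 0" "\<forall>s'\<in>{0..1} \<inter> ball s d. c r s' \<in> R \<inter> ball (c r s) e"
      using c_near[OF r s e(1)] by blast
    then show "\<exists>d>0. flat_within ({0..1} \<inter> ball s d) (\<lambda>s s'. T (c r s) (c r s'))"
      using e(2) unfolding flat_within_def by blast
  qed
  have "\<exists>F. F 0 = v \<and> parallel_on {0..1} (\<lambda>s s'. T (c r s) (c r s')) F" if "r \<in> R" for r
    using parallel_on_interval[OF flat_c[OF that]] .
  then obtain F where F0: "\<And>r. r \<in> R \<Longrightarrow> F r 0 = v"
    and F: "\<And>r. r \<in> R \<Longrightarrow> parallel_on {0..1} (\<lambda>s s'. T (c r s) (c r s')) (F r)"
    by metis
  have c0: "c r 0 = r0" and c1: "c r 1 = r" for r by (auto simp: c_def)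
  have par: "parallel_on R T (\<lambda>r. F r 1)"
    unfolding parallel_on_def
  proof
    fix r assume r: "r \<in> R"
    have "compact (c r ` {0..1})" "c r ` {0..1} \<subseteq> R"
      using c_in r c_cont by (auto intro!: compact_continuous_image)
    then obtain e where e: "e > 0" "\<forall>r'\<in>c r ` {0..1}. flat_within (R \<inter> ball r' e) T"
      using flat_on_compact_uniform[OF flat] by blast
    have "F r' 1 = T r r' (F r 1)" if r': "r' \<in> R \<inter> ball r (e/2)" for r'
    proof -
      have close: "dist (c r s) (c r' s) < e/2" if "s \<in> {0..1}" for s
      proof -
        have "c r s - c r' s = s *\<^sub>R (r - r')" by (simp add: c_def algebra_simps)
        then have "dist (c r s) (c r' s) = s * dist r r'" using that by (simp add: dist_norm)
        also have "\<dots> \<le> 1 * dist r r'" using that by (intro mult_right_mono) auto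
        also have "\<dots> < e/2" using r' by simp
        finally show ?thesis .
      qed
      define \<psi> where "\<psi> s = T (c r s) (c r' s) (F r s)" for s
      have "parallel_on {0..1} (\<lambda>s s'. T (c r' s) (c r' s')) \<psi>"
        unfolding parallel_on_def
      proof
        fix s :: real assume s: "s \<in> {0..1}"
        obtain d1 where d1: "d1 > 0" "\<forall>s'\<in>{0..1} \<inter> ball s d1. F r s' = T (c r s) (c r s') (F r s)"
          using parallel_onE[OF F[OF r] s] by blast
        obtain d2 where d2: "d2 > 0" "\<forall>s'\<in>{0..1} \<inter> ball s d2. c r s' \<in> R \<inter> ball (c r s) e"
          using c_near[OF r s e(1)] by blast
        obtain d3 where d3: "d3 > 0" "\<forall>s'\<in>{0..1} \<inter> ball s d3. c r' s' \<in> R \<inter> ball (c r' s) (e/2)"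
          using c_near[of r' s "e/2"] r' s e(1) by auto
        have "\<psi> s' = T (c r' s) (c r' s') (\<psi> s)" if s': "s' \<in> {0..1} \<inter> ball s (min d1 (min d2 d3))" for s'
        proof -
          have in1: "c r s \<in> R \<inter> ball (c r s) e" using c_in r s e by simp
          have in2: "c r s' \<in> R \<inter> ball (c r s) e" using d2 s' by auto
          have in3: "c r' s \<in> R \<inter> ball (c r s) e" using close[OF s] c_in r' s e by auto
          have "dist (c r s) (c r' s') \<le> dist (c r s) (c r' s) + dist (c r' s) (c r' s')"
            by (rule dist_triangle)
          also have "\<dots> < e/2 + e/2"
            using close[OF s] d3 s' by (intro add_strict_mono) auto
          finally have in4: "c r' s' \<in> R \<inter> ball (c r s) e" using c_in r' s' by simp
          have k: "flat_within (R \<inter> ball (c r s) e) T" using e s by blast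
          have "T (c r' s) (c r' s') (\<psi> s) = T (c r s) (c r' s') (F r s)"
            unfolding \<psi>_def by (rule flat_withinD[OF k in1 in3 in4])
          also have "\<dots> = T (c r s') (c r' s') (T (c r s) (c r s') (F r s))"
            by (rule flat_withinD[OF k in1 in2 in4, symmetric])
          also have "\<dots> = \<psi> s'" using bspec[OF d1(2), of s'] s' by (simp add: \<psi>_def)
          finally show ?thesis by simp
        qed
        then show "\<exists>d>0. \<forall>s'\<in>{0..1} \<inter> ball s d. \<psi> s' = T (c r' s) (c r' s') (\<psi> s)"
          using d1(1) d2(1) d3(1) by (intro exI[of _ "min d1 (min d2 d3)"]) auto
      qed
      moreover have "\<psi> 0 = F r' 0"
        using F0 r r' flat_on_refl[OF flat r0] by (simp add: \<psi>_def c0)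
      ultimately have "\<psi> 1 = F r' 1"
        using parallel_on_unique[OF connected_Icc flat_c[of r'] _ F[of r'], of \<psi> 0 1] r' by simp
      then show ?thesis by (simp add: \<psi>_def c1)
    qed
    then show "\<exists>d>0. \<forall>s\<in>R \<inter> ball r d. F s 1 = T r s (F r 1)"
      using e(1) by (intro exI[of _ "e/2"]) auto
  qed
  have "F r0 1 = v"
  proof -
    have "c r0 s = r0" for s by (simp add: c_def flip: scaleR_left_distrib)
    then have "parallel_on {0..1} (\<lambda>s s'. T (c r0 s) (c r0 s')) (\<lambda>s. v)"
      using flat_on_refl[OF flat r0] unfolding parallel_on_def by (auto intro: exI[of _ 1])
    then have "F r0 1 = (\<lambda>s. v) 1"
      using parallel_on_unique[OF connected_Icc flat_c[OF r0] F[OF r0], of "\<lambda>s. v" 0 1] F0[OF r0] by simp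
    then show ?thesis .
  qed
  with par show ?thesis by (intro exI[of _ "\<lambda>r. F r 1"]) simp
qed

section \<open>The polylogarithm system and its continuation\<close>

text \<open>
  The right-hand sides of the system: index 0 is the logarithm, index \<open>k \<ge> 1\<close> is \<open>Li\<^sub>k\<close>. The system
  is kept in all weights because its triangular shape is what the inductions use.
\<close>

definition polylog_form :: "(nat \<Rightarrow> complex \<Rightarrow> complex) \<Rightarrow> nat \<Rightarrow> complex \<Rightarrow> complex"
  where "polylog_form g k z =
    (case k of 0 \<Rightarrow> 1 / z | Suc j \<Rightarrow> (case j of 0 \<Rightarrow> 1 / (1 - z) | Suc _ \<Rightarrow> g j z / z))"

lemma polylog_form_simps [simp]:
  "polylog_form g 0 z = 1 / z"
  "polylog_form g (Suc 0) z = 1 / (1 - z)"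
  "polylog_form g (Suc (Suc k)) z = g (Suc k) z / z"
  by (simp_all add: polylog_form_def)

definition polylog_system :: "complex set \<Rightarrow> (nat \<Rightarrow> complex \<Rightarrow> complex) \<Rightarrow> bool"
  where "polylog_system U g \<longleftrightarrow> open U \<and> U \<subseteq> P1_minus \<and>
    (\<forall>k. \<forall>z\<in>U. (g k has_field_derivative polylog_form g k z) (at z))"

lemma polylog_systemD:
  assumes "polylog_system U g"
  shows "open U" "U \<subseteq> P1_minus"
    "z \<in> U \<Longrightarrow> (g k has_field_derivative polylog_form g k z) (at z)"
  using assms by (auto simp: polylog_system_def)

lemma polylog_system_subset:
  "polylog_system U g \<Longrightarrow> open V \<Longrightarrow> V \<subseteq> U \<Longrightarrow> polylog_system V g"
  unfolding polylog_system_def by blast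

lemma polylog_system_continuous: "polylog_system U g \<Longrightarrow> continuous_on U (g k)"
  by (meson DERIV_continuous_on has_field_derivative_at_within polylog_systemD(3))

lemma zero_derivative_imp_eq:
  fixes f :: "complex \<Rightarrow> complex"
  assumes "connected U" "open U" "\<And>w. w \<in> U \<Longrightarrow> (f has_field_derivative 0) (at w)" "a \<in> U" "b \<in> U"
  shows "f a = f b"
  using has_field_derivative_0_imp_constant_on[OF assms(3,1,2)] assms(4,5)
  unfolding constant_on_def by metis

text \<open>
  The difference of the components of index \<open>k\<close> has derivative 0 once those of smaller index agree.
\<close>

lemma polylog_system_unique:
  assumes g: "polylog_system U g" and h: "polylog_system U h" and "connected U"
    and c: "c \<in> U" "\<And>k. g k c = h k c" and "z \<in> U"
  shows "g k z = h k z"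
proof -
  have "\<forall>z\<in>U. g k z = h k z"
  proof (induction k rule: less_induct)
    case (less k)
    have same: "polylog_form g k z = polylog_form h k z" if "z \<in> U" for z
    proof -
      consider "k = 0" | "k = Suc 0" | j where "k = Suc (Suc j)"
        by (metis not0_implies_Suc)
      then show ?thesis
      proof cases
        case 3
        then have "g (Suc j) z = h (Suc j) z" using less.IH[of "Suc j"] that by blast
        then show ?thesis by (simp add: 3)
      qed simp_all
    qed
    have "g k z - h k z = g k c - h k c" if "z \<in> U" for z
    proof (rule zero_derivative_imp_eq[of U "\<lambda>z. g k z - h k z"])
      fix w assume "w \<in> U"
      then show "((\<lambda>z. g k z - h k z) has_field_derivative 0) (at w)"
        using DERIV_diff[OF polylog_systemD(3)[OF g] polylog_systemD(3)[OF h], of w k k] same[of w] by simp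
    qed (use polylog_systemD(1)[OF g] assms(3) c(1) that in auto)
    then show ?case using c(2)[of k] by simp
  qed
  then show ?thesis using \<open>z \<in> U\<close> by blast
qed

definition primitive_from :: "complex set \<Rightarrow> complex \<Rightarrow> (complex \<Rightarrow> complex) \<Rightarrow> complex \<Rightarrow> complex"
  where "primitive_from U c f z =
    (let F = (SOME F. \<forall>z\<in>U. (F has_field_derivative f z) (at z)) in F z - F c)"

text \<open>
  The finite exceptional set serves the integrands with a removable singularity at 0.
\<close>

lemma primitive_from:
  assumes "open U" "starlike U" "finite K" "continuous_on U f"
    and "\<And>z. z \<in> U - K \<Longrightarrow> f field_differentiable at z"
  shows "z \<in> U \<Longrightarrow> (primitive_from U c f has_field_derivative f z) (at z)"
    and "primitive_from U c f c = 0"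
proof -
  define F where "F = (SOME F. \<forall>z\<in>U. (F has_field_derivative f z) (at z))"
  have "\<exists>F. \<forall>z\<in>U. (F has_field_derivative f z) (at z)"
    using holomorphic_starlike_primitive[OF assms(4,2,1,3,5)] by blast
  then have F: "\<forall>z\<in>U. (F has_field_derivative f z) (at z)"
    unfolding F_def by (rule someI_ex)
  have eq: "primitive_from U c f = (\<lambda>z. F z - F c)"
    by (simp add: primitive_from_def F_def fun_eq_iff Let_def)
  show "primitive_from U c f c = 0" by (simp add: eq)
  show "(primitive_from U c f has_field_derivative f z) (at z)" if "z \<in> U"
    unfolding eq using DERIV_diff[OF bspec[OF F that] DERIV_const] by simp
qed

fun polylog_from :: "complex set \<Rightarrow> complex \<Rightarrow> (nat \<Rightarrow> complex) \<Rightarrow> nat \<Rightarrow> complex \<Rightarrow> complex" where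
  "polylog_from U c v 0 z = v 0 + primitive_from U c (\<lambda>w. 1 / w) z"
| "polylog_from U c v (Suc 0) z = v 1 + primitive_from U c (\<lambda>w. 1 / (1 - w)) z"
| "polylog_from U c v (Suc (Suc k)) z =
     v (Suc (Suc k)) + primitive_from U c (\<lambda>w. polylog_from U c v (Suc k) w / w) z"

lemma polylog_from:
  assumes U: "open U" "starlike U" "U \<subseteq> P1_minus"
  shows "polylog_system U (polylog_from U c v)" and "polylog_from U c v k c = v k"
proof -
  have nz: "z \<noteq> 0" "1 - z \<noteq> 0" if "z \<in> U" for z
    using U that by (auto simp: P1_minus_def)
  have *: "(\<forall>z\<in>U. (polylog_from U c v k has_field_derivative polylog_form (polylog_from U c v) k z) (at z))
      \<and> polylog_from U c v k c = v k" for k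
  proof (induction k rule: less_induct)
    case (less k)
    define f where "f = polylog_form (polylog_from U c v) k"
    have eq: "polylog_from U c v k = (\<lambda>z. v k + primitive_from U c f z)"
    proof (rule ext)
      fix z
      have "polylog_form g 0 = (\<lambda>z. 1 / z)" "polylog_form g (Suc 0) = (\<lambda>z. 1 / (1 - z))"
        "polylog_form g (Suc (Suc j)) = (\<lambda>z. g (Suc j) z / z)" for g j
        by (simp_all add: fun_eq_iff)
      then show "polylog_from U c v k z = v k + primitive_from U c f z"
        unfolding f_def by (cases k; cases "k - 1") simp_all
    qed
    have diff: "f field_differentiable at z" if z: "z \<in> U" for z
    proof -
      consider "k = 0" | "k = Suc 0" | j where "k = Suc (Suc j)"
        by (metis not0_implies_Suc)
      then show ?thesis
      proof cases
        case 1
        then have "f = (\<lambda>z. 1 / z)" by (simp add: f_def fun_eq_iff)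
        then show ?thesis using nz[OF z] by (auto intro!: derivative_intros)
      next
        case 2
        then have "f = (\<lambda>z. 1 / (1 - z))" by (simp add: f_def fun_eq_iff)
        then show ?thesis using nz[OF z] by (auto intro!: derivative_intros)
      next
        case 3
        then have "f = (\<lambda>z. polylog_from U c v (Suc j) z / z)" by (simp add: f_def fun_eq_iff)
        moreover have "polylog_from U c v (Suc j) field_differentiable at z"
          using less.IH[of "Suc j"] 3 z by (auto simp: field_differentiable_def)
        ultimately show ?thesis using nz[OF z] by (auto intro!: derivative_intros)
      qed
    qed
    then have "continuous_on U f"
      by (meson continuous_at_imp_continuous_on field_differentiable_imp_continuous_at)
    then have prim: "z \<in> U \<Longrightarrow> (primitive_from U c f has_field_derivative f z) (at z)"
      "primitive_from U c f c = 0" for z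
      using primitive_from[OF U(1,2) finite.emptyI, of f] diff by auto
    have "(polylog_from U c v k has_field_derivative f z) (at z)" if "z \<in> U" for z
      unfolding eq using DERIV_add[OF DERIV_const prim(1)[OF that]] by simp
    moreover have "polylog_from U c v k c = v k"
      using prim(2) by (simp add: eq)
    ultimately show ?case by (simp add: f_def)
  qed
  then show "polylog_from U c v k c = v k" by blast
  show "polylog_system U (polylog_from U c v)"
    unfolding polylog_system_def using U * by blast
qed

lemma open_P1_minus: "open P1_minus"
  unfolding P1_minus_def by (intro open_Compl finite_imp_closed) auto

text \<open>
  A continuation of the polylogarithms along \<open>h\<close>: a function on the parameter set, not on the plane,
  which near each parameter is a local solution composed with \<open>h\<close>.
\<close>

definition polylog_lift :: "('a::metric_space \<Rightarrow> complex) \<Rightarrow> 'a set \<Rightarrow> ('a \<Rightarrow> nat \<Rightarrow> complex) \<Rightarrow> bool"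
  where "polylog_lift h R \<phi> \<longleftrightarrow> (\<forall>r\<in>R. \<exists>U g. polylog_system U g \<and>
    (\<exists>d>0. \<forall>s\<in>R \<inter> ball r d. h s \<in> U \<and> \<phi> s = (\<lambda>k. g k (h s))))"

lemma polylog_liftE:
  assumes "polylog_lift h R \<phi>" "r \<in> R"
  obtains U g d where "polylog_system U g" "d > 0"
    "\<And>s. s \<in> R \<Longrightarrow> dist r s < d \<Longrightarrow> h s \<in> U" "\<And>s. s \<in> R \<Longrightarrow> dist r s < d \<Longrightarrow> \<phi> s = (\<lambda>k. g k (h s))"
proof -
  obtain U g d where *: "polylog_system U g" "d > 0"
    "\<forall>s\<in>R \<inter> ball r d. h s \<in> U \<and> \<phi> s = (\<lambda>k. g k (h s))"
    using assms unfolding polylog_lift_def by blast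
  show ?thesis by (rule that[OF *(1,2)]) (use *(3) in auto)
qed

lemma polylog_lift_ballE:
  assumes "polylog_lift h R \<phi>" "continuous_on R h" "r \<in> R"
  obtains e g d where "e > 0" "polylog_system (ball (h r) e) g" "d > 0"
    "\<And>s. s \<in> R \<Longrightarrow> dist r s < d \<Longrightarrow> h s \<in> ball (h r) e"
    "\<And>s. s \<in> R \<Longrightarrow> dist r s < d \<Longrightarrow> \<phi> s = (\<lambda>k. g k (h s))"
proof -
  obtain U g d where *: "polylog_system U g" "d > 0"
    "\<And>s. s \<in> R \<Longrightarrow> dist r s < d \<Longrightarrow> h s \<in> U" "\<And>s. s \<in> R \<Longrightarrow> dist r s < d \<Longrightarrow> \<phi> s = (\<lambda>k. g k (h s))"
    using polylog_liftE[OF assms(1,3)] by metis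
  have "h r \<in> U" using *(2,3) assms(3) by simp
  then obtain e where e: "e > 0" "ball (h r) e \<subseteq> U"
    using polylog_systemD(1)[OF *(1)] by (meson open_contains_ball)
  obtain d' where d': "d' > 0" "\<forall>s\<in>R. dist s r < d' \<longrightarrow> dist (h s) (h r) < e"
    using assms(2,3) e(1) unfolding continuous_on_iff by blast
  show ?thesis
  proof (rule that[OF e(1) polylog_system_subset[OF *(1) open_ball e(2)]])
    show "min d d' > 0" using * d' by simp
    show "h s \<in> ball (h r) e" if "s \<in> R" "dist r s < min d d'" for s
      using d'(2) that by (auto simp: dist_commute)
    show "\<phi> s = (\<lambda>k. g k (h s))" if "s \<in> R" "dist r s < min d d'" for s
      using *(4) that by auto
  qed
qed

lemma polylog_lift_system:
  assumes "polylog_system U g" "\<And>r. r \<in> R \<Longrightarrow> h r \<in> U" "\<And>r. r \<in> R \<Longrightarrow> \<phi> r = (\<lambda>k. g k (h r))"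
  shows "polylog_lift h R \<phi>"
  unfolding polylog_lift_def using assms
  by (intro ballI exI[of _ U] exI[of _ g] exI[of _ "1::real"] conjI) auto

lemma polylog_lift_compose:
  assumes l: "polylog_lift h R \<phi>" and \<theta>: "continuous_on Q \<theta>" "\<And>q. q \<in> Q \<Longrightarrow> \<theta> q \<in> R"
    and h': "\<And>q. q \<in> Q \<Longrightarrow> h' q = h (\<theta> q)" "\<And>q. q \<in> Q \<Longrightarrow> \<phi>' q = \<phi> (\<theta> q)"
  shows "polylog_lift h' Q \<phi>'"
  unfolding polylog_lift_def
proof
  fix q assume q: "q \<in> Q"
  obtain U g d where *: "polylog_system U g" "d > 0"
    "\<And>s. s \<in> R \<Longrightarrow> dist (\<theta> q) s < d \<Longrightarrow> h s \<in> U"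
    "\<And>s. s \<in> R \<Longrightarrow> dist (\<theta> q) s < d \<Longrightarrow> \<phi> s = (\<lambda>k. g k (h s))"
    using polylog_liftE[OF l \<theta>(2)[OF q]] by metis
  obtain e where e: "e > 0" "\<forall>s\<in>Q. dist s q < e \<longrightarrow> dist (\<theta> s) (\<theta> q) < d"
    using \<theta>(1) q *(2) unfolding continuous_on_iff by blast
  have "h' s \<in> U \<and> \<phi>' s = (\<lambda>k. g k (h' s))" if "s \<in> Q \<inter> ball q e" for s
  proof -
    have s: "s \<in> Q" "dist s q < e" using that by (auto simp: dist_commute)
    then have "dist (\<theta> q) (\<theta> s) < d" using bspec[OF e(2) s(1)] by (simp add: dist_commute)
    then show ?thesis using *(3,4)[of "\<theta> s"] \<theta>(2)[OF s(1)] s(1) by (simp add: h')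
  qed
  then show "\<exists>U g. polylog_system U g \<and> (\<exists>d>0. \<forall>s\<in>Q \<inter> ball q d. h' s \<in> U \<and> \<phi>' s = (\<lambda>k. g k (h' s)))"
    using *(1) e(1) by blast
qed

lemma polylog_lift_subset:
  "polylog_lift h R \<phi> \<Longrightarrow> Q \<subseteq> R \<Longrightarrow> polylog_lift h Q \<phi>"
  by (rule polylog_lift_compose[of h R \<phi> Q "\<lambda>x. x"]) auto

theorem polylog_lift_unique:
  assumes R: "connected R" and h: "continuous_on R h"
    and \<phi>: "polylog_lift h R \<phi>" and \<psi>: "polylog_lift h R \<psi>"
    and ab: "a \<in> R" "\<phi> a = \<psi> a" "b \<in> R"
  shows "\<phi> b = \<psi> b"
proof (rule connected_induction_simple[where P = "\<lambda>r. \<phi> r = \<psi> r", OF R ab(1) ab(3) ab(2)])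
  fix r assume r: "r \<in> R"
  obtain e1 g d1 where g: "e1 > 0" "polylog_system (ball (h r) e1) g" "d1 > 0"
    "\<And>s. s \<in> R \<Longrightarrow> dist r s < d1 \<Longrightarrow> h s \<in> ball (h r) e1"
    "\<And>s. s \<in> R \<Longrightarrow> dist r s < d1 \<Longrightarrow> \<phi> s = (\<lambda>k. g k (h s))"
    using polylog_lift_ballE[OF \<phi> h r] by metis
  obtain e2 f d2 where f: "e2 > 0" "polylog_system (ball (h r) e2) f" "d2 > 0"
    "\<And>s. s \<in> R \<Longrightarrow> dist r s < d2 \<Longrightarrow> h s \<in> ball (h r) e2"
    "\<And>s. s \<in> R \<Longrightarrow> dist r s < d2 \<Longrightarrow> \<psi> s = (\<lambda>k. f k (h s))"
    using polylog_lift_ballE[OF \<psi> h r] by metis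
  define B where "B = ball (h r) (min e1 e2)"
  have sys: "polylog_system B g" "polylog_system B f"
    unfolding B_def
    by (rule polylog_system_subset[OF g(2)] polylog_system_subset[OF f(2)]; simp add: subset_ball)+
  define N where "N = R \<inter> ball r (min d1 d2)"
  have step: "\<phi> y = \<psi> y" if xy: "x \<in> N" "y \<in> N" "\<phi> x = \<psi> x" for x y
  proof -
    have B: "h x \<in> B" "h y \<in> B"
      using xy g(4)[of x] g(4)[of y] f(4)[of x] f(4)[of y] by (simp_all add: N_def B_def)
    have x: "\<phi> x = (\<lambda>k. g k (h x))" "\<psi> x = (\<lambda>k. f k (h x))"
      using xy g(5)[of x] f(5)[of x] by (simp_all add: N_def)
    have y: "\<phi> y = (\<lambda>k. g k (h y))" "\<psi> y = (\<lambda>k. f k (h y))"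
      using xy g(5)[of y] f(5)[of y] by (simp_all add: N_def)
    have "g k (h x) = f k (h x)" for k using x xy(3) by (metis (full_types))
    then have "g k (h y) = f k (h y)" for k
      using polylog_system_unique[OF sys _ B(1) _ B(2)] by (auto simp: B_def)
    then show ?thesis using y by simp
  qed
  show "\<exists>T. openin (top_of_set R) T \<and> r \<in> T \<and> (\<forall>x\<in>T. \<forall>y\<in>T. \<phi> x = \<psi> x \<longrightarrow> \<phi> y = \<psi> y)"
  proof (intro exI[of _ N] conjI ballI impI)
    show "openin (top_of_set R) N" by (simp add: N_def openin_open_Int)
    show "r \<in> N" using r g(3) f(3) by (simp add: N_def)
  qed (rule step)
qed

text \<open>
  The local system is pulled back to \<open>R\<close> by \<open>h\<close>. Around \<open>h r\<close> solutions exist on the disc of radius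
  \<open>\<rho> (h r)\<close>, the distance to 0 and 1; as \<open>\<rho>\<close> is Lipschitz, all discs around points near \<open>h r\<close> contain
  a common smaller disc, on which uniqueness gives the cocycle condition.
\<close>

theorem polylog_lift_exists:
  fixes R :: "'a::real_normed_vector set"
  assumes R: "convex R" and h: "continuous_on R h" "\<And>r. r \<in> R \<Longrightarrow> h r \<in> P1_minus" and r0: "r0 \<in> R"
  shows "\<exists>\<phi>. \<phi> r0 = v \<and> polylog_lift h R \<phi>"
proof -
  define \<rho> where "\<rho> a = min (norm a) (norm (1 - a))" for a :: complex
  have ball_sub: "ball a (\<rho> a) \<subseteq> P1_minus" for a
    by (auto simp: \<rho>_def P1_minus_def dist_norm norm_minus_commute)
  have \<rho>_pos: "\<rho> (h r) > 0" if "r \<in> R" for r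
    using h(2)[OF that] by (auto simp: \<rho>_def P1_minus_def)
  have \<rho>_Lip: "\<rho> a \<le> \<rho> b + dist a b" for a b
    using norm_triangle_sub[of a b] norm_triangle_sub[of "1 - a" "1 - b"]
    by (auto simp: \<rho>_def dist_norm norm_minus_commute min_def)
  define S where "S a v = polylog_from (ball a (\<rho> a)) a v" for a v
  have starl: "starlike (ball (h r) (\<rho> (h r)))" if "r \<in> R" for r
    using \<rho>_pos[OF that] by (intro convex_imp_starlike) auto
  have S: "polylog_system (ball (h r) (\<rho> (h r))) (S (h r) v)" "S (h r) v k (h r) = v k"
    if "r \<in> R" for r v k
    unfolding S_def using polylog_from[OF open_ball starl[OF that] ball_sub] by blast+
  define T where "T a b v = (\<lambda>k. S (h a) v k (h b))" for a b v
  have near: "\<exists>d>0. \<forall>s\<in>R \<inter> ball r d. h s \<in> ball (h r) e" if "r \<in> R" "e > 0" for r e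
  proof -
    obtain d where "d > 0" "\<forall>s\<in>R. dist s r < d \<longrightarrow> dist (h s) (h r) < e"
      using h(1) \<open>r \<in> R\<close> \<open>e > 0\<close> unfolding continuous_on_iff by blast
    then show ?thesis by (intro exI[of _ d]) (auto simp: dist_commute)
  qed
  have flat: "flat_on R T"
    unfolding flat_on_def
  proof (intro ballI conjI allI)
    fix r assume r: "r \<in> R"
    show "T r r v = v" for v using S(2)[OF r] by (simp add: T_def)
    \<comment> \<open>a quarter of the radius: a disc of radius 2e around a point within e of \<open>h r\<close> avoids 0 and 1\<close>
    define e where "e = \<rho> (h r) / 4"
    have "e > 0" using \<rho>_pos[OF r] by (simp add: e_def)
    then obtain d where d: "d > 0" "\<forall>s\<in>R \<inter> ball r d. h s \<in> ball (h r) e"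
      using near[OF r] by blast
    have sub: "ball (h r) e \<subseteq> ball (h a) (\<rho> (h a))" if "a \<in> R \<inter> ball r d" for a
    proof
      fix z assume "z \<in> ball (h r) e"
      moreover have "dist (h r) (h a) < e" using d that by auto
      ultimately have "dist (h a) z < 2 * e"
        using dist_triangle[of "h a" z "h r"] by (simp add: dist_commute)
      also have "2 * e \<le> \<rho> (h a)"
        using \<rho>_Lip[of "h r" "h a"] \<open>dist (h r) (h a) < e\<close> \<open>e > 0\<close> by (simp add: e_def)
      finally show "z \<in> ball (h a) (\<rho> (h a))" by simp
    qed
    have "flat_within (R \<inter> ball r d) T"
      unfolding flat_within_def
    proof (intro ballI allI)
      fix a b c v assume abc: "a \<in> R \<inter> ball r d" "b \<in> R \<inter> ball r d" "c \<in> R \<inter> ball r d"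
      have 1: "polylog_system (ball (h r) e) (S (h a) v)"
        using polylog_system_subset[OF S(1) open_ball sub] abc by blast
      have 2: "polylog_system (ball (h r) e) (S (h b) (T a b v))"
        using polylog_system_subset[OF S(1) open_ball sub] abc by blast
      have in_ball: "h b \<in> ball (h r) e" "h c \<in> ball (h r) e" using d(2) abc by blast+
      have "S (h b) (T a b v) k (h b) = S (h a) v k (h b)" for k
        using S(2)[of b] abc by (simp add: T_def)
      then have "S (h b) (T a b v) k (h c) = S (h a) v k (h c)" for k
        using polylog_system_unique[OF 2 1 _ in_ball(1) _ in_ball(2)] by simp
      then show "T b c (T a b v) = T a c v" by (simp add: T_def)
    qed
    then show "\<exists>d>0. flat_within (R \<inter> ball r d) T" using d(1) by blast
  qed
  obtain \<phi> where \<phi>: "\<phi> r0 = v" "parallel_on R T \<phi>"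
    using parallel_section_exists[OF R flat r0, of v] by blast
  have "polylog_lift h R \<phi>"
    unfolding polylog_lift_def
  proof
    fix r assume r: "r \<in> R"
    obtain d1 where d1: "d1 > 0" "\<forall>s\<in>R \<inter> ball r d1. \<phi> s = T r s (\<phi> r)"
      using parallel_onE[OF \<phi>(2) r] by blast
    obtain d2 where d2: "d2 > 0" "\<forall>s\<in>R \<inter> ball r d2. h s \<in> ball (h r) (\<rho> (h r))"
      using near[OF r \<rho>_pos[OF r]] by blast
    have "h s \<in> ball (h r) (\<rho> (h r)) \<and> \<phi> s = (\<lambda>k. S (h r) (\<phi> r) k (h s))"
      if "s \<in> R \<inter> ball r (min d1 d2)" for s
      using bspec[OF d1(2), of s] bspec[OF d2(2), of s] that by (simp add: T_def)
    then show "\<exists>U g. polylog_system U g \<and>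
        (\<exists>d>0. \<forall>s\<in>R \<inter> ball r d. h s \<in> U \<and> \<phi> s = (\<lambda>k. g k (h s)))"
      using S(1)[OF r, of "\<phi> r"] d1(1) d2(1)
      by (intro exI[of _ "ball (h r) (\<rho> (h r))"] exI[of _ "S (h r) (\<phi> r)"] conjI
                exI[of _ "min d1 d2"] ballI) simp_all
  qed
  with \<phi>(1) show ?thesis by blast
qed

section \<open>Transport of solutions along paths with tangential ends\<close>

text \<open>
  Continuation along \<open>p\<close> of the germ of \<open>g\<close> at the start arrives as the germ of \<open>h\<close> at the end. Only
  the values near the ends enter, so this makes sense for tangential base points.
\<close>

definition transports ::
    "(real \<Rightarrow> complex) \<Rightarrow> (nat \<Rightarrow> complex \<Rightarrow> complex) \<Rightarrow> (nat \<Rightarrow> complex \<Rightarrow> complex) \<Rightarrow> bool"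
  where "transports p g h \<longleftrightarrow> (\<exists>\<phi>. polylog_lift p {0<..<1} \<phi> \<and>
    (\<forall>\<^sub>F t in at_right 0. \<phi> t = (\<lambda>k. g k (p t))) \<and>
    (\<forall>\<^sub>F t in at_left 1. \<phi> t = (\<lambda>k. h k (p t))))"

lemma base_pathsD:
  assumes "p \<in> base_paths W S T"
  shows "continuous_on {0<..<1} p" "t \<in> {0<..<1} \<Longrightarrow> p t \<in> W"
    "filterlim p S (at_right 0)" "filterlim p T (at_left 1)"
  using assms by (auto simp: base_paths_def)

lemma eventually_at_right_0_iff:
  "(\<forall>\<^sub>F t in at_right (0::real). P t) \<longleftrightarrow> (\<exists>b. 0 < b \<and> b < 1 \<and> (\<forall>t. 0 < t \<longrightarrow> t \<le> b \<longrightarrow> P t))"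
proof
  assume "\<forall>\<^sub>F t in at_right (0::real). P t"
  then obtain b where "b > 0" "\<forall>t>0. t < b \<longrightarrow> P t" unfolding eventually_at_right_field by blast
  then show "\<exists>b. 0 < b \<and> b < 1 \<and> (\<forall>t. 0 < t \<longrightarrow> t \<le> b \<longrightarrow> P t)"
    by (intro exI[of _ "min (b/2) (1/2)"]) auto
next
  assume "\<exists>b. 0 < b \<and> b < 1 \<and> (\<forall>t. 0 < t \<longrightarrow> t \<le> b \<longrightarrow> P t)"
  then obtain b where "0 < b" "\<forall>t. 0 < t \<longrightarrow> t \<le> b \<longrightarrow> P t" by blast
  then show "\<forall>\<^sub>F t in at_right (0::real). P t"
    unfolding eventually_at_right_field by (intro exI[of _ b]) auto
qed

lemma eventually_at_left_1_iff:
  "(\<forall>\<^sub>F t in at_left (1::real). P t) \<longleftrightarrow> (\<exists>b. 0 < b \<and> b < 1 \<and> (\<forall>t. b \<le> t \<longrightarrow> t < 1 \<longrightarrow> P t))"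
proof
  assume "\<forall>\<^sub>F t in at_left (1::real). P t"
  then obtain b where "b < 1" "\<forall>t>b. t < 1 \<longrightarrow> P t" unfolding eventually_at_left_field by blast
  then show "\<exists>b. 0 < b \<and> b < 1 \<and> (\<forall>t. b \<le> t \<longrightarrow> t < 1 \<longrightarrow> P t)"
    by (intro exI[of _ "max ((1+b)/2) (1/2)"]) auto
next
  assume "\<exists>b. 0 < b \<and> b < 1 \<and> (\<forall>t. b \<le> t \<longrightarrow> t < 1 \<longrightarrow> P t)"
  then obtain b where "b < 1" "\<forall>t. b \<le> t \<longrightarrow> t < 1 \<longrightarrow> P t" by blast
  then show "\<forall>\<^sub>F t in at_left (1::real). P t"
    unfolding eventually_at_left_field by (intro exI[of _ b]) auto
qed

text \<open>
  Convergence uniform in the first coordinate, as required of homotopies at their ends.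
\<close>

lemma eventually_principal_prod:
  "eventually P (principal A \<times>\<^sub>F F) \<longleftrightarrow> (\<forall>\<^sub>F y in F. \<forall>x\<in>A. P (x, y))"
proof
  assume "eventually P (principal A \<times>\<^sub>F F)"
  then obtain Pf Pg where P: "eventually Pf (principal A)" "eventually Pg F"
      "\<forall>x y. Pf x \<longrightarrow> Pg y \<longrightarrow> P (x, y)"
    unfolding eventually_prod_filter by blast
  have "\<forall>x\<in>A. Pf x" using P(1) by (simp add: eventually_principal)
  with P(3) have "\<forall>x\<in>A. P (x, y)" if "Pg y" for y using that by blast
  then show "\<forall>\<^sub>F y in F. \<forall>x\<in>A. P (x, y)" using P(2) by (simp add: eventually_mono)
next
  assume "\<forall>\<^sub>F y in F. \<forall>x\<in>A. P (x, y)"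
  then show "eventually P (principal A \<times>\<^sub>F F)"
    unfolding eventually_prod_filter
    by (intro exI[of _ "\<lambda>x. x \<in> A"] exI[of _ "\<lambda>y. \<forall>x\<in>A. P (x, y)"]) (auto simp: eventually_principal)
qed

lemma lift_agree_at_start:
  fixes p :: "real \<Rightarrow> complex"
  assumes p: "continuous_on {0<..<1} p"
    and "polylog_lift p {0<..<1} \<phi>" "\<forall>\<^sub>F t in at_right 0. \<phi> t = (\<lambda>k. g k (p t))"
    and "polylog_lift p {0<..<1} \<psi>" "\<forall>\<^sub>F t in at_right 0. \<psi> t = (\<lambda>k. g k (p t))"
    and "t \<in> {0<..<1}"
  shows "\<phi> t = \<psi> t"
proof -
  have "\<forall>\<^sub>F t in at_right 0. \<phi> t = \<psi> t"
    using assms(3,5) by eventually_elim simp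
  then obtain b where "0 < b" "b < 1" "\<phi> b = \<psi> b"
    unfolding eventually_at_right_0_iff by blast
  then show ?thesis
    using polylog_lift_unique[OF _ p assms(2,4), of b t] \<open>t \<in> {0<..<1}\<close> by auto
qed

text \<open>
  By uniqueness of continuation, any lift with the right start can be used.
\<close>

lemma transports_lift:
  assumes p: "continuous_on {0<..<1} p" and "transports p g h"
    and \<phi>: "polylog_lift p {0<..<1} \<phi>" "\<forall>\<^sub>F t in at_right 0. \<phi> t = (\<lambda>k. g k (p t))"
  shows "\<forall>\<^sub>F t in at_left 1. \<phi> t = (\<lambda>k. h k (p t))"
proof -
  obtain \<psi> where \<psi>: "polylog_lift p {0<..<1} \<psi>" "\<forall>\<^sub>F t in at_right 0. \<psi> t = (\<lambda>k. g k (p t))"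
      "\<forall>\<^sub>F t in at_left 1. \<psi> t = (\<lambda>k. h k (p t))"
    using assms(2) unfolding transports_def by blast
  have "\<forall>\<^sub>F t in at_left 1. t \<in> {0<..<(1::real)}"
    unfolding eventually_at_left_1_iff by (intro exI[of _ "1/2"]) auto
  with \<psi>(3) show ?thesis
  proof eventually_elim
    case (elim t)
    then show ?case using lift_agree_at_start[OF p \<phi> \<psi>(1,2)] by simp
  qed
qed

lemma lift_from_start_exists:
  fixes p :: "real \<Rightarrow> complex"
  assumes p: "continuous_on {0<..<1} p" "\<And>t. t \<in> {0<..<1} \<Longrightarrow> p t \<in> P1_minus"
    and g: "polylog_system U g" "\<forall>\<^sub>F t in at_right 0. p t \<in> U"
  obtains \<phi> where "polylog_lift p {0<..<1} \<phi>" "\<forall>\<^sub>F t in at_right 0. \<phi> t = (\<lambda>k. g k (p t))"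
proof -
  obtain b where b: "0 < b" "b < 1" "\<And>t. 0 < t \<Longrightarrow> t \<le> b \<Longrightarrow> p t \<in> U"
    using g(2) unfolding eventually_at_right_0_iff by blast
  obtain \<phi> where \<phi>: "\<phi> b = (\<lambda>k. g k (p b))" "polylog_lift p {0<..<1} \<phi>"
    using polylog_lift_exists[OF _ p, of b "\<lambda>k. g k (p b)"] b by auto
  have "\<phi> t = (\<lambda>k. g k (p t))" if t: "0 < t" "t \<le> b" for t
  proof (rule polylog_lift_unique[of "{0<..b}" p \<phi> "\<lambda>t k. g k (p t)" b t])
    show "continuous_on {0<..b} p" using p(1) b by (auto intro: continuous_on_subset)
    show "polylog_lift p {0<..b} \<phi>" using \<phi>(2) b by (auto intro: polylog_lift_subset)
    show "polylog_lift p {0<..b} (\<lambda>t k. g k (p t))"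
      by (rule polylog_lift_system[OF g(1)]) (auto intro: b(3))
  qed (use b t \<phi>(1) in auto)
  then have "\<forall>\<^sub>F t in at_right 0. \<phi> t = (\<lambda>k. g k (p t))"
    unfolding eventually_at_right_0_iff using b(1,2) by blast
  with \<phi>(2) that show ?thesis by blast
qed

lemma transports_to_point_exists:
  assumes p: "p \<in> base_paths P1_minus S (nhds z)" and z: "z \<in> P1_minus"
    and g: "polylog_system U g" "\<forall>\<^sub>F w in S. w \<in> U"
  obtains V h where "polylog_system V h" "z \<in> V" "transports p g h"
proof -
  have "\<forall>\<^sub>F t in at_right 0. p t \<in> U"
    using base_pathsD(3)[OF p] g(2) by (rule filterlim_iff[THEN iffD1, rule_format])
  then obtain \<phi> where \<phi>: "polylog_lift p {0<..<1} \<phi>" "\<forall>\<^sub>F t in at_right 0. \<phi> t = (\<lambda>k. g k (p t))"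
    using lift_from_start_exists[OF base_pathsD(1,2)[OF p] g(1)] by metis
  obtain e where e: "e > 0" "ball z e \<subseteq> P1_minus"
    using z open_P1_minus by (meson open_contains_ball)
  have "\<forall>\<^sub>F w in nhds z. w \<in> ball z e" using e by (intro eventually_nhds_in_open) auto
  then have "\<forall>\<^sub>F t in at_left 1. p t \<in> ball z e"
    using base_pathsD(4)[OF p] by (rule filterlim_iff[THEN iffD1, rule_format, rotated])
  then obtain b where b: "0 < b" "b < 1" "\<And>t. b \<le> t \<Longrightarrow> t < 1 \<Longrightarrow> p t \<in> ball z e"
    unfolding eventually_at_left_1_iff by blast
  define h where "h = polylog_from (ball z e) (p b) (\<phi> b)"
  have star: "starlike (ball z e)" using e by (intro convex_imp_starlike) auto
  have h: "polylog_system (ball z e) h" "h k (p b) = \<phi> b k" for k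
    unfolding h_def using polylog_from[OF open_ball star e(2)] by blast+
  have "\<phi> t = (\<lambda>k. h k (p t))" if t: "b \<le> t" "t < 1" for t
  proof (rule polylog_lift_unique[of "{b..<1}" p \<phi> "\<lambda>t k. h k (p t)" b t])
    show "continuous_on {b..<1} p" using base_pathsD(1)[OF p] b by (auto intro: continuous_on_subset)
    show "polylog_lift p {b..<1} \<phi>" using \<phi>(1) b by (auto intro: polylog_lift_subset)
    show "polylog_lift p {b..<1} (\<lambda>t k. h k (p t))"
      by (rule polylog_lift_system[OF h(1)]) (auto intro: b(3)[unfolded mem_ball])
  qed (use b t h(2) in auto)
  then have "\<forall>\<^sub>F t in at_left 1. \<phi> t = (\<lambda>k. h k (p t))"
    unfolding eventually_at_left_1_iff using b(1,2) by blast
  with \<phi> have "transports p g h" unfolding transports_def by blast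
  with h(1) e(1) that show ?thesis by (meson centre_in_ball)
qed

text \<open>
  Continue over the whole rectangle of the homotopy. Uniformly in the homotopy parameter, the strip
  near time 0 is mapped to \<open>U\<close> and the strip near time 1 to \<open>V\<close>. The strips are connected, so on them
  the continuation is the solution \<open>g\<close> respectively \<open>h\<close>, since this holds on the side of \<open>p\<close>.
\<close>

theorem transports_homotopic:
  assumes "path_homotopic P1_minus S T p q"
    and g: "polylog_system U g" "\<forall>\<^sub>F w in S. w \<in> U"
    and h: "polylog_system V h" "\<forall>\<^sub>F w in T. w \<in> V"
    and p: "transports p g h"
  shows "transports q g h"
proof -
  obtain H :: "real \<times> real \<Rightarrow> complex" where
    H: "continuous_on ({0..1} \<times> {0<..<1}) H" "H ` ({0..1} \<times> {0<..<1}) \<subseteq> P1_minus"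
      "\<And>t. t \<in> {0<..<1} \<Longrightarrow> H (0, t) = p t" "\<And>t. t \<in> {0<..<1} \<Longrightarrow> H (1, t) = q t"
      "filterlim H S (principal {0..1} \<times>\<^sub>F at_right 0)" "filterlim H T (principal {0..1} \<times>\<^sub>F at_left 1)"
    and pp: "p \<in> base_paths P1_minus S T"
    using assms(1) unfolding path_homotopic_def by blast
  have "eventually (\<lambda>x. H x \<in> U) (principal {0..1} \<times>\<^sub>F at_right 0)"
    using H(5) g(2) by (rule filterlim_iff[THEN iffD1, rule_format])
  then obtain a where a: "0 < a" "a < 1" "\<And>s t. \<lbrakk>0 < t; t \<le> a; s \<in> {0..1}\<rbrakk> \<Longrightarrow> H (s, t) \<in> U"
    unfolding eventually_principal_prod eventually_at_right_0_iff by blast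
  have "eventually (\<lambda>x. H x \<in> V) (principal {0..1} \<times>\<^sub>F at_left 1)"
    using H(6) h(2) by (rule filterlim_iff[THEN iffD1, rule_format])
  then obtain b where b: "0 < b" "b < 1" "\<And>s t. \<lbrakk>b \<le> t; t < 1; s \<in> {0..1}\<rbrakk> \<Longrightarrow> H (s, t) \<in> V"
    unfolding eventually_principal_prod eventually_at_left_1_iff by blast
  define R where "R = {0..1::real} \<times> {0<..<1::real}"
  have "convex R" unfolding R_def by (intro convex_Times) auto
  then obtain \<Phi> where \<Phi>: "\<Phi> (0, a) = (\<lambda>k. g k (H (0, a)))" "polylog_lift H R \<Phi>"
    using polylog_lift_exists[of R H "(0, a)" "\<lambda>k. g k (H (0, a))"] H(1,2) a by (auto simp: R_def)
  have start: "\<Phi> (s, t) = (\<lambda>k. g k (H (s, t)))" if "s \<in> {0..1}" "0 < t" "t \<le> a" for s t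
  proof (rule polylog_lift_unique[of "{0..1} \<times> {0<..a}" H \<Phi> "\<lambda>x k. g k (H x)" "(0, a)"])
    show "connected ({0..1::real} \<times> {0<..a})" by (intro connected_Times) auto
    show "continuous_on ({0..1} \<times> {0<..a}) H"
      using H(1) a by (auto intro: continuous_on_subset)
    show "polylog_lift H ({0..1} \<times> {0<..a}) \<Phi>"
      using a by (intro polylog_lift_subset[OF \<Phi>(2)]) (auto simp: R_def)
    show "polylog_lift H ({0..1} \<times> {0<..a}) (\<lambda>x k. g k (H x))"
      by (rule polylog_lift_system[OF g(1)]) (use a in auto)
  qed (use that a \<Phi> in auto)
  have slice: "polylog_lift f {0<..<1} (\<lambda>t. \<Phi> (s, t))"
    if "s \<in> {0..1}" "\<And>t. t \<in> {0<..<1} \<Longrightarrow> f t = H (s, t)" for s f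
    using that by (intro polylog_lift_compose[OF \<Phi>(2), of _ "\<lambda>t. (s, t)"] continuous_intros) (auto simp: R_def)
  have start': "\<forall>\<^sub>F t in at_right 0. \<Phi> (s, t) = (\<lambda>k. g k (f t))"
    if "s \<in> {0..1}" "\<And>t. t \<in> {0<..<1} \<Longrightarrow> f t = H (s, t)" for s f
    unfolding eventually_at_right_0_iff
    using a start that by (intro exI[of _ a]) auto
  have "\<forall>\<^sub>F t in at_left 1. \<Phi> (0, t) = (\<lambda>k. h k (p t))"
    using H(3) by (intro transports_lift[OF base_pathsD(1)[OF pp] p slice start']) auto
  then obtain c where c: "0 < c" "c < 1" "\<And>t. \<lbrakk>c \<le> t; t < 1\<rbrakk> \<Longrightarrow> \<Phi> (0, t) = (\<lambda>k. h k (p t))"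
    unfolding eventually_at_left_1_iff by blast
  define m where "m = max b c"
  have m: "0 < m" "m < 1" "b \<le> m" "c \<le> m" using b c by (auto simp: m_def)
  have "\<Phi> (s, t) = (\<lambda>k. h k (H (s, t)))" if "s \<in> {0..1}" "m \<le> t" "t < 1" for s t
  proof (rule polylog_lift_unique[of "{0..1} \<times> {m..<1}" H \<Phi> "\<lambda>x k. h k (H x)" "(0, m)"])
    show "connected ({0..1::real} \<times> {m..<1})" by (intro connected_Times) auto
    show "continuous_on ({0..1} \<times> {m..<1}) H"
      using H(1) m by (auto intro: continuous_on_subset)
    show "polylog_lift H ({0..1} \<times> {m..<1}) \<Phi>"
      using m by (intro polylog_lift_subset[OF \<Phi>(2)]) (auto simp: R_def)
    show "polylog_lift H ({0..1} \<times> {m..<1}) (\<lambda>x k. h k (H x))"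
      by (rule polylog_lift_system[OF h(1)]) (use b m in auto)
    show "\<Phi> (0, m) = (\<lambda>k. h k (H (0, m)))" using c(3)[of m] H(3)[of m] m by simp
  qed (use that m in auto)
  then have "\<forall>\<^sub>F t in at_left 1. \<Phi> (1, t) = (\<lambda>k. h k (q t))"
    unfolding eventually_at_left_1_iff
    using m H(4) by (intro exI[of _ m]) auto
  moreover have "polylog_lift q {0<..<1} (\<lambda>t. \<Phi> (1, t))" "\<forall>\<^sub>F t in at_right 0. \<Phi> (1, t) = (\<lambda>k. g k (q t))"
    using slice[of 1 q] start'[of 1 q] H(4) by auto
  ultimately show ?thesis unfolding transports_def by blast
qed

lemma transports_reversepath:
  assumes "transports p g h"
  shows "transports (reversepath p) h g"
proof -
  obtain \<phi> where \<phi>: "polylog_lift p {0<..<1} \<phi>" "\<forall>\<^sub>F t in at_right 0. \<phi> t = (\<lambda>k. g k (p t))"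
      "\<forall>\<^sub>F t in at_left 1. \<phi> t = (\<lambda>k. h k (p t))"
    using assms unfolding transports_def by blast
  have "polylog_lift (reversepath p) {0<..<1} (\<lambda>t. \<phi> (1 - t))"
    by (rule polylog_lift_compose[OF \<phi>(1), of _ "\<lambda>t. 1 - t"])
      (auto simp: reversepath_def intro!: continuous_intros)
  moreover have "\<forall>\<^sub>F t in at_right 0. \<phi> (1 - t) = (\<lambda>k. h k (reversepath p t))"
  proof -
    obtain b where "0 < b" "b < 1" "\<forall>t. b \<le> t \<longrightarrow> t < 1 \<longrightarrow> \<phi> t = (\<lambda>k. h k (p t))"
      using \<phi>(3) unfolding eventually_at_left_1_iff by blast
    then show ?thesis unfolding eventually_at_right_0_iff
      by (intro exI[of _ "1 - b"]) (auto simp: reversepath_def)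
  qed
  moreover have "\<forall>\<^sub>F t in at_left 1. \<phi> (1 - t) = (\<lambda>k. g k (reversepath p t))"
  proof -
    obtain b where "0 < b" "b < 1" "\<forall>t. 0 < t \<longrightarrow> t \<le> b \<longrightarrow> \<phi> t = (\<lambda>k. g k (p t))"
      using \<phi>(2) unfolding eventually_at_right_0_iff by blast
    then show ?thesis unfolding eventually_at_left_1_iff
      by (intro exI[of _ "1 - b"]) (auto simp: reversepath_def)
  qed
  ultimately show ?thesis unfolding transports_def by blast
qed

text \<open>
  At the junction the two pieces need not come with the same local solution; comparing both with a
  continuation over the whole interval avoids matching them.
\<close>

lemma polylog_lift_glue:
  fixes p :: "real \<Rightarrow> complex"
  assumes p: "continuous_on {0<..<1} p" and c: "0 < c" "c < 1"
    and \<phi>: "polylog_lift p {0<..c} \<phi>" and \<psi>: "polylog_lift p {c..<1} \<psi>" and eq: "\<phi> c = \<psi> c"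
  shows "polylog_lift p {0<..<1} (\<lambda>t. if t \<le> c then \<phi> t else \<psi> t)" (is "polylog_lift _ _ ?\<omega>")
proof -
  obtain \<Phi> where \<Phi>: "\<Phi> c = \<phi> c" "polylog_lift p {0<..<1} \<Phi>"
  proof -
    have P1: "p t \<in> P1_minus" if t: "t \<in> {0<..<1}" for t
    proof (cases "t \<le> c")
      case True
      then obtain U g d where "polylog_system U g" "d > 0"
        "\<And>s. s \<in> {0<..c} \<Longrightarrow> dist t s < d \<Longrightarrow> p s \<in> U"
        using polylog_liftE[OF \<phi>, of t] t by (metis greaterThanAtMost_iff greaterThanLessThan_iff)
      then show ?thesis using polylog_systemD(2) t True
        by (metis dist_self greaterThanAtMost_iff greaterThanLessThan_iff subsetD)
    next
      case False
      then obtain U g d where "polylog_system U g" "d > 0"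
        "\<And>s. s \<in> {c..<1} \<Longrightarrow> dist t s < d \<Longrightarrow> p s \<in> U"
        using polylog_liftE[OF \<psi>, of t] t by (metis atLeastLessThan_iff greaterThanLessThan_iff linorder_le_cases)
      then show ?thesis using polylog_systemD(2) t False
        by (metis dist_self atLeastLessThan_iff greaterThanLessThan_iff linorder_le_cases subsetD)
    qed
    show ?thesis
      using polylog_lift_exists[OF _ p P1, of c "\<phi> c"] c that by auto
  qed
  have "\<Phi> t = \<phi> t" if "0 < t" "t \<le> c" for t
  proof (rule polylog_lift_unique[of "{0<..c}" p \<Phi> \<phi> c t])
    show "continuous_on {0<..c} p" using p c by (auto intro: continuous_on_subset)
    show "polylog_lift p {0<..c} \<Phi>" using c by (intro polylog_lift_subset[OF \<Phi>(2)]) auto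
  qed (use c that \<phi> \<Phi> in auto)
  moreover have "\<Phi> t = \<psi> t" if "c \<le> t" "t < 1" for t
  proof (rule polylog_lift_unique[of "{c..<1}" p \<Phi> \<psi> c t])
    show "continuous_on {c..<1} p" using p c by (auto intro: continuous_on_subset)
    show "polylog_lift p {c..<1} \<Phi>" using c by (intro polylog_lift_subset[OF \<Phi>(2)]) auto
  qed (use c that \<psi> \<Phi> eq in auto)
  ultimately show ?thesis
    by (intro polylog_lift_compose[OF \<Phi>(2), of _ "\<lambda>t. t"]) auto
qed

text \<open>
  The halves meet in 1/2 and are closed in the open interval.
\<close>

lemma continuous_on_halves:
  fixes p :: "real \<Rightarrow> 'a::topological_space"
  assumes "continuous_on {0<..1/2} p" "continuous_on {1/2..<1} p"
  shows "continuous_on {0<..<1} p"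
proof -
  have un: "{0<..1/2} \<union> {1/2..<1} = {0<..<(1::real)}" by auto
  have "{0<..1/2} = {0<..<(1::real)} \<inter> {..1/2}" "{1/2..<1} = {0<..<(1::real)} \<inter> {1/2..}" by auto
  then have "closedin (top_of_set {0<..<1}) {0<..1/2::real}" "closedin (top_of_set {0<..<1}) {1/2..<1::real}"
    by (metis closed_atMost closedin_closed_Int, metis closed_atLeast closedin_closed_Int)
  then show ?thesis using continuous_on_Un_local[of "{0<..1/2}" "{1/2..<1}" p] assms by (simp add: un)
qed

text \<open>
  \<open>\<sigma>\<close> and \<open>\<tau>\<close> are the two paths in the definition of the product; they share the detour \<open>r\<close>, run
  in opposite directions.
\<close>

lemma path_mult_halves:
  fixes p r :: "real \<Rightarrow> 'a::real_normed_vector"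
  assumes "r 0 = p (1/2)"
  defines "\<sigma> \<equiv> subpath 0 (1/2) p +++ r" and "\<tau> \<equiv> reversepath r +++ subpath (1/2) 1 p"
  shows "t \<le> 1/2 \<Longrightarrow> p t = \<sigma> t" "1/2 \<le> t \<Longrightarrow> p t = \<tau> t" "t \<le> 1/2 \<Longrightarrow> \<tau> t = \<sigma> (1 - t)"
proof -
  show "p t = \<sigma> t" if "t \<le> 1/2"
    using that by (simp add: \<sigma>_def joinpaths_def subpath_def)
  show "p t = \<tau> t" if "1/2 \<le> t"
  proof (cases "t = 1/2")
    case True
    show ?thesis unfolding True using assms(1) by (simp add: \<tau>_def joinpaths_def reversepath_def)
  next
    case False
    then have "(1 - 1/2) * (2 * t - 1) + 1/2 = t" by (simp add: field_simps)
    then show ?thesis using False that by (simp add: \<tau>_def joinpaths_def subpath_def)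
  qed
  show "\<tau> t = \<sigma> (1 - t)" if "t \<le> 1/2"
  proof (cases "t = 1/2")
    case True
    show ?thesis unfolding True using assms(1)
      by (simp add: \<sigma>_def \<tau>_def joinpaths_def subpath_def reversepath_def)
  next
    case False
    then show ?thesis using that
      by (simp add: \<sigma>_def \<tau>_def joinpaths_def subpath_def reversepath_def algebra_simps)
  qed
qed

theorem path_mult_base_paths:
  assumes "p \<in> A \<odot> B" "A \<subseteq> base_paths W S T" "B \<subseteq> base_paths W T Z"
  shows "p \<in> base_paths W S Z"
proof -
  obtain r where r: "r 0 = p (1/2)" "subpath 0 (1/2) p +++ r \<in> A" "reversepath r +++ subpath (1/2) 1 p \<in> B"
    using assms(1) unfolding path_mult_def by blast
  define \<sigma> where "\<sigma> = subpath 0 (1/2) p +++ r"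
  define \<tau> where "\<tau> = reversepath r +++ subpath (1/2) 1 p"
  have \<sigma>: "\<sigma> \<in> base_paths W S T" and \<tau>: "\<tau> \<in> base_paths W T Z"
    using r assms by (auto simp: \<sigma>_def \<tau>_def)
  note half = path_mult_halves[where p = p and r = r, OF r(1), folded \<sigma>_def \<tau>_def]
  have "continuous_on {0<..<1} p"
  proof (rule continuous_on_halves)
    have "continuous_on {0<..1/2} \<sigma>" "continuous_on {1/2..<1} \<tau>"
      using base_pathsD(1)[OF \<sigma>] base_pathsD(1)[OF \<tau>] by (auto elim!: continuous_on_subset)
    then show "continuous_on {0<..1/2} p" "continuous_on {1/2..<1} p"
      by (auto elim!: continuous_on_eq simp: half(1,2))
  qed
  moreover have "p t \<in> W" if "t \<in> {0<..<1}" for t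
    using base_pathsD(2)[OF \<sigma> that] base_pathsD(2)[OF \<tau> that] half(1,2)[of t]
    by (cases "t \<le> 1/2") auto
  moreover have "filterlim p S (at_right 0)"
  proof -
    have "\<forall>\<^sub>F t in at_right 0. p t = \<sigma> t"
      unfolding eventually_at_right_0_iff by (intro exI[of _ "1/2"]) (auto simp: half(1))
    then show ?thesis using base_pathsD(3)[OF \<sigma>] by (simp cong: filterlim_cong)
  qed
  moreover have "filterlim p Z (at_left 1)"
  proof -
    have "\<forall>\<^sub>F t in at_left 1. p t = \<tau> t"
      unfolding eventually_at_left_1_iff by (intro exI[of _ "1/2"]) (auto simp: half(2))
    then show ?thesis using base_pathsD(4)[OF \<tau>] by (simp cong: filterlim_cong)
  qed
  ultimately show ?thesis unfolding base_paths_def by auto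
qed

text \<open>
  Continuation along \<open>\<sigma>\<close> ends, at the intermediate base point, with \<open>h\<close>, which is where continuation
  along \<open>\<tau>\<close> starts. Running back along the detour shows that the two continuations agree at the
  midpoint of \<open>p\<close>, where they are glued.
\<close>

theorem transports_path_mult:
  assumes "p \<in> A \<odot> B" and A: "A \<subseteq> base_paths P1_minus S T" and B: "B \<subseteq> base_paths P1_minus T Z"
    and gA: "\<And>q. q \<in> A \<Longrightarrow> transports q g h" and hB: "\<And>q. q \<in> B \<Longrightarrow> transports q h k"
  shows "transports p g k"
proof -
  obtain r where r: "r 0 = p (1/2)" "subpath 0 (1/2) p +++ r \<in> A" "reversepath r +++ subpath (1/2) 1 p \<in> B"
    using assms(1) unfolding path_mult_def by blast
  define \<sigma> where "\<sigma> = subpath 0 (1/2) p +++ r"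
  define \<tau> where "\<tau> = reversepath r +++ subpath (1/2) 1 p"
  note half = path_mult_halves[where p = p and r = r, OF r(1), folded \<sigma>_def \<tau>_def]
  have p: "p \<in> base_paths P1_minus S Z" using path_mult_base_paths[OF assms(1) A B] .
  have \<tau>: "\<tau> \<in> base_paths P1_minus T Z" using r(3) B by (auto simp: \<tau>_def)
  obtain \<phi> where \<phi>: "polylog_lift \<sigma> {0<..<1} \<phi>" "\<forall>\<^sub>F t in at_right 0. \<phi> t = (\<lambda>k. g k (\<sigma> t))"
      "\<forall>\<^sub>F t in at_left 1. \<phi> t = (\<lambda>k. h k (\<sigma> t))"
    using gA[OF r(2)] unfolding \<sigma>_def[symmetric] transports_def by blast
  obtain \<psi> where \<psi>: "polylog_lift \<tau> {0<..<1} \<psi>" "\<forall>\<^sub>F t in at_right 0. \<psi> t = (\<lambda>k. h k (\<tau> t))"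
      "\<forall>\<^sub>F t in at_left 1. \<psi> t = (\<lambda>j. k j (\<tau> t))"
    using hB[OF r(3)] unfolding \<tau>_def[symmetric] transports_def by blast
  obtain a where a: "0 < a" "a < 1" "\<forall>t. 0 < t \<longrightarrow> t \<le> a \<longrightarrow> \<psi> t = (\<lambda>k. h k (\<tau> t))"
    using \<psi>(2) unfolding eventually_at_right_0_iff by blast
  obtain b where b: "0 < b" "b < 1" "\<forall>t. b \<le> t \<longrightarrow> t < 1 \<longrightarrow> \<phi> t = (\<lambda>k. h k (\<sigma> t))"
    using \<phi>(3) unfolding eventually_at_left_1_iff by blast
  define c where "c = min (min a (1 - b)) (1/2)"
  have c: "0 < c" "c \<le> a" "c \<le> 1 - b" "c \<le> 1/2" using a(1,2) b(1,2) unfolding c_def by linarith+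
  have mid: "\<phi> (1/2) = \<psi> (1/2)"
  proof -
    have "\<phi> (1 - 1/2) = \<psi> (1/2)"
    proof (rule polylog_lift_unique[of "{0<..1/2}" \<tau> "\<lambda>t. \<phi> (1 - t)" \<psi> c "1/2"])
      show "continuous_on {0<..1/2} \<tau>"
        using base_pathsD(1)[OF \<tau>] by (auto elim!: continuous_on_subset)
      show "polylog_lift \<tau> {0<..1/2} (\<lambda>t. \<phi> (1 - t))"
        by (rule polylog_lift_compose[OF \<phi>(1), of _ "\<lambda>t. 1 - t"])
          (auto simp: half(3) intro!: continuous_intros)
      show "polylog_lift \<tau> {0<..1/2} \<psi>" by (rule polylog_lift_subset[OF \<psi>(1)]) auto
      show "\<phi> (1 - c) = \<psi> c" using a(3) b(3) c half(3)[of c] by auto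
    qed (use c in auto)
    then show ?thesis by simp
  qed
  define \<omega> where "\<omega> t = (if t \<le> 1/2 then \<phi> t else \<psi> t)" for t
  have "polylog_lift p {0<..<1} \<omega>"
    unfolding \<omega>_def
  proof (rule polylog_lift_glue[OF base_pathsD(1)[OF p]])
    show "polylog_lift p {0<..1/2} \<phi>"
      by (rule polylog_lift_compose[OF \<phi>(1), of _ "\<lambda>t. t"]) (auto simp: half(1))
    show "polylog_lift p {1/2..<1} \<psi>"
      by (rule polylog_lift_compose[OF \<psi>(1), of _ "\<lambda>t. t"]) (auto simp: half(2))
  qed (use mid in auto)
  moreover have "\<forall>\<^sub>F t in at_right 0. \<omega> t = (\<lambda>j. g j (p t))"
  proof -
    have "\<forall>\<^sub>F t in at_right 0. t \<le> (1/2::real)"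
      unfolding eventually_at_right_0_iff by (intro exI[of _ "1/2"]) auto
    with \<phi>(2) show ?thesis by eventually_elim (simp add: \<omega>_def half(1))
  qed
  moreover have "\<forall>\<^sub>F t in at_left 1. \<omega> t = (\<lambda>j. k j (p t))"
  proof -
    have "\<forall>\<^sub>F t in at_left 1. t > (1/2::real)"
      unfolding eventually_at_left_1_iff by (intro exI[of _ "3/4"]) auto
    with \<psi>(3) show ?thesis by eventually_elim (simp add: \<omega>_def half(2))
  qed
  ultimately show ?thesis unfolding transports_def by blast
qed

section \<open>The principal branch of the polylogarithms\<close>

text \<open>
  The plane cut along \<open>[1, \<infinity>)\<close>, which is starlike about 0.
\<close>

definition slit_plane :: "complex set"
  where "slit_plane = - (of_real ` {1..})"

lemma slit_plane_alt: "z \<in> slit_plane \<longleftrightarrow> 1 - z \<notin> \<real>\<^sub>\<le>\<^sub>0"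
proof -
  have "1 - z \<in> \<real>\<^sub>\<le>\<^sub>0 \<longleftrightarrow> z \<in> of_real ` {1..}"
    by (auto simp: complex_nonpos_Reals_iff image_iff complex_eq_iff intro!: bexI[of _ "Re z"])
  then show ?thesis by (simp add: slit_plane_def)
qed

lemma open_slit_plane: "open slit_plane"
  unfolding slit_plane_def
  by (intro open_Compl closed_injective_linear_image) (auto simp: linear_iff scaleR_conv_of_real inj_on_def)

lemma starlike_slit_plane: "starlike slit_plane"
  unfolding starlike_def
proof (intro bexI[of _ 0] ballI)
  fix z assume z: "z \<in> slit_plane"
  show "closed_segment 0 z \<subseteq> slit_plane"
  proof
    fix w assume "w \<in> closed_segment 0 z"
    then obtain u where u: "0 \<le> u" "u \<le> 1" "w = u *\<^sub>R z"
      by (auto simp: closed_segment_def)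
    show "w \<in> slit_plane"
    proof (rule ccontr)
      assume "w \<notin> slit_plane"
      then obtain x where x: "x \<ge> 1" "w = of_real x" by (auto simp: slit_plane_def)
      then have "u \<noteq> 0" using u by auto
      then have "z = of_real (x / u)" using u x by (simp add: scaleR_conv_of_real field_simps)
      moreover have "x / u \<ge> 1" using u x \<open>u \<noteq> 0\<close> by (simp add: field_simps)
      ultimately have "z \<in> of_real ` {1..}" by blast
      then show False using z by (simp add: slit_plane_def)
    qed
  qed
next
  show "0 \<in> slit_plane" by (auto simp: slit_plane_def image_iff)
qed

lemma connected_slit_plane: "connected slit_plane"
  by (simp add: starlike_imp_connected starlike_slit_plane)

lemma zero_in_slit_plane [simp]: "0 \<in> slit_plane"
  by (simp add: slit_plane_alt)

text \<open>
  The recursion starts with \<open>Li\<^sub>0(z) = z/(1-z)\<close>, so that it covers \<open>Li\<^sub>1\<close>. The value 1 at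
  \<open>w = 0\<close> removes the singularity of the integrand, as all \<open>Li\<^sub>k\<close> have derivative 1 at 0.
\<close>

fun principal_Li :: "nat \<Rightarrow> complex \<Rightarrow> complex" where
  "principal_Li 0 z = z / (1 - z)"
| "principal_Li (Suc k) z =
     primitive_from slit_plane 0 (\<lambda>w. if w = 0 then 1 else principal_Li k w / w) z"

declare principal_Li.simps(2) [simp del]

lemma principal_Li_at_0 [simp]: "principal_Li k 0 = 0"
  by (cases k) (simp_all add: principal_Li.simps(2) primitive_from_def)

lemma principal_Li_deriv_step:
  assumes 1: "\<forall>z\<in>slit_plane. principal_Li k field_differentiable (at z)"
    and 2: "(principal_Li k has_field_derivative 1) (at 0)"
  shows "\<forall>z\<in>slit_plane. (principal_Li (Suc k) has_field_derivative
           (if z = 0 then 1 else principal_Li k z / z)) (at z)"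
proof
  fix z assume z: "z \<in> slit_plane"
  define f where "f w = (if w = 0 then 1 else principal_Li k w / w)" for w
  have f: "f field_differentiable at w" if w: "w \<in> slit_plane - {0}" for w
  proof -
    have "(\<lambda>w. principal_Li k w / w) field_differentiable at w"
      using 1 w by (intro derivative_intros) auto
    moreover have "\<forall>\<^sub>F v in nhds w. v \<noteq> 0"
      using w by (intro eventually_nhds_in_open[of "- {0}", simplified]) auto
    then have "\<forall>\<^sub>F v in nhds w. f v = principal_Li k v / v"
      by eventually_elim (simp add: f_def)
    ultimately show ?thesis
      unfolding field_differentiable_def by (metis DERIV_cong_ev)
  qed
  have "f \<midarrow>0\<rightarrow> 1"
  proof -
    have "(\<lambda>w. principal_Li k w / w) \<midarrow>0\<rightarrow> 1"
      using 2 by (simp add: has_field_derivative_iff)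
    then show ?thesis
      by (rule Lim_transform_eventually) (auto simp: eventually_at f_def intro: exI[of _ 1])
  qed
  then have "isCont f 0" by (simp add: isCont_def f_def)
  then have "continuous_on slit_plane f"
    using f by (metis DiffI continuous_at_imp_continuous_on empty_iff
        field_differentiable_imp_continuous_at insert_iff)
  from primitive_from(1)[where c = 0, OF open_slit_plane starlike_slit_plane _ this f z]
  have "(primitive_from slit_plane 0 f has_field_derivative f z) (at z)" by blast
  moreover have "principal_Li (Suc k) = primitive_from slit_plane 0 f"
    by (simp add: fun_eq_iff principal_Li.simps(2) f_def[abs_def])
  ultimately show "(principal_Li (Suc k) has_field_derivative (if z = 0 then 1 else principal_Li k z / z)) (at z)"
    by (simp add: f_def)
qed

lemma principal_Li_differentiable:
  "(\<forall>z\<in>slit_plane. principal_Li k field_differentiable (at z)) \<and>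
   (principal_Li k has_field_derivative 1) (at 0)"
proof (induction k)
  case 0
  have eq: "principal_Li 0 = (\<lambda>z. z / (1 - z))" by (simp add: fun_eq_iff)
  have "principal_Li 0 field_differentiable (at z)" if "z \<in> slit_plane" for z
  proof -
    have "1 - z \<noteq> 0" using that by (auto simp: slit_plane_alt)
    then have "(\<lambda>z. z / (1 - z)) field_differentiable (at z)"
      by (intro derivative_intros) auto
    then show ?thesis by (simp only: eq)
  qed
  moreover have "((\<lambda>z. z / (1 - z)) has_field_derivative 1) (at (0::complex))"
    by (auto intro!: derivative_eq_intros)
  ultimately show ?case unfolding eq by blast
next
  case (Suc k)
  note d = principal_Li_deriv_step[OF Suc[THEN conjunct1] Suc[THEN conjunct2]]
  have "(principal_Li (Suc k) has_field_derivative 1) (at 0)"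
    using bspec[OF d zero_in_slit_plane] by simp
  with d show ?case unfolding field_differentiable_def by blast
qed

lemma principal_Li_has_derivative:
  assumes "z \<in> slit_plane"
  shows "(principal_Li (Suc k) has_field_derivative (if z = 0 then 1 else principal_Li k z / z)) (at z)"
  using principal_Li_deriv_step principal_Li_differentiable assms by blast

lemma principal_Li_deriv:
  assumes "z \<in> slit_plane" "z \<noteq> 0"
  shows "(principal_Li (Suc k) has_field_derivative principal_Li k z / z) (at z)"
  using principal_Li_has_derivative[of z k] assms by simp

lemma isCont_principal_Li: "z \<in> slit_plane \<Longrightarrow> isCont (principal_Li k) z"
  using principal_Li_differentiable[of k] field_differentiable_imp_continuous_at by blast

lemma principal_Li_1:
  assumes "z \<in> slit_plane"
  shows "principal_Li (Suc 0) z = - Ln (1 - z)"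
proof -
  have "principal_Li (Suc 0) z + Ln (1 - z) = principal_Li (Suc 0) 0 + Ln (1 - 0)"
  proof (rule zero_derivative_imp_eq[OF connected_slit_plane open_slit_plane _ assms zero_in_slit_plane])
    fix w assume w: "w \<in> slit_plane"
    then have "1 - w \<notin> \<real>\<^sub>\<le>\<^sub>0" by (simp add: slit_plane_alt)
    then have "((\<lambda>w. Ln (1 - w)) has_field_derivative - 1 / (1 - w)) (at w)"
      by (auto intro!: derivative_eq_intros simp: field_simps)
    moreover have "(principal_Li (Suc 0) has_field_derivative 1 / (1 - w)) (at w)"
      using principal_Li_has_derivative[of w 0] w by (cases "w = 0") simp_all
    ultimately show "((\<lambda>w. principal_Li (Suc 0) w + Ln (1 - w)) has_field_derivative 0) (at w)"
      using DERIV_add by fastforce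
  qed
  then show ?thesis by (simp add: add_eq_0_iff2)
qed

lemma ball_subset_slit_plane: "norm z < 1 \<Longrightarrow> z \<in> slit_plane"
  by (auto simp: slit_plane_def)

definition polylog_coeff :: "nat \<Rightarrow> nat \<Rightarrow> complex"
  where "polylog_coeff k n = 1 / of_nat (Suc n) ^ k"

lemma norm_polylog_coeff: "norm (polylog_coeff k n) = 1 / real (Suc n) ^ k"
  by (simp only: polylog_coeff_def norm_divide norm_power norm_of_nat norm_one)

lemma norm_polylog_coeff_le_1: "norm (polylog_coeff k n) \<le> 1"
  unfolding norm_polylog_coeff by (simp add: divide_le_eq_1)

lemma summable_polylog_coeffs:
  fixes z :: complex
  assumes "norm z < 1"
  shows "summable (\<lambda>n. polylog_coeff k n * z ^ n)"
proof (rule summable_comparison_test')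
  show "summable (\<lambda>n. norm z ^ n)" using assms by (simp add: summable_geometric)
  show "norm (polylog_coeff k n * z ^ n) \<le> norm z ^ n" for n
    using mult_right_mono[OF norm_polylog_coeff_le_1[of k n], of "norm z ^ n"]
    by (simp add: norm_mult norm_power)
qed

text \<open>
  Both sides have the same derivative in the unit disc and vanish at 0.
\<close>

lemma principal_Li_series:
  assumes "norm z < 1"
  shows "principal_Li k z = z * (\<Sum>n. polylog_coeff k n * z ^ n)"
  using assms
proof (induction k arbitrary: z)
  case 0
  then show ?case by (simp add: suminf_geometric polylog_coeff_def)
next
  case (Suc k)
  define c :: "nat \<Rightarrow> complex" where "c n = (if n = 0 then 0 else 1 / of_nat n ^ Suc k)" for n
  define F where "F w = (\<Sum>n. c n * w ^ n)" for w
  have split: "summable (\<lambda>n. c n * w ^ n)" "F w = w * (\<Sum>n. polylog_coeff (Suc k) n * w ^ n)"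
    if "norm w < 1" for w
  proof -
    have eq: "(\<lambda>n. c (Suc n) * w ^ Suc n) = (\<lambda>n. w * (polylog_coeff (Suc k) n * w ^ n))"
      by (simp add: c_def fun_eq_iff polylog_coeff_def)
    have "summable (\<lambda>n. c (Suc n) * w ^ Suc n)"
      unfolding eq by (intro summable_mult summable_polylog_coeffs that)
    then show *: "summable (\<lambda>n. c n * w ^ n)" by (subst (asm) summable_Suc_iff)
    have "F w = (\<Sum>n. c (Suc n) * w ^ Suc n)"
      unfolding F_def using suminf_split_head[OF *] by (simp add: c_def)
    also have "\<dots> = w * (\<Sum>n. polylog_coeff (Suc k) n * w ^ n)"
      unfolding eq by (intro suminf_mult summable_polylog_coeffs that)
    finally show "F w = w * (\<Sum>n. polylog_coeff (Suc k) n * w ^ n)" .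
  qed
  have dF: "(F has_field_derivative (\<Sum>n. polylog_coeff k n * w ^ n)) (at w)"
    if "norm w < 1" for w
  proof -
    have "diffs c n = polylog_coeff k n" for n
      using of_nat_neq_0[of n, where 'a = complex] by (simp add: diffs_def c_def polylog_coeff_def del: of_nat_Suc)
    then show ?thesis
      using termdiffs_strong'[of 1 c w] split(1) that unfolding F_def by simp
  qed
  have "principal_Li (Suc k) z - F z = principal_Li (Suc k) 0 - F 0"
  proof (rule zero_derivative_imp_eq[of "ball 0 1" "\<lambda>w. principal_Li (Suc k) w - F w" z 0])
    fix w :: complex assume w: "w \<in> ball 0 1"
    have "(if w = 0 then 1 else principal_Li k w / w) = (\<Sum>n. polylog_coeff k n * w ^ n)"
      using Suc.IH[of w] w powser_zero[of "polylog_coeff k"] by (auto simp: polylog_coeff_def)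
    then show "((\<lambda>w. principal_Li (Suc k) w - F w) has_field_derivative 0) (at w)"
      using DERIV_diff[OF principal_Li_has_derivative[of w k] dF[of w]] w
        ball_subset_slit_plane[of w] by simp
  qed (use Suc.prems in auto)
  moreover have "F 0 = 0" using split(2)[of 0] by simp
  ultimately show ?case using split(2)[of z] Suc.prems by simp
qed

text \<open>
  On the closed disc the series is dominated by that of the \<open>1/n\<^sup>k\<close>.
\<close>

lemma continuous_on_polylog_series:
  assumes "k \<ge> 2"
  shows "continuous_on (cball 0 1) (\<lambda>z::complex. \<Sum>n. polylog_coeff k n * z ^ n)"
proof -
  have "uniform_limit (cball 0 1) (\<lambda>N (z::complex). \<Sum>n<N. polylog_coeff k n * z ^ n)
      (\<lambda>z. \<Sum>n. polylog_coeff k n * z ^ n) sequentially"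
  proof (rule Weierstrass_m_test)
    have "summable (\<lambda>n. 1 / real n ^ k)"
      using assms by (simp add: inverse_power_summable flip: inverse_eq_divide)
    then show "summable (\<lambda>n. 1 / real (Suc n) ^ k)"
      by (subst summable_Suc_iff)
    show "norm (polylog_coeff k n * z ^ n) \<le> 1 / real (Suc n) ^ k"
      if "z \<in> cball 0 1" for n and z :: complex
    proof -
      have "norm (polylog_coeff k n * z ^ n) = 1 / real (Suc n) ^ k * norm z ^ n"
        by (simp only: norm_polylog_coeff norm_power norm_mult)
      also have "\<dots> \<le> 1 / real (Suc n) ^ k * 1"
        using that by (intro mult_left_mono power_le_one) auto
      finally show ?thesis by simp
    qed
  qed
  then show ?thesis
    by (rule uniform_limit_theorem[rotated]) (auto intro!: always_eventually continuous_intros)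
qed

lemma tendsto_principal_Li_1:
  assumes "k \<ge> 2"
  shows "((\<lambda>t. principal_Li k (of_real t)) \<longlongrightarrow> (\<Sum>n. 1 / of_nat (Suc n) ^ k)) (at_left 1)"
proof -
  define S where "S z = (\<Sum>n. polylog_coeff k n * z ^ n)" for z :: complex
  have "continuous_on {0..1} (\<lambda>t. S (of_real t))"
    unfolding S_def
    by (rule continuous_on_compose2[OF continuous_on_polylog_series[OF assms]])
      (auto intro!: continuous_intros)
  then have "continuous_on {0..1} (\<lambda>t. of_real t * S (of_real t))"
    by (intro continuous_intros)
  then have "((\<lambda>t. of_real t * S (of_real t)) \<longlongrightarrow> of_real 1 * S (of_real 1)) (at 1 within {0..1})"
    unfolding continuous_on_def by (rule bspec) simp
  then have "((\<lambda>t. of_real t * S (of_real t)) \<longlongrightarrow> S 1) (at_left 1)"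
    by (simp add: at_within_Icc_at_left)
  then have "((\<lambda>t. principal_Li k (of_real t)) \<longlongrightarrow> S 1) (at_left 1)"
  proof (rule Lim_transform_eventually)
    have "\<forall>\<^sub>F t in at_left 1. t \<in> {0<..<(1::real)}"
      by (rule eventually_at_leftI[of 0]) auto
    then show "\<forall>\<^sub>F t in at_left 1. of_real t * S (of_real t) = principal_Li k (of_real t)"
      by eventually_elim (simp add: principal_Li_series S_def)
  qed
  then show ?thesis by (simp add: S_def polylog_coeff_def)
qed

lemma suminf_inverse_squares: "(\<Sum>n. 1 / of_nat (Suc n) ^ 2 :: complex) = of_real pi ^ 2 / 6"
proof -
  have "(\<lambda>n. of_real (1 / (real n + 1)\<^sup>2)) sums (of_real (pi\<^sup>2 / 6) :: complex)"
    using inverse_squares_sums by (intro sums_of_real) (simp add: add.commute)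
  then have "(\<lambda>n. 1 / of_nat (Suc n) ^ 2 :: complex) sums (of_real pi ^ 2 / 6)"
    by (simp add: add.commute)
  then show ?thesis by (rule sums_unique[symmetric])
qed

text \<open>
  The series at \<open>-1\<close> is continuous up to the boundary of the disc; subtracting it from the series at
  1 leaves twice the terms with even denominator, which sum to half of \<open>zeta(2)\<close>.
\<close>

lemma principal_Li_2_minus_1: "principal_Li 2 (- 1) = - (of_real pi ^ 2 / 12)"
proof -
  define a where "a = polylog_coeff 2"
  have summ: "summable (\<lambda>n. a n * (z::complex) ^ n)" if "norm z = 1" for z
  proof (rule summable_comparison_test')
    have "summable (\<lambda>n. 1 / real n ^ 2)"
      by (simp add: inverse_power_summable flip: inverse_eq_divide)
    then show "summable (\<lambda>n. 1 / real (Suc n) ^ 2)"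
      by (subst summable_Suc_iff)
    show "norm (a n * z ^ n) \<le> 1 / real (Suc n) ^ 2" for n
      by (simp add: a_def norm_polylog_coeff norm_power norm_mult that)
  qed
  define S where "S z = (\<Sum>n. a n * z ^ n)" for z :: complex
  have S1: "S 1 = of_real pi ^ 2 / 6"
    using suminf_inverse_squares by (simp add: S_def a_def polylog_coeff_def)
  have at_m1: "principal_Li 2 (- 1) = - S (- 1)"
  proof -
    have "continuous_on {-1..0} (\<lambda>t. S (of_real t))"
      unfolding S_def a_def
      by (rule continuous_on_compose2[OF continuous_on_polylog_series[of 2]])
        (auto intro!: continuous_intros)
    then have "continuous_on {-1..0} (\<lambda>t. of_real t * S (of_real t))"
      by (intro continuous_intros)
    then have "((\<lambda>t. of_real t * S (of_real t)) \<longlongrightarrow> of_real (-1) * S (of_real (-1))) (at (-1) within {-1..0})"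
      unfolding continuous_on_def by (rule bspec) simp
    then have 1: "((\<lambda>t. of_real t * S (of_real t)) \<longlongrightarrow> - S (-1)) (at_right (-1))"
      by (simp add: at_within_Icc_at_right)
    have "isCont (principal_Li 2) (of_real (-1))"
      by (intro isCont_principal_Li) (auto simp: slit_plane_alt)
    then have "isCont (\<lambda>t. principal_Li 2 (of_real t)) (-1)"
      by (rule isCont_o2[OF isCont_of_real, rotated]) auto
    then have 2: "((\<lambda>t. principal_Li 2 (of_real t)) \<longlongrightarrow> principal_Li 2 (-1)) (at_right (-1))"
      by (simp add: isCont_def filterlim_at_split)
    have "\<forall>\<^sub>F t in at_right (-1). t \<in> {-1<..<(0::real)}"
      by (rule eventually_at_rightI[of _ 0]) auto
    then have "\<forall>\<^sub>F t in at_right (-1). of_real t * S (of_real t) = principal_Li 2 (of_real t)"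
      by eventually_elim (simp add: principal_Li_series S_def a_def)
    from tendsto_unique[OF _ Lim_transform_eventually[OF 1 this] 2] show ?thesis by simp
  qed
  have "S 1 - S (-1) = S 1 / 2"
  proof -
    have "(\<lambda>n. a n * 1 ^ n - a n * (-1) ^ n) sums (S 1 - S (-1))"
      unfolding S_def by (intro sums_diff summable_sums summ) auto
    then have "(\<lambda>n. \<Sum>i = n * 2..<n * 2 + 2. a i * 1 ^ i - a i * (-1) ^ i) sums (S 1 - S (-1))"
      by (rule sums_group) simp
    moreover have "(\<Sum>i = n * 2..<n * 2 + 2. a i * 1 ^ i - a i * (-1) ^ i) = a n * 1 ^ n / 2" for n
    proof -
      have "{n * 2..<n * 2 + 2} = {n * 2, Suc (n * 2)}" by auto
      then have "(\<Sum>i = n * 2..<n * 2 + 2. a i * 1 ^ i - a i * (-1) ^ i) = 2 * a (Suc (n * 2))"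
        by simp
      also have "\<dots> = 2 / (2 * of_nat (Suc n)) ^ 2"
        by (simp add: a_def polylog_coeff_def algebra_simps)
      also have "\<dots> = a n / 2" by (simp only: power_mult_distrib a_def polylog_coeff_def) simp
      finally show ?thesis by (simp only: power_one mult_1_right)
    qed
    ultimately have "(\<lambda>n. a n * 1 ^ n / 2) sums (S 1 - S (-1))" by (simp only:)
    moreover have "(\<lambda>n. a n * 1 ^ n) sums S 1"
      unfolding S_def by (rule summable_sums, rule summ) simp
    then have "(\<lambda>n. a n * 1 ^ n / 2) sums (S 1 / 2)" by (rule sums_divide)
    ultimately show ?thesis by (rule sums_unique2)
  qed
  then have "S (-1) = S 1 / 2" by (simp add: field_simps)
  then show ?thesis using at_m1 S1 by simp
qed


lemma negative_in_slit_plane: "t < 0 \<Longrightarrow> of_real t \<in> slit_plane"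
  by (auto simp: slit_plane_def)

lemma principal_Li_1_negative:
  assumes "t < 0"
  shows "principal_Li (Suc 0) (of_real t) = - of_real (ln (1 - t))"
proof -
  have "Ln (of_real (1 - t)) = of_real (ln (1 - t))" using assms by (intro Ln_of_real) simp
  then show ?thesis using principal_Li_1[OF negative_in_slit_plane[OF assms]] by simp
qed

lemma principal_Li_real_derivative:
  assumes "t < 0"
  shows "((\<lambda>t. principal_Li (Suc k) (of_real t)) has_vector_derivative
            principal_Li k (of_real t) / of_real t) (at t)"
  using assms by (intro has_vector_derivative_real_field principal_Li_deriv negative_in_slit_plane) auto

lemma principal_Li_reciprocal_derivative:
  assumes "t < 0"
  shows "((\<lambda>t. principal_Li (Suc k) (of_real (1 / t))) has_vector_derivative
            - (principal_Li k (of_real (1 / t)) / of_real t)) (at t)"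
proof -
  have "((\<lambda>t. 1 / t) has_vector_derivative - (1 / t^2)) (at t)"
    using assms unfolding has_real_derivative_iff_has_vector_derivative[symmetric]
    by (auto intro!: derivative_eq_intros simp: power2_eq_square)
  moreover have "((\<lambda>t. principal_Li (Suc k) (of_real t)) has_vector_derivative
            principal_Li k (of_real (1 / t)) / of_real (1 / t)) (at (1 / t))"
    using assms by (intro principal_Li_real_derivative) simp
  ultimately have "((\<lambda>t. principal_Li (Suc k) (of_real t)) \<circ> (\<lambda>t. 1 / t) has_vector_derivative
            - (1 / t^2) *\<^sub>R (principal_Li k (of_real (1 / t)) / of_real (1 / t))) (at t)"
    by (rule vector_diff_chain_at)
  moreover have "- (1 / t^2) *\<^sub>R (c / of_real (1 / t)) = - (c / of_real t)" for c :: complex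
    using assms by (simp add: scaleR_conv_of_real field_simps power2_eq_square)
  ultimately show ?thesis by (simp add: o_def)
qed

text \<open>
  The sum of all terms has derivative 0 on the negative axis, and \<open>t = -1\<close>, where \<open>t = 1/t\<close>,
  determines the constant.
\<close>

theorem principal_Li_2_inversion:
  assumes "t < 0"
  shows "principal_Li 2 (of_real t) =
    - (of_real pi ^ 2 / 6) - of_real (ln (- t) ^ 2 / 2) - principal_Li 2 (of_real (1 / t))"
proof -
  define N where "N t = principal_Li 2 (of_real t) + principal_Li 2 (of_real (1 / t))
    + of_real (ln (- t) ^ 2 / 2)" for t :: real
  have "(N has_vector_derivative 0) (at t within {..<0})" if t: "t \<in> {..<0}" for t
  proof -
    have "((\<lambda>t. ln (- t) ^ 2 / 2) has_real_derivative ln (- t) / t) (at t)"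
      using t by (auto intro!: derivative_eq_intros simp: field_simps)
    then have ln: "((\<lambda>t. of_real (ln (- t) ^ 2 / 2) :: complex) has_vector_derivative of_real (ln (- t) / t)) (at t)"
      by (rule has_vector_derivative_of_real)
    have two: "(2::nat) = Suc (Suc 0)" by simp
    have "1 - 1 / t = (1 - t) / (- t)" using t by (simp add: field_simps)
    then have "ln (1 - 1 / t) = ln ((1 - t) / (- t))" by (simp only:)
    also have "\<dots> = ln (1 - t) - ln (- t)" using t by (subst ln_div) auto
    finally have "ln (1 - 1 / t) = ln (1 - t) - ln (- t)" .
    then have "principal_Li (Suc 0) (of_real (1 / t)) = of_real (ln (- t)) - of_real (ln (1 - t))"
      using principal_Li_1_negative[of "1 / t"] t by simp
    moreover have "(N has_vector_derivative (principal_Li (Suc 0) (of_real t) / of_real t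
        + - (principal_Li (Suc 0) (of_real (1 / t)) / of_real t) + of_real (ln (- t) / t))) (at t)"
      unfolding N_def two
      using t by (intro has_vector_derivative_add principal_Li_real_derivative
          principal_Li_reciprocal_derivative ln[unfolded two]) auto
    moreover have "principal_Li (Suc 0) (of_real t) = - of_real (ln (1 - t))"
      using principal_Li_1_negative[of t] t by simp
    ultimately have "(N has_vector_derivative 0) (at t)"
      by (simp add: diff_divide_distrib)
    then show ?thesis by (rule has_vector_derivative_at_within)
  qed
  then obtain c where c: "\<And>t. t \<in> {..<0} \<Longrightarrow> N t = c"
    using has_vector_derivative_zero_constant[of "{..<0}" N] by auto
  have "N t = N (-1)" using c[of t] c[of "-1"] assms by simp
  also have "\<dots> = - (of_real pi ^ 2 / 6)" by (simp add: N_def principal_Li_2_minus_1)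
  finally show ?thesis by (simp add: N_def algebra_simps)
qed

text \<open>
  As in weight two; the derivative vanishes by the inversion formula for \<open>Li\<^sub>2\<close>, and at \<open>t = -1\<close>
  the two trilogarithms cancel.
\<close>

theorem principal_Li_3_inversion:
  assumes "t < 0"
  shows "principal_Li 3 (of_real t) = principal_Li 3 (of_real (1 / t))
    - of_real (pi ^ 2 / 6 * ln (- t) + ln (- t) ^ 3 / 6)"
proof -
  define N where "N t = principal_Li 3 (of_real t) - principal_Li 3 (of_real (1 / t))
    + of_real (pi ^ 2 / 6 * ln (- t) + ln (- t) ^ 3 / 6)" for t :: real
  have "(N has_vector_derivative 0) (at t within {..<0})" if t: "t \<in> {..<0}" for t
  proof -
    have "((\<lambda>t. pi ^ 2 / 6 * ln (- t) + ln (- t) ^ 3 / 6) has_real_derivative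
        (pi ^ 2 / 6 + ln (- t) ^ 2 / 2) / t) (at t)"
      using t by (auto intro!: derivative_eq_intros simp: field_simps)
    then have ln: "((\<lambda>t. of_real (pi ^ 2 / 6 * ln (- t) + ln (- t) ^ 3 / 6) :: complex)
        has_vector_derivative of_real ((pi ^ 2 / 6 + ln (- t) ^ 2 / 2) / t)) (at t)"
      by (rule has_vector_derivative_of_real)
    have three: "principal_Li 3 = principal_Li (Suc 2)" by (simp add: numeral_3_eq_3 numeral_2_eq_2)
    have "(N has_vector_derivative (principal_Li 2 (of_real t) / of_real t
        - - (principal_Li 2 (of_real (1 / t)) / of_real t)
        + of_real ((pi ^ 2 / 6 + ln (- t) ^ 2 / 2) / t))) (at t)"
      unfolding N_def three
      using t by (intro has_vector_derivative_add has_vector_derivative_diff principal_Li_real_derivative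
          principal_Li_reciprocal_derivative ln) auto
    moreover have "principal_Li 2 (of_real t) =
        - (of_real pi ^ 2 / 6) - of_real (ln (- t) ^ 2 / 2) - principal_Li 2 (of_real (1 / t))"
      using principal_Li_2_inversion[of t] t by simp
    ultimately have "(N has_vector_derivative 0) (at t)"
      by (simp add: diff_divide_distrib add_divide_distrib)
    then show ?thesis by (rule has_vector_derivative_at_within)
  qed
  then obtain c where c: "\<And>t. t \<in> {..<0} \<Longrightarrow> N t = c"
    using has_vector_derivative_zero_constant[of "{..<0}" N] by auto
  have "N t = N (-1)" using c[of t] c[of "-1"] assms by simp
  also have "\<dots> = 0" by (simp add: N_def)
  finally show ?thesis by (simp add: N_def algebra_simps)
qed

section \<open>The solution at the tangential base points\<close>

text \<open>
  The logarithm is cut along the negative imaginary axis, so that it is real on \<open>(0,1)\<close> and continues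
  through the upper half-plane to the negative axis. The region thus contains the rays of all the
  tangential base points and all the paths between them, and one solution serves for all of them.
\<close>

definition base_domain :: "complex set"
  where "base_domain = {z \<in> slit_plane. - \<i> * z \<notin> \<real>\<^sub>\<le>\<^sub>0}"

definition base_polylog :: "nat \<Rightarrow> complex \<Rightarrow> complex"
  where "base_polylog k z = (if k = 0 then Ln (- \<i> * z) + \<i> * of_real pi / 2 else principal_Li k z)"

lemma polylog_system_base: "polylog_system base_domain base_polylog"
  unfolding polylog_system_def
proof (intro conjI allI ballI)
  have "open ((\<lambda>z. - \<i> * z) -` (- \<real>\<^sub>\<le>\<^sub>0))"
    by (intro open_vimage continuous_intros) auto
  moreover have "base_domain = slit_plane \<inter> (\<lambda>z. - \<i> * z) -` (- \<real>\<^sub>\<le>\<^sub>0)"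
    by (auto simp: base_domain_def)
  ultimately show "open base_domain" by (metis open_Int open_slit_plane)
  show "base_domain \<subseteq> P1_minus"
    by (auto simp: base_domain_def P1_minus_def slit_plane_alt)
  fix k z assume z: "z \<in> base_domain"
  then have z': "z \<in> slit_plane" "- \<i> * z \<notin> \<real>\<^sub>\<le>\<^sub>0" "z \<noteq> 0"
    by (auto simp: base_domain_def)
  consider "k = 0" | "k = Suc 0" | j where "k = Suc (Suc j)"
    by (metis not0_implies_Suc)
  then show "(base_polylog k has_field_derivative polylog_form base_polylog k z) (at z)"
  proof cases
    case 1
    have "((\<lambda>z. Ln (- \<i> * z) + \<i> * of_real pi / 2) has_field_derivative 1 / z) (at z)"
      using z' by (auto intro!: derivative_eq_intros simp: field_simps)
    then show ?thesis by (simp add: 1 base_polylog_def[abs_def])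
  next
    case 2
    have "(principal_Li (Suc 0) has_field_derivative 1 / (1 - z)) (at z)"
      using principal_Li_deriv[OF z'(1,3), of 0] z'(3) by simp
    then show ?thesis by (simp add: 2 base_polylog_def[abs_def])
  next
    case 3
    then show ?thesis using principal_Li_deriv[OF z'(1,3), of "Suc j"]
      by (simp add: base_polylog_def[abs_def])
  qed
qed

lemma base_domain_real:
  assumes "t < 1" "t \<noteq> 0"
  shows "of_real t \<in> base_domain"
  using assms by (auto simp: base_domain_def slit_plane_def complex_nonpos_Reals_iff complex_eq_iff)

lemma base_domain_upper: "Im z > 0 \<Longrightarrow> z \<in> base_domain"
  by (auto simp: base_domain_def slit_plane_def complex_nonpos_Reals_iff)

lemma base_log_positive:
  assumes "t > 0"
  shows "base_polylog 0 (of_real t) = of_real (ln t)"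
proof -
  have "Ln (- \<i> * of_real t) = Ln (of_real t * - \<i>)" by (simp add: mult.commute)
  also have "\<dots> = of_real (ln t) + Ln (- \<i>)" using assms Ln_times_of_real[of t "- \<i>"] by (simp only: Ln_of_real) simp
  finally show ?thesis by (simp add: base_polylog_def)
qed

lemma base_log_negative:
  assumes "t < 0"
  shows "base_polylog 0 (of_real t) = of_real (ln (- t)) + \<i> * of_real pi"
proof -
  have "Ln (- \<i> * of_real t) = Ln (of_real (- t) * \<i>)" by (simp add: mult.commute)
  also have "\<dots> = of_real (ln (- t)) + Ln \<i>" using assms Ln_times_of_real[of "- t" \<i>] Ln_of_real[of "- t"] by (simp only:) simp
  finally show ?thesis by (simp add: base_polylog_def)
qed

lemma base_Li_1_real:
  assumes "t < 1" "t \<noteq> 0"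
  shows "base_polylog (Suc 0) (of_real t) = - of_real (ln (1 - t))"
proof -
  have "Ln (of_real (1 - t)) = of_real (ln (1 - t))" using assms by (intro Ln_of_real) simp
  moreover have "of_real t \<in> slit_plane" using base_domain_real[OF assms] by (simp add: base_domain_def)
  ultimately show ?thesis by (simp add: base_polylog_def principal_Li_1)
qed

section \<open>Integrals along piecewise smooth paths\<close>

lemma valid_path_differentiable_cofinite:
  assumes "valid_path p"
  obtains K where "finite K" "\<And>t. t \<in> {0<..<1} - K \<Longrightarrow> (p has_vector_derivative vector_derivative p (at t)) (at t)"
proof -
  obtain K where K: "finite K" "p C1_differentiable_on ({0..1} - K)"
    using assms unfolding valid_path_def piecewise_C1_differentiable_on_def by blast
  have "(p has_vector_derivative vector_derivative p (at t)) (at t)" if "t \<in> {0<..<1} - K" for t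
    using K(2) that unfolding C1_differentiable_on_eq by (auto simp: vector_derivative_works)
  with K(1) that show ?thesis by blast
qed

lemma polylog_lift_deriv:
  fixes p :: "real \<Rightarrow> complex"
  assumes l: "polylog_lift p {0<..<1} \<phi>" and t: "t \<in> {0<..<1}"
    and p: "(p has_vector_derivative p') (at t)"
  shows "((\<lambda>t. \<phi> t 0) has_vector_derivative 1 / p t * p') (at t)"
    and "((\<lambda>t. \<phi> t (Suc 0)) has_vector_derivative 1 / (1 - p t) * p') (at t)"
    and "((\<lambda>t. \<phi> t (Suc (Suc k))) has_vector_derivative 1 / p t * \<phi> t (Suc k) * p') (at t)"
proof -
  obtain U g d where *: "polylog_system U g" "d > 0"
    "\<And>s. s \<in> {0<..<1} \<Longrightarrow> dist t s < d \<Longrightarrow> p s \<in> U"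
    "\<And>s. s \<in> {0<..<1} \<Longrightarrow> dist t s < d \<Longrightarrow> \<phi> s = (\<lambda>k. g k (p s))"
    using polylog_liftE[OF l t] by metis
  have at_t: "\<phi> t k = g k (p t)" for k using *(2,4) t by simp
  have "((\<lambda>t. g k (p t)) has_vector_derivative p' * polylog_form g k (p t)) (at t)" for k
    using field_vector_diff_chain_at[OF p polylog_systemD(3)[OF *(1) *(3)[OF t]]] *(2)
    by (simp add: o_def)
  then have d: "((\<lambda>t. \<phi> t k) has_vector_derivative p' * polylog_form g k (p t)) (at t)" for k
    by (rule has_vector_derivative_transform_within_open[where S = "{0<..<1} \<inter> ball t d"])
      (use t *(2,4) in auto)
  show "((\<lambda>t. \<phi> t 0) has_vector_derivative 1 / p t * p') (at t)"
    using d[of 0] by (simp add: mult.commute)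
  show "((\<lambda>t. \<phi> t (Suc 0)) has_vector_derivative 1 / (1 - p t) * p') (at t)"
    using d[of "Suc 0"] by (simp add: mult.commute)
  show "((\<lambda>t. \<phi> t (Suc (Suc k))) has_vector_derivative 1 / p t * \<phi> t (Suc k) * p') (at t)"
    using d[of "Suc (Suc k)"] at_t[of "Suc k"] by (simp add: mult.commute)
qed

lemma polylog_lift_continuous:
  fixes p :: "real \<Rightarrow> complex"
  assumes "polylog_lift p R \<phi>" "continuous_on R p"
  shows "continuous_on R (\<lambda>t. \<phi> t k)"
  unfolding continuous_on_eq_continuous_within
proof
  fix t assume t: "t \<in> R"
  obtain U g d where *: "polylog_system U g" "d > 0"
    "\<And>s. s \<in> R \<Longrightarrow> dist t s < d \<Longrightarrow> p s \<in> U"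
    "\<And>s. s \<in> R \<Longrightarrow> dist t s < d \<Longrightarrow> \<phi> s = (\<lambda>k. g k (p s))"
    using polylog_liftE[OF assms(1) t] by metis
  have "isCont (g k) (p t)" using DERIV_isCont[OF polylog_systemD(3)[OF *(1) *(3)[OF t]]] *(2) by simp
  moreover have "continuous (at t within R) p"
    using assms(2) t by (simp add: continuous_on_eq_continuous_within)
  ultimately have "continuous (at t within R) (\<lambda>s. g k (p s))"
    using continuous_within_compose3 by blast
  then show "continuous (at t within R) (\<lambda>s. \<phi> s k)"
    by (rule continuous_transform_within[OF _ *(2) t]) (use *(4) in \<open>auto simp: dist_commute\<close>)
qed

lemma tendsto_compose_end:
  assumes "polylog_system V h" "z \<in> V" "filterlim p (nhds z) F"
  shows "((\<lambda>t. h k (p t)) \<longlongrightarrow> h k z) F"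
proof -
  have "isCont (h k) z" using DERIV_isCont[OF polylog_systemD(3)[OF assms(1,2)]] .
  then show ?thesis using assms(3) isCont_tendsto_compose by blast
qed

lemma continuous_on_extend_ends:
  fixes f :: "real \<Rightarrow> complex"
  assumes f: "continuous_on {0<..<1} f" and a: "(f \<longlongrightarrow> a) (at_right 0)" and b: "(f \<longlongrightarrow> b) (at_left 1)"
  shows "continuous_on {0..1} (\<lambda>t. if t \<le> 0 then a else if t \<ge> 1 then b else f t)" (is "continuous_on _ ?g")
  unfolding continuous_on_def
proof
  fix t :: real assume "t \<in> {0..1}"
  then consider "t = 0" | "t = 1" | "t \<in> {0<..<1}" by force
  then show "(?g \<longlongrightarrow> ?g t) (at t within {0..1})"
  proof cases
    case 1
    have "\<forall>\<^sub>F t in at_right 0. f t = ?g t"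
      by (rule eventually_at_rightI[of _ 1]) auto
    then have "(?g \<longlongrightarrow> a) (at_right 0)" by (rule Lim_transform_eventually[OF a])
    then show ?thesis using 1 by (simp add: at_within_Icc_at_right)
  next
    case 2
    have "\<forall>\<^sub>F t in at_left 1. f t = ?g t"
      by (rule eventually_at_leftI[of 0]) auto
    then have "(?g \<longlongrightarrow> b) (at_left 1)" by (rule Lim_transform_eventually[OF b])
    then show ?thesis using 2 by (simp add: at_within_Icc_at_left)
  next
    case 3
    then have "(f \<longlongrightarrow> f t) (at t)"
      using f continuous_on_eq_continuous_at[of "{0<..<1}" f] by (simp add: isCont_def)
    moreover have "\<forall>\<^sub>F s in at t. s \<in> {0<..<1}"
      using 3 by (intro eventually_at_in_open') auto
    then have "\<forall>\<^sub>F s in at t. f s = ?g s" by eventually_elim auto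
    ultimately have "(?g \<longlongrightarrow> f t) (at t)" by (rule Lim_transform_eventually)
    then show ?thesis using 3 by (auto intro: tendsto_within_subset)
  qed
qed

text \<open>
  The components of index \<open>k \<ge> 1\<close> of the continuation extend continuously to \<open>[0,1]\<close>, by 0 at time 0
  because the path leaves from 0, and satisfy the differential equations of the iterated integrals
  off a finite set. The derivative of the path may be unbounded near that set, which is why the
  fundamental theorem is used for the gauge integral.
\<close>

theorem Li_along_eq_transport:
  assumes p: "valid_path p" "p \<in> base_paths P1_minus base_01 (nhds z)" "pathfinish p = z"
    and h: "polylog_system V h" "z \<in> V" and tr: "transports p base_polylog h" and "k \<ge> 1"
  shows "Li_along k p 1 = h k z"
proof -
  obtain \<phi> where \<phi>: "polylog_lift p {0<..<1} \<phi>" "\<forall>\<^sub>F t in at_right 0. \<phi> t = (\<lambda>k. base_polylog k (p t))"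
      "\<forall>\<^sub>F t in at_left 1. \<phi> t = (\<lambda>k. h k (p t))"
    using tr unfolding transports_def by blast
  have p0: "(p \<longlongrightarrow> 0) (at_right 0)"
  proof (rule filterlim_mono[OF base_pathsD(3)[OF p(2)]])
    have "((\<lambda>t. of_real t :: complex) \<longlongrightarrow> of_real 0) (at_right 0)"
      by (intro tendsto_intros)
    then show "base_01 \<le> nhds 0" by (simp add: base_01_def filterlim_def)
  qed simp
  define F where "F k t = (if t \<le> 0 then 0 else if t \<ge> 1 then h k z else \<phi> t k)" for k t
  have F_cont: "continuous_on {0..1} (F (Suc k))" for k
    unfolding F_def
  proof (rule continuous_on_extend_ends)
    show "continuous_on {0<..<1} (\<lambda>t. \<phi> t (Suc k))"
      by (rule polylog_lift_continuous[OF \<phi>(1) base_pathsD(1)[OF p(2)]])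
    have "((\<lambda>t. principal_Li (Suc k) (p t)) \<longlongrightarrow> principal_Li (Suc k) 0) (at_right 0)"
      using isCont_tendsto_compose[OF isCont_principal_Li[OF zero_in_slit_plane] p0] .
    then have "((\<lambda>t. principal_Li (Suc k) (p t)) \<longlongrightarrow> 0) (at_right 0)" by simp
    then show "((\<lambda>t. \<phi> t (Suc k)) \<longlongrightarrow> 0) (at_right 0)"
    proof (rule Lim_transform_eventually)
      show "\<forall>\<^sub>F t in at_right 0. principal_Li (Suc k) (p t) = \<phi> t (Suc k)"
        using \<phi>(2) by eventually_elim (simp add: base_polylog_def)
    qed
    show "((\<lambda>t. \<phi> t (Suc k)) \<longlongrightarrow> h (Suc k) z) (at_left 1)"
    proof (rule Lim_transform_eventually[OF tendsto_compose_end[OF h base_pathsD(4)[OF p(2)]]])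
      show "\<forall>\<^sub>F t in at_left 1. h (Suc k) (p t) = \<phi> t (Suc k)"
        using \<phi>(3) by eventually_elim simp
    qed
  qed
  obtain K where K: "finite K" "\<And>t. t \<in> {0<..<1} - K \<Longrightarrow> (p has_vector_derivative vector_derivative p (at t)) (at t)"
    using valid_path_differentiable_cofinite[OF p(1)] by metis
  have F_deriv: "(F j has_vector_derivative D) (at t)"
    if "((\<lambda>t. \<phi> t j) has_vector_derivative D) (at t)" "t \<in> {0<..<1}" for j t D
    using that(1)
    by (rule has_vector_derivative_transform_within_open[where S = "{0<..<1}"]) (use that(2) in \<open>auto simp: F_def\<close>)
  have "Li_along (Suc k) p s = F (Suc k) s" if s: "s \<in> {0..1}" for k s
    using s
  proof (induction k arbitrary: s)
    case 0
    have "((\<lambda>u. 1 / (1 - p u) * vector_derivative p (at u)) has_integral (F (Suc 0) s - F (Suc 0) 0)) {0..s}"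
    proof (rule fundamental_theorem_of_calculus_interior_strong[OF K(1)])
      show "continuous_on {0..s} (F (Suc 0))" using F_cont[of 0] 0 by (auto elim!: continuous_on_subset)
      show "(F (Suc 0) has_vector_derivative 1 / (1 - p u) * vector_derivative p (at u)) (at u)"
        if "u \<in> {0<..<s} - K" for u
        using that 0 by (intro F_deriv polylog_lift_deriv[OF \<phi>(1)] K) auto
    qed (use 0 in auto)
    then show ?case by (simp add: integral_unique F_def)
  next
    case (Suc k)
    have "((\<lambda>u. 1 / p u * Li_along (Suc k) p u * vector_derivative p (at u)) has_integral
        (F (Suc (Suc k)) s - F (Suc (Suc k)) 0)) {0..s}"
    proof (rule fundamental_theorem_of_calculus_interior_strong[OF K(1)])
      show "continuous_on {0..s} (F (Suc (Suc k)))"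
        using F_cont[of "Suc k"] Suc.prems by (auto elim!: continuous_on_subset)
      show "(F (Suc (Suc k)) has_vector_derivative 1 / p u * Li_along (Suc k) p u * vector_derivative p (at u)) (at u)"
        if u: "u \<in> {0<..<s} - K" for u
      proof -
        have "Li_along (Suc k) p u = \<phi> u (Suc k)"
          using Suc.IH[of u] u Suc.prems by (auto simp: F_def)
        moreover have "u \<in> {0<..<1}" "u \<in> {0<..<1} - K" using u Suc.prems by auto
        ultimately show ?thesis
          using F_deriv[OF polylog_lift_deriv(3)[where k = k, OF \<phi>(1) _ K(2)], of u] by simp
      qed
    qed (use Suc in auto)
    then show ?case by (simp add: integral_unique F_def)
  qed
  from this[of 1 "k - 1"] \<open>k \<ge> 1\<close> show ?thesis by (simp add: F_def)
qed

text \<open>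
  The path leaves from 1, where the logarithm component of the base solution vanishes; so the
  integral is the value of that component at the end.
\<close>

theorem contour_integral_eq_transport:
  assumes p: "valid_path p" "p \<in> base_paths P1_minus base_10 (nhds z)" "pathfinish p = z"
    and h: "polylog_system V h" "z \<in> V" and tr: "transports p base_polylog h"
  shows "contour_integral p (\<lambda>t. 1 / t) = h 0 z"
proof -
  obtain \<phi> where \<phi>: "polylog_lift p {0<..<1} \<phi>" "\<forall>\<^sub>F t in at_right 0. \<phi> t = (\<lambda>k. base_polylog k (p t))"
      "\<forall>\<^sub>F t in at_left 1. \<phi> t = (\<lambda>k. h k (p t))"
    using tr unfolding transports_def by blast
  have p0: "(p \<longlongrightarrow> 1) (at_right 0)"
  proof (rule filterlim_mono[OF base_pathsD(3)[OF p(2)]])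
    have "((\<lambda>t. of_real t :: complex) \<longlongrightarrow> of_real 1) (at_left 1)"
      by (intro tendsto_intros)
    then show "base_10 \<le> nhds 1" by (simp add: base_10_def filterlim_def)
  qed simp
  define F where "F t = (if t \<le> 0 then 0 else if t \<ge> 1 then h 0 z else \<phi> t 0)" for t
  have "continuous_on {0..1} F"
    unfolding F_def
  proof (rule continuous_on_extend_ends)
    show "continuous_on {0<..<1} (\<lambda>t. \<phi> t 0)"
      by (rule polylog_lift_continuous[OF \<phi>(1) base_pathsD(1)[OF p(2)]])
    have "isCont (base_polylog 0) 1"
    proof -
      have "isCont (\<lambda>z. Ln (- \<i> * z) + \<i> * of_real pi / 2) 1"
        by (intro continuous_intros) (auto simp: complex_nonpos_Reals_iff)
      then show ?thesis by (simp add: base_polylog_def[abs_def])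
    qed
    then have "((\<lambda>t. base_polylog 0 (p t)) \<longlongrightarrow> base_polylog 0 1) (at_right 0)"
      using isCont_tendsto_compose p0 by blast
    moreover have "base_polylog 0 1 = 0" using base_log_positive[of 1] by simp
    ultimately have "((\<lambda>t. base_polylog 0 (p t)) \<longlongrightarrow> 0) (at_right 0)" by simp
    moreover have "\<forall>\<^sub>F t in at_right 0. base_polylog 0 (p t) = \<phi> t 0"
      using \<phi>(2) by eventually_elim simp
    ultimately show "((\<lambda>t. \<phi> t 0) \<longlongrightarrow> 0) (at_right 0)"
      by (rule Lim_transform_eventually)
    show "((\<lambda>t. \<phi> t 0) \<longlongrightarrow> h 0 z) (at_left 1)"
    proof (rule Lim_transform_eventually[OF tendsto_compose_end[OF h base_pathsD(4)[OF p(2)]]])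
      show "\<forall>\<^sub>F t in at_left 1. h 0 (p t) = \<phi> t 0"
        using \<phi>(3) by eventually_elim simp
    qed
  qed
  moreover obtain K where K: "finite K" "\<And>t. t \<in> {0<..<1} - K \<Longrightarrow> (p has_vector_derivative vector_derivative p (at t)) (at t)"
    using valid_path_differentiable_cofinite[OF p(1)] by metis
  moreover have "(F has_vector_derivative 1 / p t * vector_derivative p (at t)) (at t)"
    if "t \<in> {0<..<1} - K" for t
  proof -
    have "((\<lambda>t. \<phi> t 0) has_vector_derivative 1 / p t * vector_derivative p (at t)) (at t)"
      using that by (intro polylog_lift_deriv(1)[OF \<phi>(1)] K(2)) auto
    then show ?thesis
      by (rule has_vector_derivative_transform_within_open[where S = "{0<..<1}"]) (use that in \<open>auto simp: F_def\<close>)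
  qed
  ultimately have "((\<lambda>t. 1 / p t * vector_derivative p (at t)) has_integral (F 1 - F 0)) {0..1}"
    by (intro fundamental_theorem_of_calculus_interior_strong[where S = K]) auto
  then show ?thesis
    by (simp add: contour_integral_integral integral_unique F_def)
qed

section \<open>Homotopies along segments and smooth representatives\<close>

text \<open>
  A filter with a base of convex sets. Ordinary points and rays have such filters, and for paths that
  converge along them the straight-line homotopy satisfies the uniform end conditions.
\<close>

definition convex_filter :: "'a::real_vector filter \<Rightarrow> bool"
  where "convex_filter F \<longleftrightarrow>
    (\<forall>P. eventually P F \<longrightarrow> (\<exists>C. convex C \<and> (\<forall>z\<in>C. P z) \<and> eventually (\<lambda>z. z \<in> C) F))"

lemma convex_filter_nhds: "convex_filter (nhds (z::'a::real_normed_vector))"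
  unfolding convex_filter_def
proof (intro allI impI)
  fix P assume "eventually P (nhds z)"
  then obtain e where e: "e > 0" "\<And>w. dist w z < e \<Longrightarrow> P w"
    unfolding eventually_nhds_metric by blast
  then have "\<forall>w\<in>ball z e. P w" by (auto simp: dist_commute)
  moreover have "\<forall>\<^sub>F w in nhds z. w \<in> ball z e" using e by (intro eventually_nhds_in_open) auto
  ultimately show "\<exists>C. convex C \<and> (\<forall>w\<in>C. P w) \<and> (\<forall>\<^sub>F w in nhds z. w \<in> C)"
    using convex_ball by blast
qed

lemma convex_filter_at_right: "convex_filter (at_right (a::real))"
  unfolding convex_filter_def
proof (intro allI impI)
  fix P assume "eventually P (at_right a)"
  then obtain b where b: "b > a" "\<And>y. y > a \<Longrightarrow> y < b \<Longrightarrow> P y"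
    unfolding eventually_at_right_field by blast
  have "\<forall>\<^sub>F y in at_right a. y \<in> {a<..<b}" by (rule eventually_at_rightI[OF _ b(1)])
  then show "\<exists>C. convex C \<and> (\<forall>y\<in>C. P y) \<and> (\<forall>\<^sub>F y in at_right a. y \<in> C)"
    using b(2) by (intro exI[of _ "{a<..<b}"]) auto
qed

lemma convex_filter_at_left: "convex_filter (at_left (a::real))"
  unfolding convex_filter_def
proof (intro allI impI)
  fix P assume "eventually P (at_left a)"
  then obtain b where b: "b < a" "\<And>y. y > b \<Longrightarrow> y < a \<Longrightarrow> P y"
    unfolding eventually_at_left_field by blast
  have "\<forall>\<^sub>F y in at_left a. y \<in> {b<..<a}" by (rule eventually_at_leftI[OF _ b(1)])
  then show "\<exists>C. convex C \<and> (\<forall>y\<in>C. P y) \<and> (\<forall>\<^sub>F y in at_left a. y \<in> C)"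
    using b(2) by (intro exI[of _ "{b<..<a}"]) auto
qed

lemma convex_filter_at_bot: "convex_filter (at_bot :: real filter)"
  unfolding convex_filter_def
proof (intro allI impI)
  fix P :: "real \<Rightarrow> bool" assume "eventually P at_bot"
  then obtain b where "\<And>y. y \<le> b \<Longrightarrow> P y"
    unfolding eventually_at_bot_linorder by blast
  then show "\<exists>C. convex C \<and> (\<forall>y\<in>C. P y) \<and> (\<forall>\<^sub>F y in at_bot. y \<in> C)"
    by (intro exI[of _ "{..b}"]) (auto simp: eventually_at_bot_linorder)
qed

lemma convex_filter_of_real:
  assumes "convex_filter F"
  shows "convex_filter (filtermap complex_of_real F)"
  unfolding convex_filter_def
proof (intro allI impI)
  fix P assume "eventually P (filtermap complex_of_real F)"
  then have "eventually (\<lambda>t. P (of_real t)) F" by (simp add: eventually_filtermap)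
  then obtain C where "convex C" "\<forall>t\<in>C. P (of_real t)" "\<forall>\<^sub>F t in F. t \<in> C"
    using assms unfolding convex_filter_def by blast
  then show "\<exists>C. convex C \<and> (\<forall>z\<in>C. P z) \<and> (\<forall>\<^sub>F z in filtermap complex_of_real F. z \<in> C)"
    by (intro exI[of _ "of_real ` C"])
      (auto simp: eventually_filtermap linear_iff scaleR_conv_of_real intro!: convex_linear_image
            elim: eventually_mono)
qed

lemmas convex_base_filters =
  convex_filter_at_right[of 0, THEN convex_filter_of_real, folded base_01_def]
  convex_filter_at_left[of 1, THEN convex_filter_of_real, folded base_10_def]
  convex_filter_at_left[of 0, THEN convex_filter_of_real, folded base_0inf_def]
  convex_filter_at_bot[THEN convex_filter_of_real, folded base_inf0_def]

lemma filterlim_convex_combination: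
  fixes p q :: "real \<Rightarrow> 'a::real_vector"
  assumes T: "convex_filter T" and p: "filterlim p T F" and q: "filterlim q T F"
  shows "filterlim (\<lambda>x. (1 - fst x) *\<^sub>R p (snd x) + fst x *\<^sub>R q (snd x)) T (principal {0..1} \<times>\<^sub>F F)"
  unfolding filterlim_iff
proof (intro allI impI)
  fix P assume "eventually P T"
  then obtain C where C: "convex C" "\<forall>z\<in>C. P z" "\<forall>\<^sub>F z in T. z \<in> C"
    using T unfolding convex_filter_def by blast
  have "\<forall>\<^sub>F t in F. p t \<in> C" "\<forall>\<^sub>F t in F. q t \<in> C"
    using p q C(3) unfolding filterlim_iff by blast+
  then have "\<forall>\<^sub>F t in F. \<forall>s\<in>{0..1}. P ((1 - fst (s, t)) *\<^sub>R p (snd (s, t)) + fst (s, t) *\<^sub>R q (snd (s, t)))"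
  proof eventually_elim
    case (elim t)
    then have "(1 - s) *\<^sub>R p t + s *\<^sub>R q t \<in> C" if "s \<in> {0..1}" for s
      using that C(1) by (intro convexD) auto
    then show ?case using C(2) by simp
  qed
  then show "\<forall>\<^sub>F x in principal {0..1} \<times>\<^sub>F F. P ((1 - fst x) *\<^sub>R p (snd x) + fst x *\<^sub>R q (snd x))"
    unfolding eventually_principal_prod .
qed

lemma path_homotopic_linear:
  fixes p q :: "real \<Rightarrow> 'a::real_normed_vector"
  assumes p: "p \<in> base_paths W S T" and q: "q \<in> base_paths W S T"
    and S: "convex_filter S" and T: "convex_filter T"
    and seg: "\<And>t. t \<in> {0<..<1} \<Longrightarrow> closed_segment (p t) (q t) \<subseteq> W"
  shows "path_homotopic W S T p q"
  unfolding path_homotopic_def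
proof (intro conjI p q exI[of _ "\<lambda>x. (1 - fst x) *\<^sub>R p (snd x) + fst x *\<^sub>R q (snd x)"])
  have "continuous_on ({0..1} \<times> {0<..<1}) (\<lambda>x. p (snd x))" "continuous_on ({0..1} \<times> {0<..<1}) (\<lambda>x. q (snd x))"
    by (auto intro!: continuous_on_compose2[OF base_pathsD(1)[OF p]] continuous_on_compose2[OF base_pathsD(1)[OF q]]
        continuous_intros)
  then show "continuous_on ({0..1} \<times> {0<..<1}) (\<lambda>x. (1 - fst x) *\<^sub>R p (snd x) + fst x *\<^sub>R q (snd x))"
    by (intro continuous_intros)
  show "(\<lambda>x. (1 - fst x) *\<^sub>R p (snd x) + fst x *\<^sub>R q (snd x)) ` ({0..1} \<times> {0<..<1}) \<subseteq> W"
    using seg by (force simp: closed_segment_def)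
  show "filterlim (\<lambda>x. (1 - fst x) *\<^sub>R p (snd x) + fst x *\<^sub>R q (snd x)) S (principal {0..1} \<times>\<^sub>F at_right 0)"
    by (rule filterlim_convex_combination[OF S base_pathsD(3)[OF p] base_pathsD(3)[OF q]])
  show "filterlim (\<lambda>x. (1 - fst x) *\<^sub>R p (snd x) + fst x *\<^sub>R q (snd x)) T (principal {0..1} \<times>\<^sub>F at_left 1)"
    by (rule filterlim_convex_combination[OF T base_pathsD(4)[OF p] base_pathsD(4)[OF q]])
qed auto

text \<open>
  Replacing \<open>t\<close> by \<open>t\<^sup>n\<close> makes the path spend an arbitrarily large initial part of its time near its
  start.
\<close>

lemma path_homotopic_power:
  fixes p :: "real \<Rightarrow> 'a::topological_space"
  assumes p: "p \<in> base_paths W S T" and n: "n \<ge> 1"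
  shows "path_homotopic W S T p (\<lambda>t. p (t ^ n))"
proof -
  define \<theta> where "\<theta> x = (1 - fst x) *\<^sub>R snd x + fst x *\<^sub>R snd x ^ n" for x :: "real \<times> real"
  have pow: "t ^ n \<in> {0<..<1}" if "t \<in> {0<..<1::real}" for t
    using that n by (auto simp: power_less_one_iff)
  have pow0: "filterlim (\<lambda>t::real. t ^ n) (at_right 0) (at_right 0)"
  proof (rule filterlim_at_withinI)
    have "((\<lambda>t::real. t ^ n) \<longlongrightarrow> 0 ^ n) (at_right 0)" by (intro tendsto_intros)
    then show "((\<lambda>t::real. t ^ n) \<longlongrightarrow> 0) (at_right 0)" using n by (simp add: power_0_left)
    show "\<forall>\<^sub>F t in at_right 0. t ^ n \<in> {0<..} - {0::real}"
      by (rule eventually_at_rightI[of _ 1]) auto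
  qed
  have pow1: "filterlim (\<lambda>t::real. t ^ n) (at_left 1) (at_left 1)"
  proof (rule filterlim_at_withinI)
    have "((\<lambda>t::real. t ^ n) \<longlongrightarrow> 1 ^ n) (at_left 1)" by (intro tendsto_intros)
    then show "((\<lambda>t::real. t ^ n) \<longlongrightarrow> 1) (at_left 1)" by simp
    show "\<forall>\<^sub>F t in at_left 1. t ^ n \<in> {..<1} - {1::real}"
      by (rule eventually_at_leftI[of 0]) (use pow in auto)
  qed
  have id: "filterlim (\<lambda>t::real. t) F F" for F by (simp add: filterlim_def filtermap_ident)
  have \<theta>: "\<theta> x \<in> {0<..<1}" if "x \<in> {0..1} \<times> {0<..<1}" for x
  proof -
    have "convex {0<..<1::real}" by simp
    then show ?thesis unfolding \<theta>_def using that pow[of "snd x"] by (intro convexD) auto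
  qed
  have \<theta>_cont: "continuous_on A \<theta>" for A unfolding \<theta>_def by (intro continuous_intros)
  have \<theta>0: "filterlim \<theta> (at_right 0) (principal {0..1} \<times>\<^sub>F at_right 0)"
    unfolding \<theta>_def by (rule filterlim_convex_combination[OF convex_filter_at_right id pow0])
  have \<theta>1: "filterlim \<theta> (at_left 1) (principal {0..1} \<times>\<^sub>F at_left 1)"
    unfolding \<theta>_def by (rule filterlim_convex_combination[OF convex_filter_at_left id pow1])
  show ?thesis
    unfolding path_homotopic_def
  proof (intro conjI p exI[of _ "\<lambda>x. p (\<theta> x)"])
    show "(\<lambda>t. p (t ^ n)) \<in> base_paths W S T"
      unfolding base_paths_def
      using base_pathsD(2)[OF p pow] pow
        filterlim_compose[OF base_pathsD(3)[OF p] pow0] filterlim_compose[OF base_pathsD(4)[OF p] pow1]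
      by (auto intro!: continuous_on_compose2[OF base_pathsD(1)[OF p]] continuous_intros)
    show "continuous_on ({0..1} \<times> {0<..<1}) (\<lambda>x. p (\<theta> x))"
      using \<theta> by (intro continuous_on_compose2[OF base_pathsD(1)[OF p] \<theta>_cont]) auto
    show "(\<lambda>x. p (\<theta> x)) ` ({0..1} \<times> {0<..<1}) \<subseteq> W"
      using \<theta> base_pathsD(2)[OF p] by blast
    show "filterlim (\<lambda>x. p (\<theta> x)) S (principal {0..1} \<times>\<^sub>F at_right 0)"
      by (rule filterlim_compose[OF base_pathsD(3)[OF p] \<theta>0])
    show "filterlim (\<lambda>x. p (\<theta> x)) T (principal {0..1} \<times>\<^sub>F at_left 1)"
      by (rule filterlim_compose[OF base_pathsD(4)[OF p] \<theta>1])
  qed (auto simp: \<theta>_def)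
qed

lemma path_mult_joinI:
  fixes a b :: "real \<Rightarrow> 'a::real_normed_vector"
  assumes "r 0 = a 1" "a +++ r \<in> A" "reversepath r +++ b \<in> B"
  shows "a +++ b \<in> A \<odot> B"
proof -
  have "subpath 0 (1/2) (a +++ b) +++ r = a +++ r"
    by (auto simp: joinpaths_def subpath_def fun_eq_iff)
  moreover have "reversepath r +++ subpath (1/2) 1 (a +++ b) = reversepath r +++ b"
    by (auto simp: joinpaths_def subpath_def fun_eq_iff field_simps)
  moreover have "(a +++ b) (1/2) = a 1" by (simp add: joinpaths_def)
  ultimately show ?thesis using assms unfolding path_mult_def by auto
qed

lemma filterlim_eventually_eq:
  "filterlim f F G \<Longrightarrow> \<forall>\<^sub>F x in G. f x = g x \<Longrightarrow> filterlim g F G"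
  using filterlim_cong[of F F G G f g] by simp

lemma joinpaths_base_paths:
  fixes a b :: "real \<Rightarrow> 'a::real_normed_vector"
  assumes a: "continuous_on {0<..1} a" "\<And>t. t \<in> {0<..1} \<Longrightarrow> a t \<in> W" "filterlim a S (at_right 0)"
    and b: "continuous_on {0..<1} b" "\<And>t. t \<in> {0..<1} \<Longrightarrow> b t \<in> W" "filterlim b T (at_left 1)"
    and "a 1 = b 0"
  shows "a +++ b \<in> base_paths W S T"
proof -
  have "continuous_on {0<..<1} (a +++ b)"
  proof (rule continuous_on_halves)
    have "continuous_on {0<..1/2} (\<lambda>t. a (2 * t))"
      by (rule continuous_on_compose2[OF a(1)]) (auto intro!: continuous_intros)
    then show "continuous_on {0<..1/2} (a +++ b)"
      by (rule continuous_on_eq) (auto simp: joinpaths_def)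
    have "continuous_on {1/2..<1} (\<lambda>t. b (2 * t - 1))"
      by (rule continuous_on_compose2[OF b(1)]) (auto intro!: continuous_intros)
    then show "continuous_on {1/2..<1} (a +++ b)"
    proof (rule continuous_on_eq)
      fix t :: real assume "t \<in> {1/2..<1}"
      then consider "2 * t - 1 = 0" "2 * t = 1" "t \<le> 1/2" | "\<not> t \<le> 1/2" by fastforce
      then show "b (2 * t - 1) = (a +++ b) t"
        using assms(7) by cases (simp_all only: joinpaths_def if_True if_False)
    qed
  qed
  moreover have "(a +++ b) t \<in> W" if "t \<in> {0<..<1}" for t
    using that a(2)[of "2 * t"] b(2)[of "2 * t - 1"] by (auto simp: joinpaths_def)
  moreover have "filterlim (a +++ b) S (at_right 0)"
  proof -
    have "filterlim (\<lambda>t::real. 2 * t) (at_right 0) (at_right 0)" by real_asymp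
    from filterlim_compose[OF a(3) this] have "filterlim (\<lambda>t. a (2 * t)) S (at_right 0)" .
    moreover have "\<forall>\<^sub>F t in at_right 0. a (2 * t) = (a +++ b) t"
      by (rule eventually_at_rightI[of _ "1/2"]) (auto simp: joinpaths_def)
    ultimately show ?thesis by (rule filterlim_eventually_eq)
  qed
  moreover have "filterlim (a +++ b) T (at_left 1)"
  proof -
    have "filterlim (\<lambda>t::real. 2 * t - 1) (at_left 1) (at_left 1)" by real_asymp
    from filterlim_compose[OF b(3) this] have "filterlim (\<lambda>t. b (2 * t - 1)) T (at_left 1)" .
    moreover have "\<forall>\<^sub>F t in at_left 1. b (2 * t - 1) = (a +++ b) t"
      by (rule eventually_at_leftI[of "1/2"]) (auto simp: joinpaths_def)
    ultimately show ?thesis by (rule filterlim_eventually_eq)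
  qed
  ultimately show ?thesis by (auto simp: base_paths_def)
qed

text \<open>
  The part of a detour in a product that runs from \<open>c\<close> along the ray \<open>K\<close> to the tangential base point.
\<close>

definition ray_path :: "complex set \<Rightarrow> complex filter \<Rightarrow> complex \<Rightarrow> (real \<Rightarrow> complex) \<Rightarrow> bool"
  where "ray_path K T c r \<longleftrightarrow>
    r 0 = c \<and> continuous_on {0..<1} r \<and> r ` {0..<1} \<subseteq> K \<and> filterlim r T (at_left 1)"

lemma ray_path_reverse:
  assumes "ray_path K T c r"
  shows "continuous_on {0<..1} (reversepath r)" "\<And>t. t \<in> {0<..1} \<Longrightarrow> reversepath r t \<in> K"
    "filterlim (reversepath r) T (at_right 0)" "reversepath r 1 = c"
proof -
  have r: "r 0 = c" "continuous_on {0..<1} r" "r ` {0..<1} \<subseteq> K" "filterlim r T (at_left 1)"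
    using assms by (auto simp: ray_path_def)
  show "continuous_on {0<..1} (reversepath r)"
    unfolding reversepath_def
    by (rule continuous_on_compose2[OF r(2)]) (auto intro!: continuous_intros)
  show "reversepath r t \<in> K" if "t \<in> {0<..1}" for t
  proof -
    have "1 - t \<in> {0..<1}" using that by auto
    then show ?thesis using r(3) by (auto simp: reversepath_def)
  qed
  show "reversepath r 1 = c" using r(1) by (simp add: reversepath_def)
  have "filterlim (\<lambda>t::real. 1 - t) (at_left 1) (at_right 0)" by real_asymp
  then show "filterlim (reversepath r) T (at_right 0)"
    unfolding reversepath_def by (rule filterlim_compose[OF r(4)])
qed

text \<open>
  Slow \<open>\<beta>\<close> down until it stays on the ray up to time 3/4. The new path comes back along the ray to \<open>c\<close>
  up to time 1/2, moves within the ray to the position of \<open>\<beta>\<close> at time 3/4, and then follows a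
  polynomial approximation of \<open>\<beta>\<close>. At each time the segment between the two paths lies in the ray or
  in a small disc, so the straight-line homotopy joins them. The path \<open>b\<close> works for every detour \<open>r\<close>
  at once.
\<close>

theorem smooth_tail_exists:
  assumes \<beta>: "\<beta> \<in> base_paths W T (nhds z)" and W: "open W" "z \<in> W"
    and K: "convex K" "K \<subseteq> W" "\<forall>\<^sub>F w in T. w \<in> K" and T: "convex_filter T" and c: "c \<in> K"
  obtains n b where "n \<ge> 1" "valid_path b" "b 0 = c" "b 1 = z"
    "\<And>r. ray_path K T c r \<Longrightarrow> path_homotopic W T (nhds z) (\<lambda>t. \<beta> (t ^ n)) (reversepath r +++ b)"
proof -
  have "\<forall>\<^sub>F t in at_right 0. \<beta> t \<in> K"
    using base_pathsD(3)[OF \<beta>] K(3) by (rule filterlim_iff[THEN iffD1, rule_format])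
  then obtain a where a: "0 < a" "a < 1" "\<And>t. 0 < t \<Longrightarrow> t \<le> a \<Longrightarrow> \<beta> t \<in> K"
    unfolding eventually_at_right_0_iff by blast
  \<comment> \<open>with this exponent the slowed down path stays on the ray up to time 3/4\<close>
  obtain m where m: "(3/4::real) ^ m < a"
    using real_arch_pow_inv[OF a(1), of "3/4"] by auto
  define n where "n = Suc m"
  have "(3/4::real) ^ n \<le> (3/4) ^ m" unfolding n_def by (intro power_decreasing) auto
  with m have "(3/4::real) ^ n \<le> a" by linarith
  moreover have "n \<ge> 1" by (simp add: n_def)
  ultimately have n: "n \<ge> 1" "(3/4::real) ^ n \<le> a" by blast+
  define \<beta>' where "\<beta>' t = \<beta> (t ^ n)" for t
  have \<beta>'_K: "\<beta>' t \<in> K" if "0 < t" "t \<le> 3/4" for t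
  proof -
    have "t ^ n \<le> (3/4) ^ n" using that by (intro power_mono) auto
    then have "t ^ n \<le> a" using n(2) by linarith
    then show ?thesis using a(3)[of "t ^ n"] that by (simp add: \<beta>'_def)
  qed
  have \<beta>': "\<beta>' \<in> base_paths W T (nhds z)"
    using path_homotopic_power[OF \<beta> n(1)] unfolding path_homotopic_def \<beta>'_def by blast
  \<comment> \<open>the last quarter of the slowed down path, closed up by its end point\<close>
  define g where "g u = (if u \<ge> 1 then z else \<beta>' (3/4 + u/4))" for u
  have "path g"
    unfolding path_def continuous_on_def
  proof
    fix u :: real assume u: "u \<in> {0..1}"
    show "(g \<longlongrightarrow> g u) (at u within {0..1})"
    proof (cases "u = 1")
      case True
      have "filterlim (\<lambda>u::real. 3/4 + u/4) (at_left 1) (at_left 1)" by real_asymp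
      from filterlim_compose[OF base_pathsD(4)[OF \<beta>'] this]
      have "((\<lambda>u. \<beta>' (3/4 + u/4)) \<longlongrightarrow> z) (at_left 1)" .
      moreover have "\<forall>\<^sub>F u in at_left 1. \<beta>' (3/4 + u/4) = g u"
        by (rule eventually_at_leftI[of 0]) (auto simp: g_def)
      ultimately have "(g \<longlongrightarrow> z) (at_left 1)" by (rule Lim_transform_eventually)
      then show ?thesis using True by (simp add: at_within_Icc_at_left g_def)
    next
      case False
      have "continuous_on {-1<..<1} (\<lambda>u. \<beta>' (3/4 + u/4))"
        by (rule continuous_on_compose2[OF base_pathsD(1)[OF \<beta>']]) (auto intro!: continuous_intros)
      then have "((\<lambda>u. \<beta>' (3/4 + u/4)) \<longlongrightarrow> g u) (at u)"
        using continuous_on_eq_continuous_at[of "{-1<..<1::real}" "\<lambda>u. \<beta>' (3/4 + u/4)"] u False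
        by (auto simp: isCont_def g_def)
      moreover have "\<forall>\<^sub>F v in at u. v \<in> {-1<..<1}"
        using u False by (intro eventually_at_in_open') auto
      then have "\<forall>\<^sub>F v in at u. \<beta>' (3/4 + v/4) = g v"
        by eventually_elim (auto simp: g_def)
      ultimately have "(g \<longlongrightarrow> g u) (at u)" by (rule Lim_transform_eventually)
      then show ?thesis by (rule tendsto_within_subset) auto
    qed
  qed
  moreover have "g ` {0..1} \<subseteq> W"
    using base_pathsD(2)[OF \<beta>'] W(2) by (auto simp: g_def)
  ultimately obtain e where e: "e > 0" "(\<Union>x\<in>g ` {0..1}. ball x e) \<subseteq> W"
    using compact_subset_open_imp_ball_epsilon_subset[of "g ` {0..1}" W] W(1)
    by (metis compact_path_image path_image_def)
  obtain f where f: "polynomial_function f" "pathstart f = pathstart g" "pathfinish f = pathfinish g"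
    "\<And>t. t \<in> {0..1} \<Longrightarrow> norm (f t - g t) < e"
    using path_approx_polynomial_function[OF \<open>path g\<close> e(1)] by metis
  define b where "b = linepath c (g 0) +++ f"
  have f01: "f 0 = g 0" "f 1 = z" using f(2,3) by (auto simp: pathstart_def pathfinish_def g_def)
  have "valid_path b"
    unfolding b_def using f01 valid_path_polynomial_function[OF f(1)]
    by (intro valid_path_join) (auto simp: pathstart_def)
  moreover have "b 0 = c" "b 1 = z"
    using f01 by (auto simp: b_def joinpaths_def linepath_def)
  ultimately have b: "valid_path b" "b 0 = c" "b 1 = z" by blast+
  have g0: "g 0 = \<beta>' (3/4)" by (simp add: g_def)
  have line_K: "linepath c (g 0) u \<in> K" if "u \<in> {0..1}" for u
    using K(1) c \<beta>'_K[of "3/4"] that unfolding linepath_def g0 by (intro convexD) auto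
  have f_ball: "f u \<in> ball (g u) e" if "u \<in> {0..1}" for u
    using f(4)[OF that] by (simp add: dist_norm norm_minus_commute)
  have b_W: "b u \<in> W" if "u \<in> {0..1}" for u
  proof -
    have "f v \<in> W" if "v \<in> {0..1}" for v using f_ball[OF that] e(2) that by blast
    then show ?thesis
      using that line_K[of "2 * u"] K(2) by (auto simp: b_def joinpaths_def)
  qed
  have "path_homotopic W T (nhds z) \<beta>' (reversepath r +++ b)" if r: "ray_path K T c r" for r
  proof (rule path_homotopic_linear[OF \<beta>' _ T convex_filter_nhds])
    have "continuous_on {0..1} b" using valid_path_imp_path[OF b(1)] by (simp add: path_def)
    moreover have "(b \<longlongrightarrow> z) (at_left 1)"
      using \<open>continuous_on {0..1} b\<close> b(3) unfolding continuous_on_def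
      by (auto simp: at_within_Icc_at_left dest!: bspec[of _ _ 1])
    ultimately show "reversepath r +++ b \<in> base_paths W T (nhds z)"
      using ray_path_reverse[OF r] K(2) b_W b(2)
      by (intro joinpaths_base_paths) (auto elim!: continuous_on_subset)
    fix t :: real assume t: "t \<in> {0<..<1}"
    show "closed_segment (\<beta>' t) ((reversepath r +++ b) t) \<subseteq> W"
    proof (cases "t \<le> 3/4")
      case True
      have "(reversepath r +++ b) t \<in> K"
      proof (cases "t \<le> 1/2")
        case True
        then show ?thesis using ray_path_reverse(2)[OF r, of "2 * t"] t by (simp add: joinpaths_def)
      next
        case False
        then show ?thesis using line_K[of "2 * (2 * t - 1)"] \<open>t \<le> 3/4\<close>
          by (simp add: joinpaths_def b_def)
      qed
      then show ?thesis
        using closed_segment_subset[OF \<beta>'_K _ K(1)] True t K(2) by fastforce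
    next
      case False
      define u where "u = 4 * t - 3"
      have u: "u \<in> {0..1}" "u < 1" using False t by (auto simp: u_def)
      have "g u = \<beta>' t" using u by (simp add: g_def u_def field_simps)
      moreover have "(reversepath r +++ b) t = f u"
        using False by (simp add: joinpaths_def b_def u_def)
      moreover have "closed_segment (g u) (f u) \<subseteq> ball (g u) e"
        using f_ball[OF u(1)] e(1) by (intro closed_segment_subset) auto
      ultimately show ?thesis using e(2) u(1) by fastforce
    qed
  qed
  then show ?thesis using that n(1) b unfolding \<beta>'_def by blast
qed

section \<open>The paths joining the tangential base points\<close>

definition pos_ray :: "complex set" where "pos_ray = of_real ` {0<..<1}"
definition neg_ray :: "complex set" where "neg_ray = of_real ` {..<0}"

lemma pos_ray: "convex pos_ray" "pos_ray \<subseteq> P1_minus" "of_real t \<in> pos_ray \<longleftrightarrow> 0 < t \<and> t < 1"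
  by (auto simp: pos_ray_def P1_minus_def linear_iff scaleR_conv_of_real intro!: convex_linear_image)

lemma neg_ray: "convex neg_ray" "neg_ray \<subseteq> P1_minus" "of_real t \<in> neg_ray \<longleftrightarrow> t < 0"
  by (auto simp: neg_ray_def P1_minus_def linear_iff scaleR_conv_of_real complex_eq_iff intro!: convex_linear_image)

lemma eventually_base_in_ray:
  "\<forall>\<^sub>F z in base_01. z \<in> pos_ray" "\<forall>\<^sub>F z in base_10. z \<in> pos_ray"
  "\<forall>\<^sub>F z in base_0inf. z \<in> neg_ray" "\<forall>\<^sub>F z in base_inf0. z \<in> neg_ray"
proof -
  show "\<forall>\<^sub>F z in base_01. z \<in> pos_ray"
    unfolding base_01_def eventually_filtermap pos_ray(3) by (rule eventually_at_rightI[of _ 1]) auto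
  show "\<forall>\<^sub>F z in base_10. z \<in> pos_ray"
    unfolding base_10_def eventually_filtermap pos_ray(3) by (rule eventually_at_leftI[of 0]) auto
  show "\<forall>\<^sub>F z in base_0inf. z \<in> neg_ray"
    unfolding base_0inf_def eventually_filtermap neg_ray(3) by (rule eventually_at_leftI[of "-1"]) auto
  show "\<forall>\<^sub>F z in base_inf0. z \<in> neg_ray"
    unfolding base_inf0_def eventually_filtermap neg_ray(3) eventually_at_bot_linorder by (intro exI[of _ "-1"]) auto
qed

lemma rays_in_base_domain: "pos_ray \<subseteq> base_domain" "neg_ray \<subseteq> base_domain"
  by (auto simp: pos_ray_def neg_ray_def intro!: base_domain_real)

lemma filterlim_of_real:
  assumes "\<forall>\<^sub>F t in G. of_real (\<rho> t) = p t" "filterlim \<rho> F G"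
  shows "filterlim p (filtermap complex_of_real F) G"
proof (rule filterlim_eventually_eq[OF _ assms(1)])
  show "filterlim (\<lambda>t. complex_of_real (\<rho> t)) (filtermap complex_of_real F) G"
    using assms(2) by (auto simp: filterlim_def filtermap_filtermap[symmetric] intro!: filtermap_mono)
qed

lemma half_turn_point:
  assumes "0 < \<rho>"
  shows "t \<le> 1/3 \<Longrightarrow> of_real \<rho> * cis (half_turn_arg t) = of_real \<rho>"
    "2/3 \<le> t \<Longrightarrow> of_real \<rho> * cis (half_turn_arg t) = of_real (- \<rho>)"
    "1/3 < t \<Longrightarrow> t < 2/3 \<Longrightarrow> Im (of_real \<rho> * cis (half_turn_arg t)) > 0"
proof -
  show "of_real \<rho> * cis (half_turn_arg t) = of_real \<rho>" if "t \<le> 1/3"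
    using that by (simp add: half_turn_arg_def)
  show "of_real \<rho> * cis (half_turn_arg t) = of_real (- \<rho>)" if "2/3 \<le> t"
    using that by (simp add: half_turn_arg_def min_def)
  show "Im (of_real \<rho> * cis (half_turn_arg t)) > 0" if t: "1/3 < t" "t < 2/3"
  proof -
    have "half_turn_arg t = pi * (3 * t - 1)" using t by (simp add: half_turn_arg_def min_def max_def)
    moreover have "0 < pi * (3 * t - 1)" "pi * (3 * t - 1) < pi * 1"
      using t by (intro mult_pos_pos mult_strict_left_mono; simp)+
    ultimately have "sin (half_turn_arg t) > 0" by (intro sin_gt_zero) auto
    then show ?thesis using assms by simp
  qed
qed

text \<open>
  The half-turn runs on \<open>(0,1)\<close>, then in the open upper half-plane, then on the negative axis.
\<close>

lemma half_turn_trichotomy: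
  assumes "0 < \<rho>" "t \<le> 1/3 \<Longrightarrow> \<rho> < 1"
  defines "w \<equiv> of_real \<rho> * cis (half_turn_arg t)"
  shows "t \<le> 1/3 \<Longrightarrow> w \<in> pos_ray" "2/3 \<le> t \<Longrightarrow> w \<in> neg_ray" "1/3 < t \<Longrightarrow> t < 2/3 \<Longrightarrow> Im w > 0"
  using half_turn_point[OF assms(1), of t] assms(1,2) unfolding w_def
  by (simp_all add: pos_ray(3) neg_ray(3)[of "- \<rho>", simplified])

lemma in_P1_minus_if: "z \<in> pos_ray \<or> z \<in> neg_ray \<or> Im z > 0 \<Longrightarrow> z \<in> P1_minus"
  using pos_ray(2) neg_ray(2) by (auto simp: P1_minus_def)

lemma in_base_domain_if: "z \<in> pos_ray \<or> z \<in> neg_ray \<or> Im z > 0 \<Longrightarrow> z \<in> base_domain"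
  using rays_in_base_domain base_domain_upper by auto

lemma continuous_on_half_turn [continuous_intros]:
  "continuous_on A \<rho> \<Longrightarrow> continuous_on A (\<lambda>t. of_real (\<rho> t) * cis (half_turn_arg t))"
  unfolding half_turn_arg_def by (intro continuous_intros)

lemma half_turn_base_path:
  assumes "continuous_on {0<..<1} \<rho>" "\<And>t. t \<in> {0<..<1} \<Longrightarrow> 0 < \<rho> t" "\<And>t. 0 < t \<Longrightarrow> t \<le> 1/3 \<Longrightarrow> \<rho> t < 1"
    and "filterlim \<rho> (at_right 0) (at_right 0)" "filterlim (\<lambda>t. - \<rho> t) F (at_left 1)"
  shows "(\<lambda>t. of_real (\<rho> t) * cis (half_turn_arg t)) \<in> base_paths P1_minus base_01 (filtermap complex_of_real F)"
  unfolding base_paths_def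
proof (intro CollectI conjI)
  show "continuous_on {0<..<1} (\<lambda>t. of_real (\<rho> t) * cis (half_turn_arg t))"
    by (intro continuous_intros assms)
  show "(\<lambda>t. of_real (\<rho> t) * cis (half_turn_arg t)) ` {0<..<1} \<subseteq> P1_minus"
  proof
    fix z assume "z \<in> (\<lambda>t. of_real (\<rho> t) * cis (half_turn_arg t)) ` {0<..<1}"
    then obtain t where t: "t \<in> {0<..<1}" "z = of_real (\<rho> t) * cis (half_turn_arg t)" by blast
    then show "z \<in> P1_minus"
      using half_turn_trichotomy[of "\<rho> t" t] assms(2,3) by (intro in_P1_minus_if) (cases "t \<le> 1/3"; cases "2/3 \<le> t"; auto)
  qed
  have "\<forall>\<^sub>F t in at_right 0. of_real (\<rho> t) = of_real (\<rho> t) * cis (half_turn_arg t)"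
    by (rule eventually_at_rightI[of _ "1/3"]) (use half_turn_point(1) assms(2) in auto)
  then show "filterlim (\<lambda>t. of_real (\<rho> t) * cis (half_turn_arg t)) base_01 (at_right 0)"
    unfolding base_01_def by (rule filterlim_of_real) fact
  have "\<forall>\<^sub>F t in at_left 1. of_real (- \<rho> t) = of_real (\<rho> t) * cis (half_turn_arg t)"
    by (rule eventually_at_leftI[of "2/3"]) (use half_turn_point(2) assms(2) in auto)
  then show "filterlim (\<lambda>t. of_real (\<rho> t) * cis (half_turn_arg t)) (filtermap complex_of_real F) (at_left 1)"
    by (rule filterlim_of_real) fact
qed

lemma real_base_path:
  assumes "continuous_on {0<..<1} \<rho>" "\<And>t. t \<in> {0<..<1} \<Longrightarrow> 0 < \<rho> t \<and> \<rho> t < 1"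
    and "filterlim \<rho> F (at_right 0)" "filterlim \<rho> G (at_left 1)"
  shows "(\<lambda>t. of_real (\<rho> t)) \<in> base_paths P1_minus (filtermap complex_of_real F) (filtermap complex_of_real G)"
  unfolding base_paths_def
proof (intro CollectI conjI)
  show "continuous_on {0<..<1} (\<lambda>t. complex_of_real (\<rho> t))"
    using assms(1) by (intro continuous_intros)
  show "(\<lambda>t. complex_of_real (\<rho> t)) ` {0<..<1} \<subseteq> P1_minus"
    using assms(2) pos_ray(2,3) by blast
  show "filterlim (\<lambda>t. of_real (\<rho> t)) (filtermap complex_of_real F) (at_right 0)"
    "filterlim (\<lambda>t. of_real (\<rho> t)) (filtermap complex_of_real G) (at_left 1)"
    by (rule filterlim_of_real[OF _ assms(3)] filterlim_of_real[OF _ assms(4)]; simp)+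
qed

lemma delta_01_base_path: "(\<lambda>t. of_real (t * (1 - t))) \<in> base_paths P1_minus base_01 base_01"
  unfolding base_01_def
proof (rule real_base_path)
  show "filterlim (\<lambda>t::real. t * (1 - t)) (at_right 0) (at_right 0)"
    "filterlim (\<lambda>t::real. t * (1 - t)) (at_right 0) (at_left 1)"
    by real_asymp+
  show "0 < t * (1 - t) \<and> t * (1 - t) < 1" if "t \<in> {0<..<1}" for t :: real
    using that mult_strict_mono[of t 1 "1 - t" 1] by auto
qed (intro continuous_intros)

lemma delta_10_base_path: "(\<lambda>t. of_real t) \<in> base_paths P1_minus base_01 base_10"
  unfolding base_01_def base_10_def
  by (rule real_base_path) (simp_all add: filterlim_def filtermap_ident)

lemma delta_0inf_base_path:
  "(\<lambda>t. of_real (t * (1 - t)) * cis (half_turn_arg t)) \<in> base_paths P1_minus base_01 base_0inf"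
  unfolding base_0inf_def
proof (rule half_turn_base_path)
  show "filterlim (\<lambda>t::real. t * (1 - t)) (at_right 0) (at_right 0)"
    "filterlim (\<lambda>t::real. - (t * (1 - t))) (at_left 0) (at_left 1)"
    by real_asymp+
  show "t * (1 - t) < 1" if "0 < t" "t \<le> 1/3" for t :: real
    using that mult_strict_mono[of t 1 "1 - t" 1] by auto
qed (auto intro!: continuous_intros)

lemma delta_inf0_base_path:
  "(\<lambda>t. of_real (t / (1 - t)) * cis (half_turn_arg t)) \<in> base_paths P1_minus base_01 base_inf0"
  unfolding base_inf0_def
proof (rule half_turn_base_path)
  show "filterlim (\<lambda>t::real. t / (1 - t)) (at_right 0) (at_right 0)"
    "filterlim (\<lambda>t::real. - (t / (1 - t))) at_bot (at_left 1)"
    by real_asymp+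
qed (auto intro!: continuous_intros simp: divide_less_eq)

definition transports_base :: "complex filter \<Rightarrow> complex filter \<Rightarrow> (real \<Rightarrow> complex) set \<Rightarrow> bool"
  where "transports_base S T A \<longleftrightarrow>
    A \<subseteq> base_paths P1_minus S T \<and> (\<forall>p\<in>A. transports p base_polylog base_polylog)"

text \<open>
  A path inside the region carries the base solution to itself, and so does everything homotopic to
  it.
\<close>

lemma transports_base_class:
  assumes d: "d \<in> base_paths P1_minus S T" "\<And>t. t \<in> {0<..<1} \<Longrightarrow> d t \<in> base_domain"
    and S: "\<forall>\<^sub>F z in S. z \<in> base_domain" and T: "\<forall>\<^sub>F z in T. z \<in> base_domain"
  shows "transports_base S T (path_class P1_minus S T d)"
proof -
  have "transports d base_polylog base_polylog"
    unfolding transports_def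
    by (intro exI[of _ "\<lambda>t k. base_polylog k (d t)"] conjI polylog_lift_system[OF polylog_system_base d(2)]) auto
  then show ?thesis
    using transports_homotopic[OF _ polylog_system_base S polylog_system_base T, of d]
    by (auto simp: transports_base_def path_class_def path_homotopic_def)
qed

lemma eventually_base_in_domain:
  "\<forall>\<^sub>F z in base_01. z \<in> base_domain" "\<forall>\<^sub>F z in base_10. z \<in> base_domain"
  "\<forall>\<^sub>F z in base_0inf. z \<in> base_domain" "\<forall>\<^sub>F z in base_inf0. z \<in> base_domain"
  using eventually_base_in_ray rays_in_base_domain by (auto elim!: eventually_mono)

lemma transports_base_delta:
  "transports_base base_01 base_01 delta_01" "transports_base base_01 base_10 delta_10"
  "transports_base base_01 base_0inf delta_0inf" "transports_base base_01 base_inf0 delta_inf0"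
proof -
  have small: "t * (1 - t) < 1" if "0 < t" "t < 1" for t :: real
    using that mult_strict_mono[of t 1 "1 - t" 1] by auto
  show "transports_base base_01 base_01 delta_01"
    unfolding delta_01_def
    by (rule transports_base_class[OF delta_01_base_path])
      (auto simp: eventually_base_in_domain small simp del: of_real_mult intro!: base_domain_real)
  show "transports_base base_01 base_10 delta_10"
    unfolding delta_10_def
    by (rule transports_base_class[OF delta_10_base_path])
      (auto simp: eventually_base_in_domain intro!: base_domain_real)
  show "transports_base base_01 base_0inf delta_0inf"
    unfolding delta_0inf_def
  proof (rule transports_base_class[OF delta_0inf_base_path])
    fix t :: real assume "t \<in> {0<..<1}"
    then show "of_real (t * (1 - t)) * cis (half_turn_arg t) \<in> base_domain"
      using half_turn_trichotomy[of "t * (1 - t)" t] small[of t]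
      by (intro in_base_domain_if) (cases "t \<le> 1/3"; cases "2/3 \<le> t"; auto)
  qed (fact eventually_base_in_domain)+
  show "transports_base base_01 base_inf0 delta_inf0"
    unfolding delta_inf0_def
  proof (rule transports_base_class[OF delta_inf0_base_path])
    fix t :: real assume "t \<in> {0<..<1}"
    then show "of_real (t / (1 - t)) * cis (half_turn_arg t) \<in> base_domain"
      using half_turn_trichotomy[of "t / (1 - t)" t]
      by (intro in_base_domain_if) (cases "t \<le> 1/3"; cases "2/3 \<le> t"; auto simp: divide_less_eq)
  qed (fact eventually_base_in_domain)+
qed


text \<open>
  A segment with one end strictly above the real axis and the other not below it can meet the real
  axis only at that other end.
\<close>

lemma upper_segment:
  assumes "Im a > 0" "Im b \<ge> 0" "b \<in> P1_minus"
  shows "closed_segment a b \<subseteq> P1_minus"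
proof
  fix w assume "w \<in> closed_segment a b"
  then obtain u where u: "0 \<le> u" "u \<le> 1" "w = (1 - u) *\<^sub>R a + u *\<^sub>R b"
    by (auto simp: closed_segment_def)
  show "w \<in> P1_minus"
  proof (cases "u = 1")
    case True
    then show ?thesis using u assms by simp
  next
    case False
    have "Im w = (1 - u) * Im a + u * Im b" by (simp add: u)
    also have "\<dots> > 0" using u assms False by (intro add_pos_nonneg mult_pos_pos mult_nonneg_nonneg) auto
    finally show ?thesis by (intro in_P1_minus_if) simp
  qed
qed

text \<open>
  The class \<open>A\<close> contains a path that begins with a piecewise smooth \<open>e\<close> and ends on the ray \<open>K\<close>. In a
  product of classes \<open>e\<close> can be kept while the part on the ray is absorbed into the detour.
\<close>

definition smooth_start :: "complex set \<Rightarrow> complex filter \<Rightarrow> (real \<Rightarrow> complex) set \<Rightarrow> complex \<Rightarrow> bool"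
  where "smooth_start K T A c \<longleftrightarrow> c \<in> K \<and>
    (\<exists>e r. valid_path e \<and> e 1 = c \<and> ray_path K T c r \<and> e +++ r \<in> A)"

lemma linepath_half: "linepath 0 (1/2) u = (of_real (u / 2) :: complex)"
  by (simp add: linepath_def scaleR_conv_of_real)

lemma filterlim_line_start: "filterlim (linepath 0 (1/2)) base_01 (at_right 0)"
  unfolding base_01_def
proof (rule filterlim_of_real)
  show "\<forall>\<^sub>F t in at_right 0. of_real (t / 2) = (linepath 0 (1/2) t :: complex)"
    by (simp only: linepath_half) simp
  show "filterlim (\<lambda>t::real. t / 2) (at_right 0) (at_right 0)" by real_asymp
qed

definition ray_to_0 :: "real \<Rightarrow> real \<Rightarrow> complex"
  where "ray_to_0 c u = of_real (c * (1 - u))"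

lemma ray_to_0:
  "ray_path pos_ray base_01 (1/2) (ray_to_0 (1/2))" "ray_path neg_ray base_0inf (-1) (ray_to_0 (-1))"
proof -
  have cont: "continuous_on A (ray_to_0 c)" for A c
    unfolding ray_to_0_def by (intro continuous_intros)
  have "filterlim (\<lambda>u::real. 1/2 * (1 - u)) (at_right 0) (at_left 1)" by real_asymp
  then have "filterlim (ray_to_0 (1/2)) base_01 (at_left 1)"
    unfolding base_01_def ray_to_0_def by (intro filterlim_of_real[OF always_eventually]) auto
  moreover have "ray_to_0 (1/2) u \<in> pos_ray" if "u \<in> {0..<1}" for u
    unfolding ray_to_0_def pos_ray(3) using that by auto
  ultimately show "ray_path pos_ray base_01 (1/2) (ray_to_0 (1/2))"
    using cont[of _ "1/2"] unfolding ray_path_def by (auto simp: ray_to_0_def[of _ 0])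
  have "filterlim (\<lambda>u::real. -1 * (1 - u)) (at_left 0) (at_left 1)" by real_asymp
  then have "filterlim (ray_to_0 (-1)) base_0inf (at_left 1)"
    unfolding base_0inf_def ray_to_0_def by (intro filterlim_of_real[OF always_eventually]) auto
  moreover have "ray_to_0 (-1) u \<in> neg_ray" if "u \<in> {0..<1}" for u
    unfolding ray_to_0_def neg_ray(3) using that by auto
  ultimately show "ray_path neg_ray base_0inf (-1) (ray_to_0 (-1))"
    using cont[of _ "-1"] unfolding ray_path_def by (auto simp: ray_to_0_def[of _ 0])
qed

definition ray_to_1 :: "real \<Rightarrow> complex"
  where "ray_to_1 u = of_real ((1 + u) / 2)"

lemma ray_to_1: "ray_path pos_ray base_10 (1/2) ray_to_1"
proof -
  have "filterlim (\<lambda>u::real. (1 + u) / 2) (at_left 1) (at_left 1)" by real_asymp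
  then have "filterlim ray_to_1 base_10 (at_left 1)"
    unfolding base_10_def ray_to_1_def by (intro filterlim_of_real[OF always_eventually]) auto
  moreover have "ray_to_1 u \<in> pos_ray" if "u \<in> {0..<1}" for u
    unfolding ray_to_1_def pos_ray(3) using that by auto
  moreover have "continuous_on A ray_to_1" for A
    unfolding ray_to_1_def by (intro continuous_intros) auto
  ultimately show ?thesis by (auto simp: ray_path_def ray_to_1_def)
qed

definition ray_to_inf :: "real \<Rightarrow> complex"
  where "ray_to_inf u = of_real (- (1 / (1 - u)))"

lemma ray_to_inf: "ray_path neg_ray base_inf0 (-1) ray_to_inf"
proof -
  have "filterlim (\<lambda>t::real. - (1 / (1 - t))) at_bot (at_left 1)" by real_asymp
  then have "filterlim ray_to_inf base_inf0 (at_left 1)"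
    unfolding base_inf0_def ray_to_inf_def by (intro filterlim_of_real[OF always_eventually]) auto
  moreover have "ray_to_inf u \<in> neg_ray" if "u \<in> {0..<1}" for u
    unfolding ray_to_inf_def neg_ray(3) using that by auto
  moreover have "continuous_on {0..<1} ray_to_inf"
    unfolding ray_to_inf_def by (intro continuous_intros) auto
  ultimately show ?thesis by (auto simp: ray_path_def ray_to_inf_def)
qed

lemma ray_path_base_path:
  assumes r: "ray_path K T c r" "K \<subseteq> P1_minus"
    and e: "continuous_on {0<..1} e" "\<And>t. t \<in> {0<..1} \<Longrightarrow> e t \<in> P1_minus" "filterlim e S (at_right 0)" "e 1 = c"
  shows "e +++ r \<in> base_paths P1_minus S T"
proof (rule joinpaths_base_paths[OF e(1-3)])
  show "r t \<in> P1_minus" if "t \<in> {0..<1}" for t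
    using r that by (auto simp: ray_path_def image_subset_iff)
qed (use r(1) e(4) in \<open>auto simp: ray_path_def\<close>)

lemma path_homotopic_within_pos_ray:
  assumes p: "p \<in> base_paths P1_minus S T" "q \<in> base_paths P1_minus S T"
    and "convex_filter S" "convex_filter T" "\<And>t. t \<in> {0<..<1} \<Longrightarrow> p t \<in> pos_ray \<and> q t \<in> pos_ray"
  shows "path_homotopic P1_minus S T p q"
proof (rule path_homotopic_linear[OF assms(1-4)])
  fix t :: real assume "t \<in> {0<..<1}"
  then have "p t \<in> pos_ray" "q t \<in> pos_ray" using assms(5) by auto
  then show "closed_segment (p t) (q t) \<subseteq> P1_minus"
    using closed_segment_subset pos_ray(1,2) by (metis subset_trans)
qed

lemma linepath_half_in_pos_ray: "u \<in> {0<..1} \<Longrightarrow> linepath 0 (1/2) u \<in> pos_ray"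
  unfolding linepath_half pos_ray(3) by auto

lemma join_in_pos_ray:
  assumes "ray_path pos_ray T c r" "\<And>u. u \<in> {0<..1} \<Longrightarrow> e u \<in> pos_ray" "t \<in> {0<..<1}"
  shows "(e +++ r) t \<in> pos_ray"
proof -
  have "r u \<in> pos_ray" if "u \<in> {0..<1}" for u using assms(1) that by (auto simp: ray_path_def)
  then show ?thesis using assms(2)[of "2 * t"] assms(3) by (auto simp: joinpaths_def)
qed

lemma smooth_start_pos:
  "smooth_start pos_ray base_01 delta_01 (1/2)" "smooth_start pos_ray base_10 delta_10 (1/2)"
proof -
  have half: "1/2 \<in> pos_ray" using pos_ray(3)[of "1/2"] by simp
  have e: "continuous_on {0<..1} (linepath 0 (1/2::complex))" "linepath 0 (1/2::complex) 1 = 1/2"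
    "\<And>u. u \<in> {0<..1} \<Longrightarrow> linepath 0 (1/2::complex) u \<in> P1_minus"
    using linepath_half_in_pos_ray pos_ray(2) by (auto simp: linepath_def intro!: continuous_intros)
  have small: "of_real (t * (1 - t)) \<in> pos_ray" if "t \<in> {0<..<1}" for t
    unfolding pos_ray(3) using that mult_strict_mono[of t 1 "1 - t" 1] by auto
  have "path_homotopic P1_minus base_01 base_01 (\<lambda>t. of_real (t * (1 - t))) (linepath 0 (1/2) +++ ray_to_0 (1/2))"
    by (rule path_homotopic_within_pos_ray[OF delta_01_base_path
          ray_path_base_path[OF ray_to_0(1) pos_ray(2) e(1,3) filterlim_line_start e(2)]
          convex_base_filters(1,1) conjI[OF small join_in_pos_ray[OF ray_to_0(1) linepath_half_in_pos_ray]]])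
  then have "linepath 0 (1/2) +++ ray_to_0 (1/2) \<in> delta_01"
    unfolding delta_01_def path_class_def by blast
  then show "smooth_start pos_ray base_01 delta_01 (1/2)"
    unfolding smooth_start_def using half e(2) ray_to_0(1) by (intro conjI exI) auto
  have id: "of_real t \<in> pos_ray" if "t \<in> {0<..<1}" for t using pos_ray(3) that by auto
  have "path_homotopic P1_minus base_01 base_10 (\<lambda>t. of_real t) (linepath 0 (1/2) +++ ray_to_1)"
    by (rule path_homotopic_within_pos_ray[OF delta_10_base_path
          ray_path_base_path[OF ray_to_1 pos_ray(2) e(1,3) filterlim_line_start e(2)]
          convex_base_filters(1,2) conjI[OF id join_in_pos_ray[OF ray_to_1 linepath_half_in_pos_ray]]])
  then have "linepath 0 (1/2) +++ ray_to_1 \<in> delta_10"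
    unfolding delta_10_def path_class_def by blast
  then show "smooth_start pos_ray base_10 delta_10 (1/2)"
    unfolding smooth_start_def using half e(2) ray_to_1 by (intro conjI exI) auto
qed

text \<open>
  A piecewise linear substitute for the half-turn around 0, ending at \<open>-1\<close>; with the ray to 0 or to
  minus infinity attached it represents the two half-turn classes.
\<close>

definition upper_detour :: "real \<Rightarrow> complex"
  where "upper_detour = linepath 0 (1/2) +++ (linepath (1/2) \<i> +++ linepath \<i> (-1))"

lemma upper_detour:
  "valid_path upper_detour" "upper_detour 1 = -1"
  "u \<in> {0<..1/2} \<Longrightarrow> upper_detour u \<in> pos_ray" "u \<in> {1/2<..<1} \<Longrightarrow> Im (upper_detour u) > 0"
  "filterlim upper_detour base_01 (at_right 0)"
proof -
  show "valid_path upper_detour"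
    unfolding upper_detour_def by (intro valid_path_join valid_path_linepath) auto
  show "upper_detour 1 = -1" by (simp add: upper_detour_def joinpaths_def linepath_def)
  show "upper_detour u \<in> pos_ray" if "u \<in> {0<..1/2}"
    using that linepath_half_in_pos_ray[of "2 * u"] by (simp add: upper_detour_def joinpaths_def)
  show "Im (upper_detour u) > 0" if "u \<in> {1/2<..<1}"
    using that by (auto simp: upper_detour_def joinpaths_def linepath_def)
  have "filterlim (\<lambda>t::real. 2 * t) (at_right 0) (at_right 0)" by real_asymp
  from filterlim_compose[OF filterlim_line_start this]
  show "filterlim upper_detour base_01 (at_right 0)"
    by (rule filterlim_eventually_eq)
      (rule eventually_at_rightI[of _ "1/2"]; simp add: upper_detour_def joinpaths_def)
qed

text \<open>
  The detour leaves the real axis at time 1/4 and is back at time 1/2, the half-turn does so at times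
  1/3 and 2/3. Hence at each time both points lie on the same ray, or one of them lies strictly above
  the real axis and the other not below it, and the straight-line homotopy avoids 0 and 1.
\<close>

lemma smooth_start_upper:
  assumes d: "d = (\<lambda>t. of_real (\<rho> t) * cis (half_turn_arg t))" "d \<in> base_paths P1_minus base_01 T"
    and \<rho>: "\<And>t. t \<in> {0<..<1} \<Longrightarrow> 0 < \<rho> t" "\<And>t. 0 < t \<Longrightarrow> t \<le> 1/3 \<Longrightarrow> \<rho> t < 1"
    and r: "ray_path neg_ray T (-1) r" and T: "convex_filter T"
  shows "smooth_start neg_ray T (path_class P1_minus base_01 T d) (-1)"
proof -
  let ?q = "upper_detour +++ r"
  have m1: "-1 \<in> neg_ray" using neg_ray(3)[of "-1"] by simp
  have q: "?q \<in> base_paths P1_minus base_01 T"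
  proof (rule ray_path_base_path[OF r neg_ray(2) _ _ upper_detour(5,2)])
    show "continuous_on {0<..1} upper_detour"
      using valid_path_imp_path[OF upper_detour(1)] by (auto simp: path_def elim: continuous_on_subset)
    show "upper_detour u \<in> P1_minus" if "u \<in> {0<..1}" for u
    proof -
      have "u \<in> {0<..1/2} \<or> u \<in> {1/2<..<1} \<or> u = 1" using that by auto
      then show ?thesis
        using upper_detour(2) upper_detour(3,4)[of u] m1 by (intro in_P1_minus_if) auto
    qed
  qed
  have r_neg: "r u \<in> neg_ray" if "u \<in> {0..<1}" for u using r that by (auto simp: ray_path_def)
  have q_cases: "t \<le> 1/4 \<Longrightarrow> ?q t \<in> pos_ray" "1/4 < t \<Longrightarrow> t < 1/2 \<Longrightarrow> Im (?q t) > 0"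
      "1/2 \<le> t \<Longrightarrow> ?q t \<in> neg_ray" if "t \<in> {0<..<1}" for t
  proof -
    show "?q t \<in> pos_ray" if "t \<le> 1/4"
      using that \<open>t \<in> {0<..<1}\<close> upper_detour(3)[of "2 * t"] by (simp add: joinpaths_def)
    show "Im (?q t) > 0" if "1/4 < t" "t < 1/2"
      using that upper_detour(4)[of "2 * t"] by (simp add: joinpaths_def)
    show "?q t \<in> neg_ray" if "1/2 \<le> t"
    proof (cases "t = 1/2")
      case True
      show ?thesis unfolding True using upper_detour(2) m1 by (simp add: joinpaths_def)
    next
      case False
      then show ?thesis using that \<open>t \<in> {0<..<1}\<close> r_neg[of "2 * t - 1"] by (simp add: joinpaths_def)
    qed
  qed
  have Im_pos: "Im z = 0" if "z \<in> pos_ray" for z using that by (auto simp: pos_ray_def)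
  have Im_neg: "Im z = 0" if "z \<in> neg_ray" for z using that by (auto simp: neg_ray_def)
  have "path_homotopic P1_minus base_01 T d ?q"
  proof (rule path_homotopic_linear[OF d(2) q convex_base_filters(1) T])
    fix t :: real assume t: "t \<in> {0<..<1}"
    have P1: "d t \<in> P1_minus" "?q t \<in> P1_minus"
      using base_pathsD(2)[OF d(2) t] base_pathsD(2)[OF q t] .
    have tri: "t \<le> 1/3 \<Longrightarrow> d t \<in> pos_ray" "2/3 \<le> t \<Longrightarrow> d t \<in> neg_ray"
        "1/3 < t \<Longrightarrow> t < 2/3 \<Longrightarrow> Im (d t) > 0"
      using half_turn_trichotomy[of "\<rho> t" t] \<rho> t unfolding d(1) by auto
    have Imq: "Im (?q t) \<ge> 0"
      using q_cases[OF t] Im_pos[of "?q t"] Im_neg[of "?q t"] by linarith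
    consider "t \<le> 1/4" | "1/4 < t" "t \<le> 1/3" | "1/3 < t" "t < 2/3" | "2/3 \<le> t" by linarith
    then show "closed_segment (d t) (?q t) \<subseteq> P1_minus"
    proof cases
      case 1
      then show ?thesis
        using closed_segment_subset[OF tri(1) q_cases(1)[OF t] pos_ray(1)] pos_ray(2) by auto
    next
      case 2
      then show ?thesis
        using upper_segment[OF q_cases(2)[OF t] _ P1(1)] Im_pos[OF tri(1)]
        by (simp add: closed_segment_commute)
    next
      case 3
      then show ?thesis using upper_segment[OF tri(3) Imq P1(2)] by simp
    next
      case 4
      then show ?thesis
        using closed_segment_subset[OF tri(2) q_cases(3)[OF t] neg_ray(1)] neg_ray(2) by auto
    qed
  qed
  then show ?thesis
    unfolding smooth_start_def path_class_def using m1 upper_detour(1,2) r by blast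
qed

lemma smooth_start_neg:
  "smooth_start neg_ray base_0inf delta_0inf (-1)" "smooth_start neg_ray base_inf0 delta_inf0 (-1)"
proof -
  show "smooth_start neg_ray base_0inf delta_0inf (-1)"
    unfolding delta_0inf_def
  proof (rule smooth_start_upper[OF refl delta_0inf_base_path _ _ ray_to_0(2) convex_base_filters(3)])
    show "t * (1 - t) < 1" if "0 < t" "t \<le> 1/3" for t :: real
      using that mult_strict_mono[of t 1 "1 - t" 1] by auto
  qed auto
  show "smooth_start neg_ray base_inf0 delta_inf0 (-1)"
    unfolding delta_inf0_def
    by (rule smooth_start_upper[OF refl delta_inf0_base_path _ _ ray_to_inf convex_base_filters(4)])
      (auto simp: divide_less_eq)
qed

section \<open>Piecewise smooth elements of products of classes\<close>

lemma base_paths_reversepath: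
  fixes p :: "real \<Rightarrow> 'a::topological_space"
  assumes "p \<in> base_paths W S T"
  shows "reversepath p \<in> base_paths W T S"
proof -
  have "continuous_on {0<..<1} (\<lambda>t. p (1 - t))"
    by (rule continuous_on_compose2[OF base_pathsD(1)[OF assms]]) (auto intro!: continuous_intros)
  moreover have "p (1 - t) \<in> W" if "t \<in> {0<..<1}" for t
    using base_pathsD(2)[OF assms, of "1 - t"] that by simp
  moreover have "filterlim (\<lambda>t::real. 1 - t) (at_left 1) (at_right 0)" by real_asymp
  then have "filterlim (\<lambda>t. p (1 - t)) T (at_right 0)"
    by (rule filterlim_compose[OF base_pathsD(4)[OF assms]])
  moreover have "filterlim (\<lambda>t::real. 1 - t) (at_right 0) (at_left 1)" by real_asymp
  then have "filterlim (\<lambda>t. p (1 - t)) S (at_left 1)"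
    by (rule filterlim_compose[OF base_pathsD(3)[OF assms]])
  ultimately show ?thesis by (auto simp: base_paths_def reversepath_def)
qed

lemma transports_base_path_inv:
  assumes "transports_base S T A"
  shows "transports_base T S (path_inv A)"
  using assms base_paths_reversepath transports_reversepath
  unfolding transports_base_def path_inv_def by blast

text \<open>
  The path \<open>e\<close> runs to the point \<open>c\<close> on the ray and the smooth tail starts from there; the ray from \<open>c\<close>
  to the base point is the detour that exhibits their join as an element of the product. The smooth
  tail is homotopic to a slowed down path \<open>\<beta> (t ^ n)\<close>, whence the form of the hypothesis on \<open>B\<close>.
\<close>

lemma smooth_element_exists:
  assumes K: "convex K" "K \<subseteq> P1_minus" "\<forall>\<^sub>F w in T. w \<in> K" "convex_filter T"
    and D: "smooth_start K T D c"
    and \<beta>: "\<beta> \<in> base_paths P1_minus T (nhds z)" and z: "z \<in> P1_minus"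
    and B: "\<And>n q. n \<ge> 1 \<Longrightarrow> path_homotopic P1_minus T (nhds z) (\<lambda>t. \<beta> (t ^ n)) q \<Longrightarrow> q \<in> B"
  shows "\<exists>p. p \<in> D \<odot> B \<and> valid_path p \<and> pathfinish p = z"
proof -
  obtain e r where e: "c \<in> K" "valid_path e" "e 1 = c" "ray_path K T c r" "e +++ r \<in> D"
    using D unfolding smooth_start_def by blast
  obtain n b where b: "n \<ge> 1" "valid_path b" "b 0 = c" "b 1 = z"
    "\<And>r. ray_path K T c r \<Longrightarrow> path_homotopic P1_minus T (nhds z) (\<lambda>t. \<beta> (t ^ n)) (reversepath r +++ b)"
    using smooth_tail_exists[OF \<beta> open_P1_minus z K(1-3) K(4) e(1)] by metis
  have "r 0 = c" using e(4) by (simp add: ray_path_def)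
  then have "e +++ b \<in> D \<odot> B"
    using e by (intro path_mult_joinI[where r = r] B[OF b(1) b(5)]) auto
  moreover have "valid_path (e +++ b)"
    using e(2,3) b(2,3) by (intro valid_path_join) (auto simp: pathstart_def pathfinish_def)
  moreover have "pathfinish (e +++ b) = z" using b(4) by (simp add: pathfinish_def joinpaths_def)
  ultimately show ?thesis by blast
qed

text \<open>
  Two nested products, for a base point on \<open>(0,1)\<close>: the path runs from 1 to 1/2 and continues with the
  smooth tail. The detours are the rays from 1/2 to 0 and to the second base point; all homotopies
  between the explicit pieces take place in the interval \<open>(0,1)\<close>.
\<close>

lemma smooth_log_element_exists:
  assumes T: "convex_filter T" "\<forall>\<^sub>F w in T. w \<in> pos_ray" and r2: "ray_path pos_ray T (1/2) r2"
    and d: "d \<in> base_paths P1_minus base_01 T" "\<And>t. t \<in> {0<..<1} \<Longrightarrow> d t \<in> pos_ray"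
    and \<beta>: "\<beta> \<in> base_paths P1_minus T (nhds z)" and z: "z \<in> P1_minus"
    and B: "\<And>n q. n \<ge> 1 \<Longrightarrow> path_homotopic P1_minus T (nhds z) (\<lambda>t. \<beta> (t ^ n)) q \<Longrightarrow> q \<in> B"
  shows "\<exists>p. p \<in> path_inv delta_10 \<odot> (path_class P1_minus base_01 T d \<odot> B) \<and> valid_path p \<and> pathfinish p = z"
proof -
  define r1 where "r1 = ray_to_0 (1/2)"
  have r1: "ray_path pos_ray base_01 (1/2) r1" unfolding r1_def by (rule ray_to_0)
  have half: "1/2 \<in> pos_ray" using pos_ray(3)[of "1/2"] by simp
  obtain n b where b: "n \<ge> 1" "valid_path b" "b 0 = 1/2" "b 1 = z"
    "\<And>r. ray_path pos_ray T (1/2) r \<Longrightarrow> path_homotopic P1_minus T (nhds z) (\<lambda>t. \<beta> (t ^ n)) (reversepath r +++ b)"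
    using smooth_tail_exists[OF \<beta> open_P1_minus z pos_ray(1,2) T(2,1) half] by metis
  define e where "e = linepath 1 (1/2::complex)"
  have e_eq: "e u = of_real (1 - u / 2)" for u
    by (simp add: e_def linepath_def scaleR_conv_of_real algebra_simps)
  have e_ray: "e u \<in> pos_ray" if "u \<in> {0<..1}" for u unfolding e_eq pos_ray(3) using that by auto
  have "filterlim (\<lambda>u::real. 1 - u / 2) (at_left 1) (at_right 0)" by real_asymp
  then have e_lim: "filterlim e base_10 (at_right 0)"
    unfolding base_10_def by (intro filterlim_of_real[OF always_eventually]) (auto simp: e_eq)
  have e_cont: "continuous_on A e" for A unfolding e_def by (intro continuous_intros)
  have e1: "e 1 = 1/2" by (simp add: e_def linepath_def)
  have "e +++ r1 \<in> base_paths P1_minus base_10 base_01"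
    using e_ray pos_ray(2) by (intro ray_path_base_path[OF r1 pos_ray(2) e_cont _ e_lim e1]) auto
  then have rev: "reversepath (e +++ r1) \<in> base_paths P1_minus base_01 base_10"
    by (rule base_paths_reversepath)
  have rev_ray: "reversepath (e +++ r1) t \<in> pos_ray" if "t \<in> {0<..<1}" for t
    using join_in_pos_ray[where t = "1 - t", OF r1 e_ray] that by (simp add: reversepath_def)
  have id: "of_real t \<in> pos_ray" if "t \<in> {0<..<1}" for t using pos_ray(3) that by auto
  have "path_homotopic P1_minus base_01 base_10 (\<lambda>t. of_real t) (reversepath (e +++ r1))"
    by (rule path_homotopic_within_pos_ray[OF delta_10_base_path rev convex_base_filters(1,2) conjI[OF id rev_ray]])
  then have "reversepath (e +++ r1) \<in> delta_10" unfolding delta_10_def path_class_def by blast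
  then have 1: "e +++ r1 \<in> path_inv delta_10"
    unfolding path_inv_def by (metis image_eqI reversepath_reversepath)
  have rev1: "reversepath r1 u \<in> pos_ray" if "u \<in> {0<..1}" for u
    using ray_path_reverse(2)[OF r1 that] .
  have "reversepath r1 +++ r2 \<in> base_paths P1_minus base_01 T"
    using rev1 pos_ray(2)
    by (intro ray_path_base_path[OF r2 pos_ray(2) ray_path_reverse(1)[OF r1] _ ray_path_reverse(3,4)[OF r1]]) auto
  from path_homotopic_within_pos_ray[OF d(1) this convex_base_filters(1) T(1) conjI[OF d(2) join_in_pos_ray[OF r2 rev1]]]
  have 2: "reversepath r1 +++ r2 \<in> path_class P1_minus base_01 T d"
    by (simp add: path_class_def)
  have r10: "r1 0 = 1/2" "r2 0 = 1/2" using r1 r2 by (simp_all add: ray_path_def)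
  have meet: "r2 0 = r1 0" "r1 0 = e 1" by (simp_all only: r10 e1)
  have "reversepath r1 +++ b \<in> path_class P1_minus base_01 T d \<odot> B"
    using meet(1) by (intro path_mult_joinI[where r = r2] 2 B[OF b(1) b(5)[OF r2]]) (auto simp: reversepath_def)
  then have "e +++ b \<in> path_inv delta_10 \<odot> (path_class P1_minus base_01 T d \<odot> B)"
    by (rule path_mult_joinI[where r = r1, OF meet(2) 1])
  moreover have "valid_path (e +++ b)"
    using b(2,3) by (intro valid_path_join) (auto simp: pathstart_def e_def)
  moreover have "pathfinish (e +++ b) = z" using b(4) by (simp add: pathfinish_def joinpaths_def)
  ultimately show ?thesis by blast
qed

lemma smooth_rep_properties:
  assumes "\<exists>p. p \<in> A \<and> valid_path p \<and> pathfinish p = z"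
  shows "smooth_rep A z \<in> A" "valid_path (smooth_rep A z)" "pathfinish (smooth_rep A z) = z"
  using someI_ex[OF assms] unfolding smooth_rep_def by blast+

lemma path_homotopic_base_paths:
  assumes "path_homotopic W S T p q"
  shows "p \<in> base_paths W S T" "q \<in> base_paths W S T"
  using assms by (auto simp: path_homotopic_def)

lemma path_homotopic_push:
  fixes f :: "'a::topological_space \<Rightarrow> 'b::topological_space"
  assumes H: "path_homotopic V S T p q" and f: "continuous_on V f" "f ` V \<subseteq> W"
    and S: "filterlim f S' S" and T: "filterlim f T' T"
  shows "path_homotopic W S' T' (f \<circ> p) (f \<circ> q)"
proof -
  have push: "f \<circ> p \<in> base_paths W S' T'" if "p \<in> base_paths V S T" for p
  proof -
    have "continuous_on {0<..<1} (\<lambda>t. f (p t))"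
      using base_pathsD(2)[OF that] by (intro continuous_on_compose2[OF f(1) base_pathsD(1)[OF that]]) auto
    then show ?thesis
      using base_pathsD(2)[OF that] f(2) filterlim_compose[OF S base_pathsD(3)[OF that]]
        filterlim_compose[OF T base_pathsD(4)[OF that]]
      by (auto simp: base_paths_def o_def)
  qed
  obtain H :: "real \<times> real \<Rightarrow> 'a" where H': "continuous_on ({0..1} \<times> {0<..<1}) H" "H ` ({0..1} \<times> {0<..<1}) \<subseteq> V"
      "\<forall>t\<in>{0<..<1}. H (0, t) = p t \<and> H (1, t) = q t"
      "filterlim H S (principal {0..1} \<times>\<^sub>F at_right 0)" "filterlim H T (principal {0..1} \<times>\<^sub>F at_left 1)"
    using H unfolding path_homotopic_def by blast
  show ?thesis
    unfolding path_homotopic_def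
  proof (intro conjI exI[of _ "\<lambda>x. f (H x)"])
    show "f \<circ> p \<in> base_paths W S' T'" "f \<circ> q \<in> base_paths W S' T'"
      using push path_homotopic_base_paths[OF H] by blast+
    show "continuous_on ({0..1} \<times> {0<..<1}) (\<lambda>x. f (H x))"
      by (rule continuous_on_compose2[OF f(1) H'(1,2)])
    show "(\<lambda>x. f (H x)) ` ({0..1} \<times> {0<..<1}) \<subseteq> W" using H'(2) f(2) by blast
    show "filterlim (\<lambda>x. f (H x)) S' (principal {0..1} \<times>\<^sub>F at_right 0)"
      by (rule filterlim_compose[OF S H'(4)])
    show "filterlim (\<lambda>x. f (H x)) T' (principal {0..1} \<times>\<^sub>F at_left 1)"
      by (rule filterlim_compose[OF T H'(5)])
  qed (use H'(3) in auto)
qed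

section \<open>The nine maps and their paths\<close>

lemma SK_index_cases:
  assumes "i \<in> {1..9::nat}"
  obtains "i = 1" | "i = 2" | "i = 3" | "i = 4" | "i = 5" | "i = 6" | "i = 7" | "i = 8" | "i = 9"
  using assms by fastforce

lemma SK_map_simps:
  "SK_map 1 (x, y) = x * (1 - y)^2 / (y * (1 - x)^2)" "SK_map 2 (x, y) = x * y" "SK_map 3 (x, y) = x / y"
  "SK_map 4 (x, y) = x * (1 - y) / (y * (1 - x))" "SK_map 5 (x, y) = x * (1 - y) / (x - 1)"
  "SK_map 6 (x, y) = (1 - y) / (1 - x)" "SK_map 7 (x, y) = (1 - y) / (y * (x - 1))"
  "SK_map 8 (x, y) = x" "SK_map 9 (x, y) = y" "SK_map (Suc 0) (x, y) = x * (1 - y)^2 / (y * (1 - x)^2)"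
  by (simp_all add: SK_map_def)

lemma V_anD:
  assumes "(x, y) \<in> V_an"
  shows "x \<noteq> 0" "y \<noteq> 0" "x \<noteq> 1" "y \<noteq> 1" "x \<noteq> y" "x * y \<noteq> 1"
  using assms by (auto simp: V_an_def)

lemma open_V_an: "open V_an"
proof -
  have eq: "V_an = {v. fst v * snd v * (1 - fst v) * (1 - snd v) * (fst v - snd v) * (1 - fst v * snd v) \<noteq> 0}"
    by (auto simp: V_an_def)
  show ?thesis unfolding eq by (intro open_Collect_neq continuous_intros)
qed

lemma continuous_on_SK_map:
  assumes "i \<in> {1..9}"
  shows "continuous_on V_an (SK_map i)"
proof -
  have eq: "SK_map i = (\<lambda>v. SK_map i (fst v, snd v))" by simp
  have nz: "fst v \<noteq> 0" "snd v \<noteq> 0" "fst v - 1 \<noteq> 0" "1 - fst v \<noteq> 0" if "v \<in> V_an" for v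
    using V_anD[of "fst v" "snd v"] that by auto
  show ?thesis
    using assms by (subst eq, cases rule: SK_index_cases)
      (auto simp only: SK_map_simps intro!: continuous_intros nz mult_eq_0_iff power_eq_0_iff, auto dest: nz)
qed

lemma SK_map_in_P1_minus:
  assumes "i \<in> {1..9}" "v \<in> V_an"
  shows "SK_map i v \<in> P1_minus"
proof -
  obtain x y where v: "v = (x, y)" by fastforce
  note nz = V_anD[OF assms(2)[unfolded v]]
  have eq1: "x * (1 - y)^2 \<noteq> y * (1 - x)^2"
  proof
    assume "x * (1 - y)^2 = y * (1 - x)^2"
    then have "(x - y) * (1 - x * y) = 0" by algebra
    then show False using nz by auto
  qed
  have eq4: "x * (1 - y) \<noteq> y * (1 - x)" using nz by (auto simp: algebra_simps)
  have eq5: "x * (1 - y) \<noteq> x - 1" "1 - y \<noteq> y * (x - 1)" using nz by (auto simp: algebra_simps)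
  show ?thesis
    using assms(1) unfolding v P1_minus_def
    by (cases rule: SK_index_cases) (use nz eq1 eq4 eq5 in \<open>auto simp: SK_map_simps divide_eq_1_iff\<close>)
qed

text \<open>
  The values of the nine maps along the curve \<open>(t\<^sup>2, t)\<close>.
\<close>

definition SK_curve :: "nat \<Rightarrow> real \<Rightarrow> real"
  where "SK_curve i t = [t / (1 + t)^2, t^3, t, t / (1 + t), - (t^2) / (1 + t), 1 / (1 + t),
    - 1 / (t * (1 + t)), t^2, t] ! (i - 1)"

lemma SK_curve_simps:
  "SK_curve 1 t = t / (1 + t)^2" "SK_curve 2 t = t^3" "SK_curve 3 t = t" "SK_curve 4 t = t / (1 + t)"
  "SK_curve 5 t = - (t^2) / (1 + t)" "SK_curve 6 t = 1 / (1 + t)" "SK_curve 7 t = - 1 / (t * (1 + t))"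
  "SK_curve 8 t = t^2" "SK_curve 9 t = t" "SK_curve (Suc 0) t = t / (1 + t)^2"
  by (simp_all add: SK_curve_def)

lemma SK_map_curve:
  assumes "i \<in> {1..9}" "0 < t" "t < 1"
  shows "SK_map i (of_real t ^ 2, of_real t) = of_real (SK_curve i t)"
proof -
  have nz: "complex_of_real t \<noteq> 0" "1 - complex_of_real t \<noteq> 0" "1 + complex_of_real t \<noteq> 0"
    using assms(2,3) by (auto simp: complex_eq_iff)
  have nz': "complex_of_real t + of_real t * of_real t \<noteq> 0"
    using nz by (metis distrib_left mult_1_right mult_eq_0_iff)
  have sq: "1 - complex_of_real t ^ 2 = (1 - of_real t) * (1 + of_real t)"
    "complex_of_real t ^ 2 - 1 = - ((1 - of_real t) * (1 + of_real t))"
    by (simp_all add: algebra_simps power2_eq_square)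
  show ?thesis
    using assms(1)
  proof (cases rule: SK_index_cases)
    case 1
    then show ?thesis
      using nz by (simp add: SK_map_simps SK_curve_simps sq power_mult_distrib)
        (simp add: power2_eq_square)
  qed (use nz nz' in \<open>simp_all add: SK_map_simps SK_curve_simps sq power_mult_distrib,
        simp_all add: field_simps power2_eq_square power3_eq_cube\<close>)
qed

lemma filterlim_SK_map_base:
  assumes "i \<in> {1..9}"
  shows "filterlim (SK_map i) (SK_base i) base_v"
proof -
  have ev: "\<forall>\<^sub>F t in at_right 0. of_real (SK_curve i t) = SK_map i (of_real t ^ 2, of_real t)"
    by (rule eventually_at_rightI[of _ 1]) (use SK_map_curve[OF assms] in auto)
  obtain F where F: "SK_base i = filtermap complex_of_real F" "filterlim (SK_curve i) F (at_right 0)"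
  proof -
    have "filterlim (SK_curve i) (if i = 5 then at_left 0 else if i = 6 then at_left 1
              else if i = 7 then at_bot else at_right 0) (at_right 0)"
    proof -
      have "filterlim (\<lambda>t::real. t / (1 + t)^2) (at_right 0) (at_right 0)"
        "filterlim (\<lambda>t::real. t^3) (at_right 0) (at_right 0)" "filterlim (\<lambda>t::real. t) (at_right 0) (at_right 0)"
        "filterlim (\<lambda>t::real. t / (1 + t)) (at_right 0) (at_right 0)"
        "filterlim (\<lambda>t::real. - (t^2) / (1 + t)) (at_left 0) (at_right 0)"
        "filterlim (\<lambda>t::real. 1 / (1 + t)) (at_left 1) (at_right 0)"
        "filterlim (\<lambda>t::real. - 1 / (t * (1 + t))) at_bot (at_right 0)"
        "filterlim (\<lambda>t::real. t^2) (at_right 0) (at_right 0)"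
        by real_asymp+
      note lims = this
      show ?thesis
        using assms by (cases rule: SK_index_cases) (use lims in \<open>simp_all add: SK_curve_simps[abs_def]\<close>)
    qed
    then show ?thesis
      by (rule that[rotated]) (simp add: SK_base_def base_01_def base_10_def base_0inf_def base_inf0_def)
  qed
  show ?thesis
    unfolding base_v_def filterlim_filtermap F(1) by (rule filterlim_of_real[OF ev F(2)])
qed

lemma filterlim_SK_map_point:
  assumes "i \<in> {1..9}" "v \<in> V_an"
  shows "filterlim (SK_map i) (nhds (SK_map i v)) (nhds v)"
proof -
  have "isCont (SK_map i) v"
    using continuous_on_SK_map[OF assms(1)] open_V_an assms(2) by (simp add: continuous_on_eq_continuous_at)
  then show ?thesis using isCont_def tendsto_at_iff_tendsto_nhds by blast
qed


lemma SK_delta_transports: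
  assumes "i \<in> {1..9}"
  shows "transports_base base_01 (SK_base i) (SK_delta i)"
  using assms
  by (cases rule: SK_index_cases) (simp_all add: SK_base_def SK_delta_def transports_base_delta)

lemma SK_smooth_start:
  assumes "i \<in> {1..9}"
  obtains K c where "convex K" "K \<subseteq> P1_minus" "\<forall>\<^sub>F w in SK_base i. w \<in> K" "convex_filter (SK_base i)"
    "smooth_start K (SK_base i) (SK_delta i) c"
proof -
  consider "i = 5" | "i = 6" | "i = 7" | "i \<noteq> 5" "i \<noteq> 6" "i \<noteq> 7" by blast
  then show ?thesis
  proof cases
    case 1
    then show ?thesis
      using that[of neg_ray "-1"] neg_ray(1,2) eventually_base_in_ray convex_base_filters smooth_start_neg
      by (simp add: SK_base_def SK_delta_def)
  next
    case 2
    then show ?thesis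
      using that[of pos_ray "1/2"] pos_ray(1,2) eventually_base_in_ray convex_base_filters smooth_start_pos
      by (simp add: SK_base_def SK_delta_def)
  next
    case 3
    then show ?thesis
      using that[of neg_ray "-1"] neg_ray(1,2) eventually_base_in_ray convex_base_filters smooth_start_neg
      by (simp add: SK_base_def SK_delta_def)
  next
    case 4
    then show ?thesis
      using that[of pos_ray "1/2"] pos_ray(1,2) eventually_base_in_ray convex_base_filters smooth_start_pos
      by (simp add: SK_base_def SK_delta_def)
  qed
qed

lemma SK_base_in_domain: "i \<in> {1..9} \<Longrightarrow> \<forall>\<^sub>F w in SK_base i. w \<in> base_domain"
  by (simp add: SK_base_def eventually_base_in_domain)

text \<open>
  All elements of the class of \<open>f\<^sub>i(\<gamma>\<^sub>0)\<close>, and hence of \<open>\<gamma>\<^sub>i\<close>, transport the base solution to the same germ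
  \<open>h\<close>; the integrals along the smooth representative chosen in the definitions are its values.
\<close>

theorem SK_path_values:
  assumes v: "v \<in> V_an" and p0: "p0 \<in> base_paths V_an base_v (nhds v)" and i: "i \<in> {1..9}"
    and h: "polylog_system U h" "SK_map i v \<in> U" and tr: "transports (SK_map i \<circ> p0) base_polylog h"
  defines "\<gamma> \<equiv> SK_delta i \<odot> path_push (SK_map i) P1_minus (SK_base i) (nhds (SK_map i v))
    {q. path_homotopic V_an base_v (nhds v) p0 q}"
  shows "k \<ge> 1 \<Longrightarrow> Li k (SK_map i v) \<gamma> = h k (SK_map i v)"
    and "i = 6 \<or> i = 9 \<Longrightarrow> log_path (SK_map i v) \<gamma> = h 0 (SK_map i v)"
proof -
  define f where "f = SK_map i"
  define z where "z = f v"
  define T where "T = SK_base i"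
  define B where "B = path_push f P1_minus T (nhds z) {q. path_homotopic V_an base_v (nhds v) p0 q}"
  have z: "z \<in> P1_minus" using SK_map_in_P1_minus[OF i v] by (simp add: z_def f_def)
  have push: "path_homotopic P1_minus T (nhds z) (f \<circ> p) (f \<circ> q)"
    if "path_homotopic V_an base_v (nhds v) p q" for p q
    unfolding T_def z_def f_def
    by (rule path_homotopic_push[OF that continuous_on_SK_map[OF i] _ filterlim_SK_map_base[OF i]
          filterlim_SK_map_point[OF i v]]) (use SK_map_in_P1_minus[OF i] in blast)
  have T_dom: "\<forall>\<^sub>F w in T. w \<in> base_domain" unfolding T_def by (rule SK_base_in_domain[OF i])
  have z_dom: "\<forall>\<^sub>F w in nhds z. w \<in> U"
    using polylog_systemD(1)[OF h(1)] h(2) by (intro eventually_nhds_in_open) (auto simp: z_def f_def)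
  note transport_hom = transports_homotopic[OF _ polylog_system_base T_dom h(1) z_dom]
  have B: "q \<in> base_paths P1_minus T (nhds z) \<and> transports q base_polylog h" if "q \<in> B" for q
  proof -
    obtain p where p: "path_homotopic V_an base_v (nhds v) p0 p" "path_homotopic P1_minus T (nhds z) (f \<circ> p) q"
      using \<open>q \<in> B\<close> by (auto simp: B_def path_push_def path_class_def)
    have "transports (f \<circ> p) base_polylog h"
      using transport_hom[OF push[OF p(1)]] tr by (simp add: f_def)
    then show ?thesis
      using transport_hom[OF p(2)] path_homotopic_base_paths(2)[OF p(2)] by blast
  qed
  have B_closed: "q \<in> B" if "n \<ge> 1" "path_homotopic P1_minus T (nhds z) (\<lambda>t. (f \<circ> p0) (t ^ n)) q" for n q
  proof -
    have "path_homotopic V_an base_v (nhds v) p0 (\<lambda>t. p0 (t ^ n))"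
      by (rule path_homotopic_power[OF p0 that(1)])
    moreover have "f \<circ> (\<lambda>t. p0 (t ^ n)) = (\<lambda>t. (f \<circ> p0) (t ^ n))" by (simp add: fun_eq_iff)
    ultimately show ?thesis using that(2) unfolding B_def path_push_def path_class_def by force
  qed
  have "path_homotopic V_an base_v (nhds v) p0 (\<lambda>t. p0 (t ^ 1))"
    by (rule path_homotopic_power[OF p0 order_refl])
  from path_homotopic_base_paths(1)[OF push[OF this]]
  have fp0: "f \<circ> p0 \<in> base_paths P1_minus T (nhds z)" .
  have \<gamma>: "\<gamma> = SK_delta i \<odot> B" by (simp add: \<gamma>_def B_def f_def T_def z_def)
  have D: "SK_delta i \<subseteq> base_paths P1_minus base_01 T"
      "\<And>q. q \<in> SK_delta i \<Longrightarrow> transports q base_polylog base_polylog"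
    using SK_delta_transports[OF i] by (auto simp: transports_base_def T_def)
  have B': "B \<subseteq> base_paths P1_minus T (nhds z)" using B by blast
  have \<gamma>_base: "\<gamma> \<subseteq> base_paths P1_minus base_01 (nhds z)"
    using path_mult_base_paths[OF _ D(1) B'] unfolding \<gamma> by blast
  have \<gamma>_tr: "transports q base_polylog h" if "q \<in> \<gamma>" for q
    using transports_path_mult[OF that[unfolded \<gamma>] D(1) B' D(2)] B by blast
  show "Li k (SK_map i v) \<gamma> = h k (SK_map i v)" if "k \<ge> 1"
  proof -
    obtain K c where K: "convex K" "K \<subseteq> P1_minus" "\<forall>\<^sub>F w in T. w \<in> K" "convex_filter T"
        "smooth_start K T (SK_delta i) c"
      using SK_smooth_start[OF i] unfolding T_def by metis
    have "\<exists>p. p \<in> \<gamma> \<and> valid_path p \<and> pathfinish p = z"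
      unfolding \<gamma> by (rule smooth_element_exists[OF K fp0 z B_closed])
    note rep = smooth_rep_properties[OF this]
    have "Li_along k (smooth_rep \<gamma> z) 1 = h k z"
      using rep \<gamma>_base \<gamma>_tr[OF rep(1)] h that
      by (intro Li_along_eq_transport) (auto simp: z_def f_def)
    then show ?thesis by (simp add: Li_def z_def f_def)
  qed
  show "log_path (SK_map i v) \<gamma> = h 0 (SK_map i v)" if i69: "i = 6 \<or> i = 9"
  proof -
    define E where "E = path_inv delta_10 \<odot> \<gamma>"
    have inv: "path_inv delta_10 \<subseteq> base_paths P1_minus base_10 base_01"
        "\<And>q. q \<in> path_inv delta_10 \<Longrightarrow> transports q base_polylog base_polylog"
      using transports_base_path_inv[OF transports_base_delta(2)] by (auto simp: transports_base_def)
    have E_base: "E \<subseteq> base_paths P1_minus base_10 (nhds z)"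
      using path_mult_base_paths[OF _ inv(1) \<gamma>_base] unfolding E_def by blast
    have E_tr: "transports q base_polylog h" if "q \<in> E" for q
      using transports_path_mult[OF that[unfolded E_def] inv(1) \<gamma>_base inv(2) \<gamma>_tr] .
    have "\<exists>p. p \<in> E \<and> valid_path p \<and> pathfinish p = z"
      using i69
    proof
      assume "i = 6"
      then have eq: "T = base_10" "SK_delta i = delta_10" by (simp_all add: T_def SK_base_def SK_delta_def)
      have "of_real t \<in> pos_ray" if "t \<in> {0<..<1}" for t using pos_ray(3) that by auto
      note ray = this
      have "\<exists>p. p \<in> path_inv delta_10 \<odot> (SK_delta i \<odot> B) \<and> valid_path p \<and> pathfinish p = z"
        unfolding eq(2) by (subst (2) delta_10_def,
          rule smooth_log_element_exists[OF convex_base_filters(2) eventually_base_in_ray(2) ray_to_1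
            delta_10_base_path _ fp0[unfolded eq] z]) (use ray B_closed[unfolded eq] in auto)
      then show ?thesis unfolding E_def \<gamma> .
    next
      assume "i = 9"
      then have eq: "T = base_01" "SK_delta i = delta_01" by (simp_all add: T_def SK_base_def SK_delta_def)
      have "of_real (t * (1 - t)) \<in> pos_ray" if "t \<in> {0<..<1}" for t
        unfolding pos_ray(3) using that mult_strict_mono[of t 1 "1 - t" 1] by auto
      note ray = this
      have "\<exists>p. p \<in> path_inv delta_10 \<odot> (SK_delta i \<odot> B) \<and> valid_path p \<and> pathfinish p = z"
        unfolding eq(2) delta_01_def
        by (rule smooth_log_element_exists[OF convex_base_filters(1) eventually_base_in_ray(1) ray_to_0(1)
            delta_01_base_path _ fp0[unfolded eq] z]) (use ray B_closed[unfolded eq] in \<open>simp_all del: of_real_mult\<close>)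
      then show ?thesis unfolding E_def \<gamma> .
    qed
    note rep = smooth_rep_properties[OF this]
    have "contour_integral (smooth_rep E z) (\<lambda>t. 1 / t) = h 0 z"
      using rep E_base E_tr[OF rep(1)] h
      by (intro contour_integral_eq_transport) (auto simp: z_def f_def)
    then show ?thesis by (simp add: log_path_def E_def z_def f_def)
  qed
qed

section \<open>Logarithmic derivatives of the nine maps\<close>

text \<open>
  Stated with \<open>f' = f * a\<close> instead of a quotient, so that the product rule holds wherever
  the factors vanish, too.
\<close>

definition has_log_derivative :: "(real \<Rightarrow> complex) \<Rightarrow> complex \<Rightarrow> real \<Rightarrow> real set \<Rightarrow> bool"
  where "has_log_derivative f a s I \<longleftrightarrow> (f has_vector_derivative f s * a) (at s within I)"

lemma has_log_derivative_mult:
  assumes "has_log_derivative f a s I" "has_log_derivative g b s I"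
  shows "has_log_derivative (\<lambda>s. f s * g s) (a + b) s I"
  using has_vector_derivative_mult[OF assms[unfolded has_log_derivative_def]]
  unfolding has_log_derivative_def by (simp add: algebra_simps)

lemma has_log_derivative_divide:
  assumes "has_log_derivative f a s I" "has_log_derivative g b s I" "g s \<noteq> 0"
  shows "has_log_derivative (\<lambda>s. f s / g s) (a - b) s I"
proof -
  have "(inverse has_field_derivative - (inverse (g s) * inverse (g s))) (at (g s) within g ` I)"
    using DERIV_inverse'[OF DERIV_ident, of "g s"] assms(3) by simp
  from field_vector_diff_chain_within[OF assms(2)[unfolded has_log_derivative_def] this]
  have "has_log_derivative (\<lambda>s. inverse (g s)) (- b) s I"
    using assms(3) by (simp add: has_log_derivative_def o_def field_simps)
  from has_log_derivative_mult[OF assms(1) this] show ?thesis by (simp add: field_simps)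
qed

lemma has_log_derivative_power2:
  "has_log_derivative f a s I \<Longrightarrow> has_log_derivative (\<lambda>s. f s ^ 2) (2 * a) s I"
  unfolding power2_eq_square mult_2 by (rule has_log_derivative_mult)

text \<open>
  The exponents of the factors \<open>x, y, 1-x, 1-y\<close> of \<open>f\<^sub>i\<close>, as a linear form: applied to logarithms of the
  factors it gives the logarithm of \<open>f\<^sub>i\<close>, applied to their logarithmic derivatives that of \<open>f\<^sub>i\<close>.
\<close>

definition SK_dlog :: "nat \<Rightarrow> complex \<Rightarrow> complex \<Rightarrow> complex \<Rightarrow> complex \<Rightarrow> complex"
  where "SK_dlog i a b c d = [a - b + 2 * d - 2 * c, a + b, a - b, a - b + d - c, a + d - c, d - c,
    d - b - c, a, b] ! (i - 1)"

text \<open>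
  The same for \<open>1 - f\<^sub>i\<close> and the factors \<open>y, 1-x, 1-y, y-x, 1-xy\<close>.
\<close>

definition SK_dlog1m :: "nat \<Rightarrow> complex \<Rightarrow> complex \<Rightarrow> complex \<Rightarrow> complex \<Rightarrow> complex \<Rightarrow> complex"
  where "SK_dlog1m i b c d e f = [e + f - b - 2 * c, f, e - b, e - b - c, f - c, e - c, f - b - c, c, d] ! (i - 1)"

lemma SK_dlog_simps:
  "SK_dlog 1 a b c d = a - b + 2 * d - 2 * c" "SK_dlog 2 a b c d = a + b" "SK_dlog 3 a b c d = a - b"
  "SK_dlog 4 a b c d = a - b + d - c" "SK_dlog 5 a b c d = a + d - c" "SK_dlog 6 a b c d = d - c"
  "SK_dlog 7 a b c d = d - b - c" "SK_dlog 8 a b c d = a" "SK_dlog 9 a b c d = b"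
  "SK_dlog (Suc 0) a b c d = a - b + 2 * d - 2 * c"
  by (simp_all add: SK_dlog_def)

lemma SK_dlog1m_simps:
  "SK_dlog1m 1 b c d e f = e + f - b - 2 * c" "SK_dlog1m 2 b c d e f = f" "SK_dlog1m 3 b c d e f = e - b"
  "SK_dlog1m 4 b c d e f = e - b - c" "SK_dlog1m 5 b c d e f = f - c" "SK_dlog1m 6 b c d e f = e - c"
  "SK_dlog1m 7 b c d e f = f - b - c" "SK_dlog1m 8 b c d e f = c" "SK_dlog1m 9 b c d e f = d"
  "SK_dlog1m (Suc 0) b c d e f = e + f - b - 2 * c"
  by (simp_all add: SK_dlog1m_def)

text \<open>
  The factorizations on which the equation rests: no factors occur besides the six that define the
  surface.
\<close>

lemma SK_map_complement:
  assumes "(x, y) \<in> V_an"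
  shows "1 - SK_map 1 (x, y) = (y - x) * (1 - x * y) / (y * (1 - x)^2)"
    "1 - SK_map 2 (x, y) = 1 - x * y" "1 - SK_map 3 (x, y) = (y - x) / y"
    "1 - SK_map 4 (x, y) = (y - x) / (y * (1 - x))" "1 - SK_map 5 (x, y) = (1 - x * y) / (1 - x)"
    "1 - SK_map 6 (x, y) = (y - x) / (1 - x)" "1 - SK_map 7 (x, y) = (1 - x * y) / (y * (1 - x))"
    "1 - SK_map 8 (x, y) = 1 - x" "1 - SK_map 9 (x, y) = 1 - y"
proof -
  note nz = V_anD[OF assms]
  have nz': "x - 1 \<noteq> 0" "1 - x \<noteq> 0" using nz by auto
  have "1 - SK_map 1 (x, y) = (y * (1 - x)^2 - x * (1 - y)^2) / (y * (1 - x)^2)"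
    using nz nz' by (simp add: SK_map_simps diff_divide_distrib)
  also have "y * (1 - x)^2 - x * (1 - y)^2 = (y - x) * (1 - x * y)" by algebra
  finally show "1 - SK_map 1 (x, y) = (y - x) * (1 - x * y) / (y * (1 - x)^2)" .
  have "x * (1 - y) / (x - 1) = - (x * (1 - y) / (1 - x))" by (metis minus_diff_eq minus_divide_right)
  then show "1 - SK_map 5 (x, y) = (1 - x * y) / (1 - x)"
    using nz' by (simp add: SK_map_simps field_simps)
  have "(1 - y) / (y * (x - 1)) = - ((1 - y) / (y * (1 - x)))"
    by (metis minus_diff_eq minus_divide_right mult_minus_right)
  then show "1 - SK_map 7 (x, y) = (1 - x * y) / (y * (1 - x))"
    using nz nz' by (simp add: SK_map_simps) (simp add: field_simps)
qed (use V_anD[OF assms] in \<open>simp_all add: SK_map_simps, simp_all add: field_simps\<close>)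

lemma SK_map_log_derivative:
  assumes i: "i \<in> {1..9}" and s: "s \<in> I" and V: "\<And>s. s \<in> I \<Longrightarrow> (x s, y s) \<in> V_an"
    and x: "(x has_vector_derivative x') (at s within I)" and y: "(y has_vector_derivative y') (at s within I)"
  defines "a \<equiv> x' / x s" and "b \<equiv> y' / y s" and "c \<equiv> x' / (x s - 1)" and "d \<equiv> y' / (y s - 1)"
    and "e \<equiv> (y' - x') / (y s - x s)" and "f \<equiv> - (x' * y s + x s * y') / (1 - x s * y s)"
  shows "has_log_derivative (\<lambda>s. SK_map i (x s, y s)) (SK_dlog i a b c d) s I"
    and "has_log_derivative (\<lambda>s. 1 - SK_map i (x s, y s)) (SK_dlog1m i b c d e f) s I"
proof -
  note nz = V_anD[OF V[OF s]]
  have nz': "x s - 1 \<noteq> 0" "1 - x s \<noteq> 0" "1 - y s \<noteq> 0" "y s - x s \<noteq> 0" "1 - x s * y s \<noteq> 0"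
    using nz by auto
  have X: "has_log_derivative x a s I" and Y: "has_log_derivative y b s I"
    using x y nz by (simp_all add: has_log_derivative_def a_def b_def)
  have X1: "has_log_derivative (\<lambda>s. x s - 1) c s I"
    unfolding has_log_derivative_def c_def using x nz' by (auto intro!: derivative_eq_intros)
  have c': "c = - x' / (1 - x s)" unfolding c_def by (metis minus_diff_eq minus_divide_divide minus_minus)
  have d': "d = - y' / (1 - y s)" unfolding d_def by (metis minus_diff_eq minus_divide_divide minus_minus)
  have A: "has_log_derivative (\<lambda>s. 1 - x s) c s I" and B: "has_log_derivative (\<lambda>s. 1 - y s) d s I"
    unfolding has_log_derivative_def c' d' using x y nz' by (auto intro!: derivative_eq_intros)
  have Z: "has_log_derivative (\<lambda>s. y s - x s) e s I"
    unfolding has_log_derivative_def e_def using x y nz' by (auto intro!: derivative_eq_intros)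
  have D: "has_log_derivative (\<lambda>s. 1 - x s * y s) f s I"
    unfolding has_log_derivative_def f_def using x y nz'
    by (auto intro!: derivative_eq_intros has_vector_derivative_mult)
  have nz'': "y s * (1 - x s)^2 \<noteq> 0" "y s * (1 - x s) \<noteq> 0" "y s * (x s - 1) \<noteq> 0" "y s \<noteq> 0"
    using nz nz' by auto
  have cong: "has_log_derivative g u s I"
    if "has_log_derivative h v s I" "\<And>s. s \<in> I \<Longrightarrow> g s = h s" "u = v" for g h u v
  proof -
    have "(g has_vector_derivative h s * v) (at s within I)"
      using that(1) unfolding has_log_derivative_def
      by (rule has_vector_derivative_transform[OF s, rotated]) (use that(2) in simp)
    then show ?thesis using that s by (simp add: has_log_derivative_def)
  qed
  show "has_log_derivative (\<lambda>s. SK_map i (x s, y s)) (SK_dlog i a b c d) s I"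
    using i
  proof (cases rule: SK_index_cases)
    case 1
    show ?thesis unfolding 1
      by (rule cong[OF has_log_derivative_divide[OF has_log_derivative_mult[OF X has_log_derivative_power2[OF B]]
              has_log_derivative_mult[OF Y has_log_derivative_power2[OF A]] nz''(1)]])
        (simp_all only: SK_map_simps SK_dlog_simps, simp)
  next
    case 2
    show ?thesis unfolding 2
      by (rule cong[OF has_log_derivative_mult[OF X Y]]) (simp_all only: SK_map_simps SK_dlog_simps)
  next
    case 3
    show ?thesis unfolding 3
      by (rule cong[OF has_log_derivative_divide[OF X Y nz''(4)]]) (simp_all only: SK_map_simps SK_dlog_simps)
  next
    case 4
    show ?thesis unfolding 4
      by (rule cong[OF has_log_derivative_divide[OF has_log_derivative_mult[OF X B] has_log_derivative_mult[OF Y A] nz''(2)]])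
        (simp_all only: SK_map_simps SK_dlog_simps, simp)
  next
    case 5
    show ?thesis unfolding 5
      by (rule cong[OF has_log_derivative_divide[OF has_log_derivative_mult[OF X B] X1 nz'(1)]])
        (simp_all only: SK_map_simps SK_dlog_simps)
  next
    case 6
    show ?thesis unfolding 6
      by (rule cong[OF has_log_derivative_divide[OF B A nz'(2)]]) (simp_all only: SK_map_simps SK_dlog_simps)
  next
    case 7
    show ?thesis unfolding 7
      by (rule cong[OF has_log_derivative_divide[OF B has_log_derivative_mult[OF Y X1] nz''(3)]])
        (simp_all only: SK_map_simps SK_dlog_simps, simp)
  next
    case 8
    show ?thesis unfolding 8 by (rule cong[OF X]) (simp_all only: SK_map_simps SK_dlog_simps)
  next
    case 9
    show ?thesis unfolding 9 by (rule cong[OF Y]) (simp_all only: SK_map_simps SK_dlog_simps)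
  qed
  note compl = SK_map_complement[OF V]
  show "has_log_derivative (\<lambda>s. 1 - SK_map i (x s, y s)) (SK_dlog1m i b c d e f) s I"
    using i
  proof (cases rule: SK_index_cases)
    case 1
    show ?thesis unfolding 1
      by (rule cong[OF has_log_derivative_divide[OF has_log_derivative_mult[OF Z D]
              has_log_derivative_mult[OF Y has_log_derivative_power2[OF A]] nz''(1)] compl(1)])
        (simp_all only: SK_dlog1m_simps, simp)
  next
    case 2
    show ?thesis unfolding 2 by (rule cong[OF D compl(2)]) (simp_all only: SK_dlog1m_simps)
  next
    case 3
    show ?thesis unfolding 3
      by (rule cong[OF has_log_derivative_divide[OF Z Y nz''(4)] compl(3)]) (simp_all only: SK_dlog1m_simps)
  next
    case 4
    show ?thesis unfolding 4
      by (rule cong[OF has_log_derivative_divide[OF Z has_log_derivative_mult[OF Y A] nz''(2)] compl(4)])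
        (simp_all only: SK_dlog1m_simps, simp)
  next
    case 5
    show ?thesis unfolding 5
      by (rule cong[OF has_log_derivative_divide[OF D A nz'(2)] compl(5)]) (simp_all only: SK_dlog1m_simps)
  next
    case 6
    show ?thesis unfolding 6
      by (rule cong[OF has_log_derivative_divide[OF Z A nz'(2)] compl(6)]) (simp_all only: SK_dlog1m_simps)
  next
    case 7
    show ?thesis unfolding 7
      by (rule cong[OF has_log_derivative_divide[OF D has_log_derivative_mult[OF Y A] nz''(2)] compl(7)])
        (simp_all only: SK_dlog1m_simps, simp)
  next
    case 8
    show ?thesis unfolding 8 by (rule cong[OF A compl(8)]) (simp_all only: SK_dlog1m_simps)
  next
    case 9
    show ?thesis unfolding 9 by (rule cong[OF B compl(9)]) (simp_all only: SK_dlog1m_simps)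
  qed
qed

text \<open>
  The derivative of \<open>F\<close> is both \<open>F l\<close> and \<open>-(1 - F) m\<close>; choosing the first for \<open>dF/F\<close> and the second for
  \<open>dF/(1 - F)\<close> makes the denominators cancel.
\<close>

lemma polylog_system_compose_derivative:
  assumes g: "polylog_system U g" "F s \<in> U"
    and F: "has_log_derivative F l s I" "has_log_derivative (\<lambda>s. 1 - F s) m s I"
  shows "((\<lambda>s. g 0 (F s)) has_vector_derivative l) (at s within I)"
    and "((\<lambda>s. g 1 (F s)) has_vector_derivative - m) (at s within I)"
    and "((\<lambda>s. g (Suc (Suc k)) (F s)) has_vector_derivative g (Suc k) (F s) * l) (at s within I)"
proof -
  have nz: "F s \<noteq> 0" "1 - F s \<noteq> 0" using polylog_systemD(2)[OF g(1)] g(2) by (auto simp: P1_minus_def)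
  have chain: "((\<lambda>s. g k (F s)) has_vector_derivative D * polylog_form g k (F s)) (at s within I)"
    if "(F has_vector_derivative D) (at s within I)" for D k
    using field_vector_diff_chain_within[OF that has_field_derivative_at_within[OF polylog_systemD(3)[OF g]]]
    by (simp add: o_def)
  have F1: "(F has_vector_derivative F s * l) (at s within I)" using F(1) by (simp add: has_log_derivative_def)
  have "((\<lambda>s. 1 - (1 - F s)) has_vector_derivative 0 - (1 - F s) * m) (at s within I)"
    using F(2) unfolding has_log_derivative_def by (intro has_vector_derivative_diff) auto
  then have F2: "(F has_vector_derivative - ((1 - F s) * m)) (at s within I)" by simp
  show "((\<lambda>s. g 0 (F s)) has_vector_derivative l) (at s within I)"
    using chain[OF F1, of 0] nz by simp
  show "((\<lambda>s. g 1 (F s)) has_vector_derivative - m) (at s within I)"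
    using chain[OF F2, of 1] nz by simp
  show "((\<lambda>s. g (Suc (Suc k)) (F s)) has_vector_derivative g (Suc k) (F s) * l) (at s within I)"
    using chain[OF F1, of "Suc (Suc k)"] nz by (simp add: mult.commute)
qed

section \<open>The Spence-Kummer relations in weights one, two and three\<close>

text \<open>
  A state \<open>v\<close> holds in \<open>v i k\<close> the component of index \<open>k\<close> over \<open>f\<^sub>i\<close>. The six logarithms are recovered
  from it: \<open>f\<^sub>8 = x\<close> and \<open>f\<^sub>9 = y\<close> give those of \<open>x, y, 1-x, 1-y\<close>, while \<open>1 - f\<^sub>2 = 1 - xy\<close> and
  \<open>1 - f\<^sub>3 = (y-x)/y\<close> give the other two. The terms \<open>i pi\<close> come from the half-turns for \<open>f\<^sub>5\<close> and \<open>f\<^sub>7\<close>.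
\<close>

definition SK_log_relations :: "(nat \<Rightarrow> nat \<Rightarrow> complex) \<Rightarrow> bool"
  where "SK_log_relations v \<longleftrightarrow> (\<forall>i\<in>{1..9}.
    v i 0 = SK_dlog i (v 8 0) (v 9 0) (- v 8 1) (- v 9 1) + (if i = 5 \<or> i = 7 then \<i> * of_real pi else 0) \<and>
    v i 1 = - SK_dlog1m i (v 9 0) (- v 8 1) (- v 9 1) (v 9 0 - v 3 1) (- v 2 1))"

text \<open>
  The coefficients of \<open>dlog x\<close> and \<open>dlog y\<close> and half of that of \<open>dlog (1-y)\<close>, which is minus that of
  \<open>dlog (1-x)\<close>, in the derivative of the trilogarithmic expression below.
\<close>

definition SK_dilog_defect :: "nat \<Rightarrow> (nat \<Rightarrow> nat \<Rightarrow> complex) \<Rightarrow> complex"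
  where "SK_dilog_defect j v = [
    v 1 2 + v 2 2 + v 3 2 - 2 * v 4 2 - 2 * v 5 2 - 2 * v 8 2,
    - v 1 2 + v 2 2 - v 3 2 + 2 * v 4 2 + 2 * v 7 2 - 2 * v 9 2
      - (2 * v 9 0 * v 6 0 - of_real pi ^ 2 / 3 - v 9 0 ^ 2),
    v 1 2 - v 4 2 - v 5 2 - v 6 2 - v 7 2 - v 9 0 ^ 2 / 2] ! j"

text \<open>
  The difference of the two sides of the equation; \<open>v 9 0\<close> and \<open>v 6 0\<close> are the two logarithms in it.
\<close>

definition SK_defect :: "(nat \<Rightarrow> nat \<Rightarrow> complex) \<Rightarrow> complex"
  where "SK_defect v = v 1 3 + v 2 3 + v 3 3 - 2 * v 4 3 - 2 * v 5 3 - 2 * v 6 3 - 2 * v 7 3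
    - 2 * v 8 3 - 2 * v 9 3 + 2 * zeta3
    - (v 9 0 ^ 2 * v 6 0 - of_real pi ^ 2 / 3 * v 9 0 - 1 / 3 * v 9 0 ^ 3)"

definition SK_relations :: "(nat \<Rightarrow> nat \<Rightarrow> complex) \<Rightarrow> bool"
  where "SK_relations v \<longleftrightarrow>
    SK_log_relations v \<and> (\<forall>j<3. SK_dilog_defect j v = 0) \<and> SK_defect v = 0"

text \<open>
  The differential equations satisfied by the state along a differentiable curve on the surface. The
  six numbers are the logarithmic derivatives of the six factors.
\<close>

definition SK_flow :: "real set \<Rightarrow> (real \<Rightarrow> nat \<Rightarrow> nat \<Rightarrow> complex) \<Rightarrow> bool"
  where "SK_flow I v \<longleftrightarrow> (\<forall>s\<in>I. \<exists>a b c d e f. \<forall>i\<in>{1..9}.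
    ((\<lambda>s. v s i 0) has_vector_derivative SK_dlog i a b c d) (at s within I) \<and>
    ((\<lambda>s. v s i 1) has_vector_derivative - SK_dlog1m i b c d e f) (at s within I) \<and>
    (\<forall>k. ((\<lambda>s. v s i (Suc (Suc k))) has_vector_derivative v s i (Suc k) * SK_dlog i a b c d) (at s within I)))"

lemma SK_flow_along_curve:
  assumes "\<And>s. s \<in> I \<Longrightarrow> (x s, y s) \<in> V_an"
    and "\<And>s. s \<in> I \<Longrightarrow> (x has_vector_derivative x' s) (at s within I)"
    and "\<And>s. s \<in> I \<Longrightarrow> (y has_vector_derivative y' s) (at s within I)"
    and "\<And>i. i \<in> {1..9} \<Longrightarrow> polylog_system (U i) (g i)"
    and "\<And>i s. i \<in> {1..9} \<Longrightarrow> s \<in> I \<Longrightarrow> SK_map i (x s, y s) \<in> U i"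
  shows "SK_flow I (\<lambda>s i k. g i k (SK_map i (x s, y s)))"
  unfolding SK_flow_def
proof
  fix s assume s: "s \<in> I"
  note deriv = polylog_system_compose_derivative[OF assms(4) assms(5)[OF _ s]
      SK_map_log_derivative(1)[OF _ s assms(1) assms(2)[OF s] assms(3)[OF s]]
      SK_map_log_derivative(2)[OF _ s assms(1) assms(2)[OF s] assms(3)[OF s]]]
  show "\<exists>a b c d e f. \<forall>i\<in>{1..9}.
    ((\<lambda>s. g i 0 (SK_map i (x s, y s))) has_vector_derivative SK_dlog i a b c d) (at s within I) \<and>
    ((\<lambda>s. g i 1 (SK_map i (x s, y s))) has_vector_derivative - SK_dlog1m i b c d e f) (at s within I) \<and>
    (\<forall>k. ((\<lambda>s. g i (Suc (Suc k)) (SK_map i (x s, y s))) has_vector_derivative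
      g i (Suc k) (SK_map i (x s, y s)) * SK_dlog i a b c d) (at s within I))"
    by (rule exI[of _ "x' s / x s"], rule exI[of _ "y' s / y s"], rule exI[of _ "x' s / (x s - 1)"],
        rule exI[of _ "y' s / (y s - 1)"], rule exI[of _ "(y' s - x' s) / (y s - x s)"],
        rule exI[of _ "- (x' s * y s + x s * y' s) / (1 - x s * y s)"])
      (intro ballI conjI allI deriv)
qed

lemma SK_dlog_has_vector_derivative:
  assumes "i \<in> {1..9}" "(A has_vector_derivative a) F" "(B has_vector_derivative b) F"
    "(C has_vector_derivative c) F" "(D has_vector_derivative d) F"
  shows "((\<lambda>s. SK_dlog i (A s) (B s) (C s) (D s)) has_vector_derivative SK_dlog i a b c d) F"
  using assms(1)
  by (cases rule: SK_index_cases; hypsubst; unfold SK_dlog_simps)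
    (intro assms(2-) has_vector_derivative_add has_vector_derivative_diff has_vector_derivative_mult_right)+

lemma SK_dlog1m_has_vector_derivative:
  assumes "i \<in> {1..9}" "(B has_vector_derivative b) G" "(C has_vector_derivative c) G"
    "(D has_vector_derivative d) G" "(E has_vector_derivative e) G" "(F has_vector_derivative f) G"
  shows "((\<lambda>s. SK_dlog1m i (B s) (C s) (D s) (E s) (F s)) has_vector_derivative SK_dlog1m i b c d e f) G"
  using assms(1)
  by (cases rule: SK_index_cases; hypsubst; unfold SK_dlog1m_simps)
    (intro assms(2-) has_vector_derivative_add has_vector_derivative_diff has_vector_derivative_mult_right)+

lemma SK_flowE:
  assumes "SK_flow I v" "s \<in> I"
  obtains a b c d e f where
    "\<And>i. i \<in> {1..9} \<Longrightarrow> ((\<lambda>s. v s i 0) has_vector_derivative SK_dlog i a b c d) (at s within I)"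
    "\<And>i. i \<in> {1..9} \<Longrightarrow> ((\<lambda>s. v s i 1) has_vector_derivative - SK_dlog1m i b c d e f) (at s within I)"
    "\<And>i. i \<in> {1..9} \<Longrightarrow> ((\<lambda>s. v s i 2) has_vector_derivative v s i 1 * SK_dlog i a b c d) (at s within I)"
    "\<And>i. i \<in> {1..9} \<Longrightarrow> ((\<lambda>s. v s i 3) has_vector_derivative v s i 2 * SK_dlog i a b c d) (at s within I)"
proof -
  obtain a b c d e f where D: "\<forall>i\<in>{1..9}.
    ((\<lambda>s. v s i 0) has_vector_derivative SK_dlog i a b c d) (at s within I) \<and>
    ((\<lambda>s. v s i 1) has_vector_derivative - SK_dlog1m i b c d e f) (at s within I) \<and>
    (\<forall>k. ((\<lambda>s. v s i (Suc (Suc k))) has_vector_derivative v s i (Suc k) * SK_dlog i a b c d) (at s within I))"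
    using bspec[OF assms(1)[unfolded SK_flow_def] assms(2)] by (elim exE) (rule that)
  have num: "(2::nat) = Suc (Suc 0)" "(3::nat) = Suc (Suc 1)" "(1::nat) = Suc 0" by simp_all
  show ?thesis
  proof (rule that)
    fix i :: nat assume i: "i \<in> {1..9}"
    note D' = bspec[OF D i]
    show "((\<lambda>s. v s i 0) has_vector_derivative SK_dlog i a b c d) (at s within I)" using D' by blast
    show "((\<lambda>s. v s i 1) has_vector_derivative - SK_dlog1m i b c d e f) (at s within I)" using D' by blast
    show "((\<lambda>s. v s i 2) has_vector_derivative v s i 1 * SK_dlog i a b c d) (at s within I)"
      using D'[THEN conjunct2, THEN conjunct2, THEN spec, of 0] by (simp only: num)
    show "((\<lambda>s. v s i 3) has_vector_derivative v s i 2 * SK_dlog i a b c d) (at s within I)"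
      using D'[THEN conjunct2, THEN conjunct2, THEN spec, of 1] by (simp only: num)
  qed
qed

lemma zero_vector_derivative_imp_eq:
  fixes f :: "real \<Rightarrow> complex"
  assumes "convex I" "\<And>s. s \<in> I \<Longrightarrow> (f has_vector_derivative 0) (at s within I)" "s \<in> I" "t \<in> I"
  shows "f t = f s"
proof -
  obtain c where "\<And>s. s \<in> I \<Longrightarrow> f s = c"
    using has_vector_derivative_zero_constant[OF assms(1,2)] by blast
  then show ?thesis using assms(3,4) by simp
qed

text \<open>
  Both sides of each relation are linear in the logarithms and have the same derivative.
\<close>

lemma SK_log_relations_constant:
  assumes I: "convex I" and v: "SK_flow I v" and st: "s \<in> I" "t \<in> I" and rel: "SK_log_relations (v s)"
  shows "SK_log_relations (v t)"
proof -
  define E where "E i s = v s i 0 - SK_dlog i (v s 8 0) (v s 9 0) (- v s 8 1) (- v s 9 1)" for s i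
  define E' where "E' i s = v s i 1 + SK_dlog1m i (v s 9 0) (- v s 8 1) (- v s 9 1) (v s 9 0 - v s 3 1) (- v s 2 1)" for s i
  have deriv: "(E i has_vector_derivative 0) (at s within I)" "(E' i has_vector_derivative 0) (at s within I)"
    if i: "i \<in> {1..9}" and s: "s \<in> I" for i s
  proof -
    obtain a b c d e f where
      D0: "\<And>i. i \<in> {1..9} \<Longrightarrow> ((\<lambda>s. v s i 0) has_vector_derivative SK_dlog i a b c d) (at s within I)" and
      D1: "\<And>i. i \<in> {1..9} \<Longrightarrow> ((\<lambda>s. v s i 1) has_vector_derivative - SK_dlog1m i b c d e f) (at s within I)"
      using SK_flowE[OF v s] by metis
    have X: "((\<lambda>s. v s 8 0) has_vector_derivative a) (at s within I)"
      and Y: "((\<lambda>s. v s 9 0) has_vector_derivative b) (at s within I)"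
      using D0[of 8] D0[of 9] by (simp_all add: SK_dlog_simps)
    have A: "((\<lambda>s. - v s 8 1) has_vector_derivative c) (at s within I)"
      and B: "((\<lambda>s. - v s 9 1) has_vector_derivative d) (at s within I)"
      and C: "((\<lambda>s. - v s 2 1) has_vector_derivative f) (at s within I)"
      and Z': "((\<lambda>s. - v s 3 1) has_vector_derivative e - b) (at s within I)"
      using has_vector_derivative_minus[OF D1[of 8]] has_vector_derivative_minus[OF D1[of 9]]
        has_vector_derivative_minus[OF D1[of 2]] has_vector_derivative_minus[OF D1[of 3]]
      by (simp_all add: SK_dlog1m_simps)
    have Z: "((\<lambda>s. v s 9 0 - v s 3 1) has_vector_derivative e) (at s within I)"
      using has_vector_derivative_add[OF Y Z'] by simp
    show "(E i has_vector_derivative 0) (at s within I)"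
      using has_vector_derivative_diff[OF D0[OF i] SK_dlog_has_vector_derivative[OF i X Y A B]]
      by (simp add: E_def[abs_def])
    show "(E' i has_vector_derivative 0) (at s within I)"
      using has_vector_derivative_add[OF D1[OF i] SK_dlog1m_has_vector_derivative[OF i Y A B Z C]]
      by (simp add: E'_def[abs_def])
  qed
  have "E i t = E i s" "E' i t = E' i s" if "i \<in> {1..9}" for i
    using zero_vector_derivative_imp_eq[OF I deriv(1)[OF that] st]
      zero_vector_derivative_imp_eq[OF I deriv(2)[OF that] st] by simp_all
  then show ?thesis
    using rel unfolding SK_log_relations_def E_def E'_def
    by (metis add.commute add_cancel_left_left diff_add_cancel eq_neg_iff_add_eq_0 add_diff_cancel_left')
qed

lemma SK_log_relationsD:
  assumes "SK_log_relations v"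
  shows "v 1 1 = - SK_dlog1m 1 (v 9 0) (- v 8 1) (- v 9 1) (v 9 0 - v 3 1) (- v 2 1)"
    "v 4 1 = - SK_dlog1m 4 (v 9 0) (- v 8 1) (- v 9 1) (v 9 0 - v 3 1) (- v 2 1)"
    "v 5 1 = - SK_dlog1m 5 (v 9 0) (- v 8 1) (- v 9 1) (v 9 0 - v 3 1) (- v 2 1)"
    "v 6 1 = - SK_dlog1m 6 (v 9 0) (- v 8 1) (- v 9 1) (v 9 0 - v 3 1) (- v 2 1)"
    "v 7 1 = - SK_dlog1m 7 (v 9 0) (- v 8 1) (- v 9 1) (v 9 0 - v 3 1) (- v 2 1)"
    "v 6 0 = - v 9 1 + v 8 1"
  using bspec[OF assms[unfolded SK_log_relations_def], of 1] bspec[OF assms[unfolded SK_log_relations_def], of 4]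
    bspec[OF assms[unfolded SK_log_relations_def], of 5] bspec[OF assms[unfolded SK_log_relations_def], of 6]
    bspec[OF assms[unfolded SK_log_relations_def], of 7]
  by (simp_all add: SK_dlog_simps)

text \<open>
  After insertion of the linear forms for \<open>q\<^sub>i\<close>, the derivative is a bilinear form in the logarithms and
  their derivatives, all of whose coefficients cancel.
\<close>

lemma SK_dilog_defect_constant:
  assumes I: "convex I" and v: "SK_flow I v" and st: "s \<in> I" "t \<in> I"
    and rel: "\<And>s. s \<in> I \<Longrightarrow> SK_log_relations (v s)" and j: "j < 3"
  shows "SK_dilog_defect j (v t) = SK_dilog_defect j (v s)"
proof (rule zero_vector_derivative_imp_eq[OF I _ st])
  fix s assume s: "s \<in> I"
  obtain a b c d e f where
    D0: "\<And>i. i \<in> {1..9} \<Longrightarrow> ((\<lambda>s. v s i 0) has_vector_derivative SK_dlog i a b c d) (at s within I)" and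
    D2: "\<And>i. i \<in> {1..9} \<Longrightarrow> ((\<lambda>s. v s i 2) has_vector_derivative v s i 1 * SK_dlog i a b c d) (at s within I)"
    using SK_flowE[OF v s] by metis
  have P: "((\<lambda>s. v s 1 2) has_vector_derivative v s 1 1 * (a - b + 2 * d - 2 * c)) (at s within I)"
    "((\<lambda>s. v s 2 2) has_vector_derivative v s 2 1 * (a + b)) (at s within I)"
    "((\<lambda>s. v s 3 2) has_vector_derivative v s 3 1 * (a - b)) (at s within I)"
    "((\<lambda>s. v s 4 2) has_vector_derivative v s 4 1 * (a - b + d - c)) (at s within I)"
    "((\<lambda>s. v s 5 2) has_vector_derivative v s 5 1 * (a + d - c)) (at s within I)"
    "((\<lambda>s. v s 6 2) has_vector_derivative v s 6 1 * (d - c)) (at s within I)"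
    "((\<lambda>s. v s 7 2) has_vector_derivative v s 7 1 * (d - b - c)) (at s within I)"
    "((\<lambda>s. v s 8 2) has_vector_derivative v s 8 1 * a) (at s within I)"
    "((\<lambda>s. v s 9 2) has_vector_derivative v s 9 1 * b) (at s within I)"
    using D2[of 1] D2[of 2] D2[of 3] D2[of 4] D2[of 5] D2[of 6] D2[of 7] D2[of 8] D2[of 9]
    by (simp_all add: SK_dlog_simps)
  have L: "((\<lambda>s. v s 9 0) has_vector_derivative b) (at s within I)"
    "((\<lambda>s. v s 6 0) has_vector_derivative d - c) (at s within I)"
    using D0[of 9] D0[of 6] by (simp_all add: SK_dlog_simps)
  have sq: "((\<lambda>s. v s 9 0 ^ 2) has_vector_derivative 2 * v s 9 0 * b) (at s within I)"
    using has_vector_derivative_mult[OF L(1) L(1)] by (simp add: power2_eq_square algebra_simps)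
  have prod: "((\<lambda>s. 2 * v s 9 0 * v s 6 0) has_vector_derivative 2 * (v s 9 0 * (d - c) + b * v s 6 0)) (at s within I)"
    using has_vector_derivative_mult_right[OF has_vector_derivative_mult[OF L], of 2]
    by (simp add: mult.assoc)
  note rel' = SK_log_relationsD[OF rel[OF s], unfolded SK_dlog1m_simps]
  consider "j = 0" | "j = 1" | "j = 2" using j by linarith
  then show "((\<lambda>s. SK_dilog_defect j (v s)) has_vector_derivative 0) (at s within I)"
  proof cases
    case 1
    have "((\<lambda>s. v s 1 2 + v s 2 2 + v s 3 2 - 2 * v s 4 2 - 2 * v s 5 2 - 2 * v s 8 2)
        has_vector_derivative 0) (at s within I)"
    proof (rule has_vector_derivative_eq_rhs)
      show "((\<lambda>s. v s 1 2 + v s 2 2 + v s 3 2 - 2 * v s 4 2 - 2 * v s 5 2 - 2 * v s 8 2)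
        has_vector_derivative v s 1 1 * (a - b + 2 * d - 2 * c) + v s 2 1 * (a + b) + v s 3 1 * (a - b)
          - 2 * (v s 4 1 * (a - b + d - c)) - 2 * (v s 5 1 * (a + d - c)) - 2 * (v s 8 1 * a)) (at s within I)"
        by (intro has_vector_derivative_add has_vector_derivative_diff
            has_vector_derivative_mult_right P)
      show "v s 1 1 * (a - b + 2 * d - 2 * c) + v s 2 1 * (a + b) + v s 3 1 * (a - b)
          - 2 * (v s 4 1 * (a - b + d - c)) - 2 * (v s 5 1 * (a + d - c)) - 2 * (v s 8 1 * a) = 0"
        unfolding rel'(1-3) by (simp add: algebra_simps)
    qed
    then show ?thesis by (simp add: 1 SK_dilog_defect_def)
  next
    case 2
    have "((\<lambda>s. - v s 1 2 + v s 2 2 - v s 3 2 + 2 * v s 4 2 + 2 * v s 7 2 - 2 * v s 9 2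
      - (2 * v s 9 0 * v s 6 0 - of_real pi ^ 2 / 3 - v s 9 0 ^ 2)) has_vector_derivative 0) (at s within I)"
    proof (rule has_vector_derivative_eq_rhs)
      let ?D = "- (v s 1 1 * (a - b + 2 * d - 2 * c)) + v s 2 1 * (a + b) - v s 3 1 * (a - b)
          + 2 * (v s 4 1 * (a - b + d - c)) + 2 * (v s 7 1 * (d - b - c)) - 2 * (v s 9 1 * b)
          - (2 * (v s 9 0 * (d - c) + b * v s 6 0) - 0 - 2 * v s 9 0 * b)"
      show "((\<lambda>s. - v s 1 2 + v s 2 2 - v s 3 2 + 2 * v s 4 2 + 2 * v s 7 2 - 2 * v s 9 2
        - (2 * v s 9 0 * v s 6 0 - of_real pi ^ 2 / 3 - v s 9 0 ^ 2)) has_vector_derivative ?D) (at s within I)"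
        by (intro has_vector_derivative_add has_vector_derivative_diff has_vector_derivative_minus
            has_vector_derivative_const prod sq has_vector_derivative_mult_right P)
      show "?D = 0" unfolding rel' by (simp add: algebra_simps)
    qed
    then show ?thesis by (simp add: 2 SK_dilog_defect_def)
  next
    case 3
    have "((\<lambda>s. v s 1 2 - v s 4 2 - v s 5 2 - v s 6 2 - v s 7 2 - v s 9 0 ^ 2 / 2) has_vector_derivative 0) (at s within I)"
    proof (rule has_vector_derivative_eq_rhs)
      let ?D = "v s 1 1 * (a - b + 2 * d - 2 * c) - v s 4 1 * (a - b + d - c) - v s 5 1 * (a + d - c)
          - v s 6 1 * (d - c) - v s 7 1 * (d - b - c) - 2 * v s 9 0 * b / 2"
      show "((\<lambda>s. v s 1 2 - v s 4 2 - v s 5 2 - v s 6 2 - v s 7 2 - v s 9 0 ^ 2 / 2)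
          has_vector_derivative ?D) (at s within I)"
        by (intro has_vector_derivative_diff has_vector_derivative_divide P sq)
      show "?D = 0" unfolding rel' by (simp add: algebra_simps)
    qed
    then show ?thesis by (simp add: 3 SK_dilog_defect_def)
  qed
qed

lemma SK_defect_constant:
  assumes I: "convex I" and v: "SK_flow I v" and st: "s \<in> I" "t \<in> I"
    and rel: "\<And>s. s \<in> I \<Longrightarrow> SK_log_relations (v s)" "\<And>s j. s \<in> I \<Longrightarrow> j < 3 \<Longrightarrow> SK_dilog_defect j (v s) = 0"
  shows "SK_defect (v t) = SK_defect (v s)"
proof (rule zero_vector_derivative_imp_eq[OF I _ st])
  fix s assume s: "s \<in> I"
  obtain a b c d e f where
    D0: "\<And>i. i \<in> {1..9} \<Longrightarrow> ((\<lambda>s. v s i 0) has_vector_derivative SK_dlog i a b c d) (at s within I)" and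
    D3: "\<And>i. i \<in> {1..9} \<Longrightarrow> ((\<lambda>s. v s i 3) has_vector_derivative v s i 2 * SK_dlog i a b c d) (at s within I)"
    using SK_flowE[OF v s] by metis
  have P: "((\<lambda>s. v s 1 3) has_vector_derivative v s 1 2 * (a - b + 2 * d - 2 * c)) (at s within I)"
    "((\<lambda>s. v s 2 3) has_vector_derivative v s 2 2 * (a + b)) (at s within I)"
    "((\<lambda>s. v s 3 3) has_vector_derivative v s 3 2 * (a - b)) (at s within I)"
    "((\<lambda>s. v s 4 3) has_vector_derivative v s 4 2 * (a - b + d - c)) (at s within I)"
    "((\<lambda>s. v s 5 3) has_vector_derivative v s 5 2 * (a + d - c)) (at s within I)"
    "((\<lambda>s. v s 6 3) has_vector_derivative v s 6 2 * (d - c)) (at s within I)"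
    "((\<lambda>s. v s 7 3) has_vector_derivative v s 7 2 * (d - b - c)) (at s within I)"
    "((\<lambda>s. v s 8 3) has_vector_derivative v s 8 2 * a) (at s within I)"
    "((\<lambda>s. v s 9 3) has_vector_derivative v s 9 2 * b) (at s within I)"
    using D3[of 1] D3[of 2] D3[of 3] D3[of 4] D3[of 5] D3[of 6] D3[of 7] D3[of 8] D3[of 9]
    by (simp_all add: SK_dlog_simps)
  have L: "((\<lambda>s. v s 9 0) has_vector_derivative b) (at s within I)"
    "((\<lambda>s. v s 6 0) has_vector_derivative d - c) (at s within I)"
    using D0[of 9] D0[of 6] by (simp_all add: SK_dlog_simps)
  have sq: "((\<lambda>s. v s 9 0 ^ 2) has_vector_derivative 2 * v s 9 0 * b) (at s within I)"
    using has_vector_derivative_mult[OF L(1) L(1)] by (simp add: power2_eq_square algebra_simps)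
  have cube: "((\<lambda>s. v s 9 0 ^ 3) has_vector_derivative 3 * v s 9 0 ^ 2 * b) (at s within I)"
    using has_vector_derivative_mult[OF L(1) sq] by (simp add: power2_eq_square power3_eq_cube algebra_simps)
  have prod: "((\<lambda>s. v s 9 0 ^ 2 * v s 6 0) has_vector_derivative
      v s 9 0 ^ 2 * (d - c) + 2 * v s 9 0 * b * v s 6 0) (at s within I)"
    by (rule has_vector_derivative_mult[OF sq L(2)])
  let ?D = "(v s 1 2 * (a - b + 2 * d - 2 * c) + v s 2 2 * (a + b) + v s 3 2 * (a - b)
      - 2 * (v s 4 2 * (a - b + d - c)) - 2 * (v s 5 2 * (a + d - c)) - 2 * (v s 6 2 * (d - c))
      - 2 * (v s 7 2 * (d - b - c)) - 2 * (v s 8 2 * a) - 2 * (v s 9 2 * b) + 0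
      - (v s 9 0 ^ 2 * (d - c) + 2 * v s 9 0 * b * v s 6 0 - of_real pi ^ 2 / 3 * b
          - 1 / 3 * (3 * v s 9 0 ^ 2 * b)))"
  have "((\<lambda>s. SK_defect (v s)) has_vector_derivative ?D) (at s within I)"
    unfolding SK_defect_def
    by (intro has_vector_derivative_add has_vector_derivative_diff has_vector_derivative_const
        prod cube has_vector_derivative_mult_right L P)
  moreover have "?D = a * SK_dilog_defect 0 (v s) + b * SK_dilog_defect 1 (v s)
      + (2 * d - 2 * c) * SK_dilog_defect 2 (v s)"
    by (simp add: SK_dilog_defect_def) (simp add: field_simps)
  ultimately show "((\<lambda>s. SK_defect (v s)) has_vector_derivative 0) (at s within I)"
    using rel(2)[OF s] by simp
qed

text \<open>
  Weight by weight: the relations of each weight say that the derivative in the next weight is 0.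
\<close>

lemma SK_relations_constant:
  assumes I: "convex I" and v: "SK_flow I v" and st: "s \<in> I" "t \<in> I" and rel: "SK_relations (v s)"
  shows "SK_relations (v t)"
proof -
  have log: "SK_log_relations (v r)" if "r \<in> I" for r
    using SK_log_relations_constant[OF I v st(1) that] rel by (simp add: SK_relations_def)
  have dilog: "SK_dilog_defect j (v r) = 0" if "r \<in> I" "j < 3" for r j
    using SK_dilog_defect_constant[OF I v st(1) that(1) log that(2)] rel that by (simp add: SK_relations_def)
  have "SK_defect (v t) = 0"
    using SK_defect_constant[OF I v st log dilog] rel by (simp add: SK_relations_def)
  then show ?thesis using log dilog st by (simp add: SK_relations_def)
qed

section \<open>The relations near the tangential base point\<close>

definition SK_base_state :: "real \<Rightarrow> nat \<Rightarrow> nat \<Rightarrow> complex"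
  where "SK_base_state u i k = base_polylog k (SK_map i (of_real u ^ 2, of_real u))"

lemma curve_in_V_an:
  assumes "0 < u" "u < 1"
  shows "(of_real u ^ 2, of_real u) \<in> V_an"
proof -
  have "u ^ 2 < u" "u ^ 2 * u < u ^ 2"
    using assms by (simp_all add: power2_eq_square)
  then have "u ^ 2 \<noteq> 1" "u ^ 2 \<noteq> u" "u ^ 2 * u \<noteq> 1" using assms by linarith+
  then have "of_real (u ^ 2) \<noteq> (1 :: complex)" "of_real (u ^ 2) \<noteq> (of_real u :: complex)"
      "of_real (u ^ 2 * u) \<noteq> (1 :: complex)"
    by (simp_all only: of_real_eq_1_iff of_real_eq_iff not_False_eq_True)
  then show ?thesis using assms by (simp add: V_an_def)
qed

lemma SK_base_state_eq:
  assumes "i \<in> {1..9}" "0 < u" "u < 1"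
  shows "SK_base_state u i k = base_polylog k (of_real (SK_curve i u))"
  unfolding SK_base_state_def SK_map_curve[OF assms] ..

lemma SK_curve_bounds:
  assumes "i \<in> {1..9}" "0 < u" "u < 1"
  shows "SK_curve i u < 1" "SK_curve i u \<noteq> 0"
    "i = 5 \<or> i = 7 \<Longrightarrow> SK_curve i u < 0" "i \<noteq> 5 \<Longrightarrow> i \<noteq> 7 \<Longrightarrow> SK_curve i u > 0"
proof -
  have *: "if i = 5 \<or> i = 7 then SK_curve i u < 0 else SK_curve i u > 0 \<and> SK_curve i u < 1"
    using assms(1)
  proof (cases rule: SK_index_cases)
    case 1
    have "u < (1 + u)^2" using assms by (simp add: power2_eq_square algebra_simps add_pos_pos)
    then show ?thesis using assms by (simp add: 1 SK_curve_simps)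
  next
    case 2
    then show ?thesis using assms by (simp add: SK_curve_simps power_less_one_iff)
  next
    case 5
    then show ?thesis using assms by (simp add: SK_curve_simps)
  next
    case 7
    then show ?thesis using assms by (simp add: SK_curve_simps)
  next
    case 8
    then show ?thesis using assms by (simp add: SK_curve_simps power_less_one_iff)
  qed (use assms in \<open>simp_all add: SK_curve_simps\<close>)
  then show "SK_curve i u < 1" "SK_curve i u \<noteq> 0"
    "i = 5 \<or> i = 7 \<Longrightarrow> SK_curve i u < 0" "i \<noteq> 5 \<Longrightarrow> i \<noteq> 7 \<Longrightarrow> SK_curve i u > 0"
    by (auto split: if_splits)
qed

lemma SK_flow_base: "SK_flow {0<..<1} SK_base_state"
  unfolding SK_base_state_def[abs_def]
proof (rule SK_flow_along_curve[where U = "\<lambda>i. base_domain" and x' = "\<lambda>s. 2 * of_real s" and y' = "\<lambda>s. 1"])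
  fix s :: real assume s: "s \<in> {0<..<1}"
  show "(of_real s ^ 2, of_real s) \<in> V_an" using curve_in_V_an s by simp
  show "((\<lambda>s. complex_of_real s ^ 2) has_vector_derivative 2 * of_real s) (at s within {0<..<1})"
    by (rule has_vector_derivative_real_field) (auto intro!: derivative_eq_intros)
  show "(complex_of_real has_vector_derivative 1) (at s within {0<..<1})"
    using has_vector_derivative_real_field[OF DERIV_ident, of s "{0<..<1}"] by simp
  show "SK_map i (of_real s ^ 2, of_real s) \<in> base_domain" if "i \<in> {1..9}" for i
    using SK_map_curve[OF that] SK_curve_bounds(1,2)[OF that] s by (simp add: base_domain_real)
qed (rule polylog_system_base)

text \<open>
  Along the curve, the logarithms of all \<open>f\<^sub>i\<close> and \<open>1 - f\<^sub>i\<close> are combinations of four real ones.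
\<close>

lemma SK_base_logs:
  assumes u: "0 < u" "u < 1" and i: "i \<in> {1..9}"
  defines "p \<equiv> ln u" and "m \<equiv> ln (1 - u)" and "n \<equiv> ln (1 + u)" and "r \<equiv> ln (1 + u + u^2)"
  shows "ln \<bar>SK_curve i u\<bar> = [p - 2 * n, 3 * p, p, p - n, 2 * p - n, - n, - p - n, 2 * p, p] ! (i - 1)"
    and "ln (1 - SK_curve i u) = [r - 2 * n, m + r, m, - n, r - n, p - n, r - p - n, m + n, m] ! (i - 1)"
proof -
  have pos: "1 + u > 0" "1 - u > 0" "1 + u + u^2 > 0" "(1 + u)^2 > 0" "u * (1 + u) > 0"
    using u by (auto simp: add_pos_pos)
  have compl: "1 - u / (1 + u)^2 = (1 + u + u^2) / (1 + u)^2" "1 - u^3 = (1 - u) * (1 + u + u^2)"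
    "1 - u / (1 + u) = 1 / (1 + u)" "1 - - (u^2) / (1 + u) = (1 + u + u^2) / (1 + u)"
    "1 - 1 / (1 + u) = u / (1 + u)" "1 - - 1 / (u * (1 + u)) = (1 + u + u^2) / (u * (1 + u))"
    "1 - u^2 = (1 - u) * (1 + u)"
    using u pos by (simp_all add: field_simps power2_eq_square power3_eq_cube)
  note lns = ln_div ln_mult ln_realpow
  show "ln \<bar>SK_curve i u\<bar> = [p - 2 * n, 3 * p, p, p - n, 2 * p - n, - n, - p - n, 2 * p, p] ! (i - 1)"
    using i by (cases rule: SK_index_cases)
      (use u pos in \<open>simp_all add: SK_curve_simps lns p_def n_def abs_mult\<close>)
  show "ln (1 - SK_curve i u) = [r - 2 * n, m + r, m, - n, r - n, p - n, r - p - n, m + n, m] ! (i - 1)"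
    using i by (cases rule: SK_index_cases; hypsubst; unfold SK_curve_simps compl)
      (use u pos in \<open>simp_all add: lns p_def n_def m_def r_def\<close>)
qed

lemma SK_base_state_logs:
  assumes u: "0 < u" "u < 1" and i: "i \<in> {1..9}"
  shows "SK_base_state u i 0 = of_real (ln \<bar>SK_curve i u\<bar>) + (if i = 5 \<or> i = 7 then \<i> * of_real pi else 0)"
    and "SK_base_state u i 1 = - of_real (ln (1 - SK_curve i u))"
proof -
  show "SK_base_state u i 0 = of_real (ln \<bar>SK_curve i u\<bar>) + (if i = 5 \<or> i = 7 then \<i> * of_real pi else 0)"
    using SK_curve_bounds[OF i u] base_log_negative[of "SK_curve i u"] base_log_positive[of "SK_curve i u"]
    by (auto simp: SK_base_state_eq[OF i u])
  show "SK_base_state u i 1 = - of_real (ln (1 - SK_curve i u))"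
    using base_Li_1_real SK_curve_bounds(1,2)[OF i u] by (simp add: SK_base_state_eq[OF i u])
qed

lemma SK_base_log_relations:
  assumes u: "0 < u" "u < 1"
  shows "SK_log_relations (SK_base_state u)"
  unfolding SK_log_relations_def
proof
  fix i :: nat assume i: "i \<in> {1..9}"
  have nine: "8 \<in> {1..9::nat}" "9 \<in> {1..9::nat}" "2 \<in> {1..9::nat}" "3 \<in> {1..9::nat}" by auto
  note st = SK_base_state_logs[OF u] SK_base_logs[OF u]
  note st' = st[OF i] st[OF nine(1)] st[OF nine(2)] st[OF nine(3)] st[OF nine(4)]
  show "SK_base_state u i 0 = SK_dlog i (SK_base_state u 8 0) (SK_base_state u 9 0)
      (- SK_base_state u 8 1) (- SK_base_state u 9 1) + (if i = 5 \<or> i = 7 then \<i> * of_real pi else 0) \<and>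
    SK_base_state u i 1 = - SK_dlog1m i (SK_base_state u 9 0) (- SK_base_state u 8 1)
      (- SK_base_state u 9 1) (SK_base_state u 9 0 - SK_base_state u 3 1) (- SK_base_state u 2 1)"
    unfolding st'
    using i by (cases rule: SK_index_cases; hypsubst) (simp_all add: SK_dlog_simps SK_dlog1m_simps)
qed

lemma SK_base_small:
  assumes "i \<in> {1,2,3,4,5,8,9}"
  shows "((\<lambda>u. SK_base_state u i (Suc k)) \<longlongrightarrow> 0) (at_right 0)"
proof -
  have i: "i \<in> {1..9}" using assms by auto
  have "(SK_curve i \<longlongrightarrow> 0) (at_right 0)"
  proof -
    have "((\<lambda>t::real. t / (1 + t)^2) \<longlongrightarrow> 0) (at_right 0)" "((\<lambda>t::real. t^3) \<longlongrightarrow> 0) (at_right 0)"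
      "((\<lambda>t::real. t) \<longlongrightarrow> 0) (at_right 0)" "((\<lambda>t::real. t / (1 + t)) \<longlongrightarrow> 0) (at_right 0)"
      "((\<lambda>t::real. - (t^2) / (1 + t)) \<longlongrightarrow> 0) (at_right 0)" "((\<lambda>t::real. t^2) \<longlongrightarrow> 0) (at_right 0)"
      by real_asymp+
    then show ?thesis using assms by (auto simp: SK_curve_simps[abs_def])
  qed
  then have "((\<lambda>u. complex_of_real (SK_curve i u)) \<longlongrightarrow> of_real 0) (at_right 0)"
    by (rule tendsto_of_real)
  then have "((\<lambda>u. principal_Li (Suc k) (of_real (SK_curve i u))) \<longlongrightarrow> principal_Li (Suc k) 0) (at_right 0)"
    using isCont_tendsto_compose[OF isCont_principal_Li[OF zero_in_slit_plane]] by simp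
  moreover have "\<forall>\<^sub>F u in at_right 0. principal_Li (Suc k) (of_real (SK_curve i u)) = SK_base_state u i (Suc k)"
    by (rule eventually_at_rightI[of _ 1]) (auto simp: SK_base_state_eq[OF i] base_polylog_def)
  ultimately have "((\<lambda>u. SK_base_state u i (Suc k)) \<longlongrightarrow> principal_Li (Suc k) 0) (at_right 0)"
    by (rule Lim_transform_eventually)
  then show ?thesis by simp
qed

lemma SK_base_6:
  assumes "k \<ge> 2"
  shows "((\<lambda>u. SK_base_state u 6 k) \<longlongrightarrow> (\<Sum>n. 1 / of_nat (Suc n) ^ k)) (at_right 0)"
proof -
  have "filterlim (\<lambda>t::real. 1 / (1 + t)) (at_left 1) (at_right 0)" by real_asymp
  then have "filterlim (SK_curve 6) (at_left 1) (at_right 0)" by (simp add: SK_curve_simps[abs_def])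
  from filterlim_compose[OF tendsto_principal_Li_1[OF assms] this]
  have "((\<lambda>u. principal_Li k (of_real (SK_curve 6 u))) \<longlongrightarrow> (\<Sum>n. 1 / of_nat (Suc n) ^ k)) (at_right 0)" .
  moreover have "\<forall>\<^sub>F u in at_right 0. principal_Li k (of_real (SK_curve 6 u)) = SK_base_state u 6 k"
    by (rule eventually_at_rightI[of _ 1]) (use assms in \<open>auto simp: SK_base_state_eq base_polylog_def\<close>)
  ultimately show ?thesis by (rule Lim_transform_eventually)
qed

text \<open>
  The argument \<open>f\<^sub>7\<close> tends to minus infinity, its reciprocal \<open>-t (1 + t)\<close> to 0; \<open>l\<close> is minus the
  logarithm of \<open>-f\<^sub>7\<close>.
\<close>

lemma SK_base_7:
  defines "l \<equiv> \<lambda>u. ln u + ln (1 + u)"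
  shows "((\<lambda>u. SK_base_state u 7 2 + of_real pi ^ 2 / 6 + of_real (l u ^ 2 / 2)) \<longlongrightarrow> 0) (at_right 0)"
    and "((\<lambda>u. SK_base_state u 7 3 - of_real (pi ^ 2 / 6 * l u + l u ^ 3 / 6)) \<longlongrightarrow> 0) (at_right 0)"
proof -
  have seven: "7 \<in> {1..9::nat}" by simp
  have small: "((\<lambda>u. principal_Li k (of_real (1 / SK_curve 7 u))) \<longlongrightarrow> 0) (at_right 0)" for k
  proof -
    have "((\<lambda>t::real. 1 / (- 1 / (t * (1 + t)))) \<longlongrightarrow> 0) (at_right 0)" by real_asymp
    then have "((\<lambda>u. complex_of_real (1 / SK_curve 7 u)) \<longlongrightarrow> of_real 0) (at_right 0)"
      unfolding SK_curve_simps by (rule tendsto_of_real)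
    then have "((\<lambda>u. principal_Li k (of_real (1 / SK_curve 7 u))) \<longlongrightarrow> principal_Li k 0) (at_right 0)"
      using isCont_tendsto_compose[OF isCont_principal_Li[OF zero_in_slit_plane]] by simp
    then show ?thesis by simp
  qed
  have ln7: "ln (- SK_curve 7 u) = - l u" "SK_curve 7 u < 0" if u: "u \<in> {0<..<1}" for u
    using SK_base_logs(1)[of u 7] SK_curve_bounds(3)[of 7 u] u by (simp_all add: l_def)
  have "\<forall>\<^sub>F u in at_right 0. - principal_Li 2 (of_real (1 / SK_curve 7 u)) =
      SK_base_state u 7 2 + of_real pi ^ 2 / 6 + of_real (l u ^ 2 / 2)"
  proof (rule eventually_at_rightI[of _ 1])
    fix u :: real assume u: "u \<in> {0<..<1}"
    have "SK_base_state u 7 2 = principal_Li 2 (of_real (SK_curve 7 u))"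
      using u by (simp add: SK_base_state_eq[OF seven] base_polylog_def)
    then show "- principal_Li 2 (of_real (1 / SK_curve 7 u)) =
      SK_base_state u 7 2 + of_real pi ^ 2 / 6 + of_real (l u ^ 2 / 2)"
      using principal_Li_2_inversion[OF ln7(2)[OF u]] by (simp only: ln7(1)[OF u]) simp
  qed simp
  moreover have "((\<lambda>u. - principal_Li 2 (of_real (1 / SK_curve 7 u))) \<longlongrightarrow> 0) (at_right 0)"
    using tendsto_minus[OF small[of 2]] by simp
  ultimately show "((\<lambda>u. SK_base_state u 7 2 + of_real pi ^ 2 / 6 + of_real (l u ^ 2 / 2)) \<longlongrightarrow> 0) (at_right 0)"
    using Lim_transform_eventually by fast
  have "\<forall>\<^sub>F u in at_right 0. principal_Li 3 (of_real (1 / SK_curve 7 u)) =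
      SK_base_state u 7 3 - of_real (pi ^ 2 / 6 * l u + l u ^ 3 / 6)"
  proof (rule eventually_at_rightI[of _ 1])
    fix u :: real assume u: "u \<in> {0<..<1}"
    have "SK_base_state u 7 3 = principal_Li 3 (of_real (SK_curve 7 u))"
      using u by (simp add: SK_base_state_eq[OF seven] base_polylog_def)
    then show "principal_Li 3 (of_real (1 / SK_curve 7 u)) =
      SK_base_state u 7 3 - of_real (pi ^ 2 / 6 * l u + l u ^ 3 / 6)"
      using principal_Li_3_inversion[OF ln7(2)[OF u]] by (simp only: ln7(1)[OF u]) simp
  qed simp
  then show "((\<lambda>u. SK_base_state u 7 3 - of_real (pi ^ 2 / 6 * l u + l u ^ 3 / 6)) \<longlongrightarrow> 0) (at_right 0)"
    using Lim_transform_eventually[OF small[of 3]] by fast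
qed

text \<open>
  A constant is determined by a limit at the boundary.
\<close>

lemma constant_tendsto_zero:
  fixes f :: "real \<Rightarrow> complex"
  assumes "\<And>s t. s \<in> {0<..<1} \<Longrightarrow> t \<in> {0<..<1} \<Longrightarrow> f t = f s" "(f \<longlongrightarrow> 0) (at_right 0)" "u \<in> {0<..<1}"
  shows "f u = 0"
proof -
  have "\<forall>\<^sub>F t in at_right 0. f t = f u"
    by (rule eventually_at_rightI[of _ 1], rule assms(1)[OF assms(3)]) simp_all
  then have "((\<lambda>t. f u) \<longlongrightarrow> 0) (at_right (0::real))"
    by (rule Lim_transform_eventually[OF assms(2)])
  then show ?thesis using tendsto_const_iff[of "at_right (0::real)"] by force
qed

lemma SK_base_9_6:
  assumes "u \<in> {0<..<1}"
  shows "SK_base_state u 9 0 = of_real (ln u)" "SK_base_state u 6 0 = - of_real (ln (1 + u))"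
  using SK_base_state_logs(1)[of u 9] SK_base_state_logs(1)[of u 6] SK_base_logs(1)[of u 9] SK_base_logs(1)[of u 6] assms
  by simp_all

text \<open>
  Each expression is constant on the curve, and it tends to 0: by the limits above, what is left of
  the divergent terms are products of powers of \<open>ln t\<close> and \<open>ln (1 + t)\<close>, with the latter present.
\<close>

lemma SK_base_dilog:
  assumes "u \<in> {0<..<1}" "j < 3"
  shows "SK_dilog_defect j (SK_base_state u) = 0"
proof (rule constant_tendsto_zero[OF _ _ assms(1), of "\<lambda>u. SK_dilog_defect j (SK_base_state u)"])
  show "SK_dilog_defect j (SK_base_state t) = SK_dilog_defect j (SK_base_state s)"
    if "s \<in> {0<..<1}" "t \<in> {0<..<1}" for s t
    using SK_dilog_defect_constant[OF _ SK_flow_base that SK_base_log_relations assms(2)] by simp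
  have P: "((\<lambda>u. SK_base_state u i 2) \<longlongrightarrow> 0) (at_right 0)" if "i \<in> {1,2,3,4,5,8,9}" for i
    using SK_base_small[OF that, of 1] by (simp add: numeral_2_eq_2)
  have P6: "((\<lambda>u. SK_base_state u 6 2) \<longlongrightarrow> of_real pi ^ 2 / 6) (at_right 0)"
    using SK_base_6[of 2] unfolding suminf_inverse_squares by simp
  \<comment> \<open>the dilogarithm of \<open>f\<^sub>7\<close> without its divergent part\<close>
  define R where "R u = SK_base_state u 7 2 + of_real pi ^ 2 / 6 + of_real ((ln u + ln (1 + u)) ^ 2 / 2)" for u
  have R: "(R \<longlongrightarrow> 0) (at_right 0)" using SK_base_7(1) unfolding R_def .
  have ev: "\<forall>\<^sub>F u in at_right (0::real). u \<in> {0<..<1}" by (rule eventually_at_rightI[of _ 1]) auto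
  consider "j = 0" | "j = 1" | "j = 2" using assms(2) by linarith
  then show "((\<lambda>u. SK_dilog_defect j (SK_base_state u)) \<longlongrightarrow> 0) (at_right 0)"
  proof cases
    case 1
    have "((\<lambda>u. SK_dilog_defect 0 (SK_base_state u)) \<longlongrightarrow> 0 + 0 + 0 - 2 * 0 - 2 * 0 - 2 * 0) (at_right 0)"
      unfolding SK_dilog_defect_def nth_Cons_0 by (intro tendsto_intros P) auto
    then show ?thesis by (simp add: 1)
  next
    case 2
    have "((\<lambda>u::real. - (ln (1 + u) ^ 2)) \<longlongrightarrow> 0) (at_right 0)" by real_asymp
    then have lim: "((\<lambda>u. complex_of_real (- (ln (1 + u) ^ 2))) \<longlongrightarrow> of_real 0) (at_right 0)" by (rule tendsto_of_real)
    have "((\<lambda>u. - SK_base_state u 1 2 + SK_base_state u 2 2 - SK_base_state u 3 2 + 2 * SK_base_state u 4 2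
        + 2 * R u - 2 * SK_base_state u 9 2 + of_real (- (ln (1 + u) ^ 2)))
        \<longlongrightarrow> - 0 + 0 - 0 + 2 * 0 + 2 * 0 - 2 * 0 + of_real 0) (at_right 0)"
      by (intro tendsto_intros P R lim) auto
    moreover have "\<forall>\<^sub>F u in at_right 0. - SK_base_state u 1 2 + SK_base_state u 2 2 - SK_base_state u 3 2 + 2 * SK_base_state u 4 2
        + 2 * R u - 2 * SK_base_state u 9 2 + of_real (- (ln (1 + u) ^ 2)) = SK_dilog_defect j (SK_base_state u)"
      using ev by eventually_elim
        (simp add: 2 SK_dilog_defect_def SK_base_9_6 R_def, simp add: field_simps power2_eq_square)
    ultimately have "((\<lambda>u. SK_dilog_defect j (SK_base_state u)) \<longlongrightarrow> - 0 + 0 - 0 + 2 * 0 + 2 * 0 - 2 * 0 + of_real 0) (at_right 0)"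
      by (rule Lim_transform_eventually)
    then show ?thesis by simp
  next
    case 3
    have "((\<lambda>u::real. ln u * ln (1 + u) + ln (1 + u) ^ 2 / 2) \<longlongrightarrow> 0) (at_right 0)" by real_asymp
    then have lim: "((\<lambda>u. complex_of_real (ln u * ln (1 + u) + ln (1 + u) ^ 2 / 2)) \<longlongrightarrow> of_real 0) (at_right 0)"
      by (rule tendsto_of_real)
    have "((\<lambda>u. SK_base_state u 1 2 - SK_base_state u 4 2 - SK_base_state u 5 2
        - (SK_base_state u 6 2 - of_real pi ^ 2 / 6) - R u + of_real (ln u * ln (1 + u) + ln (1 + u) ^ 2 / 2))
        \<longlongrightarrow> 0 - 0 - 0 - (of_real pi ^ 2 / 6 - of_real pi ^ 2 / 6) - 0 + of_real 0) (at_right 0)"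
      by (intro tendsto_intros P P6 R lim) auto
    moreover have "\<forall>\<^sub>F u in at_right 0. SK_base_state u 1 2 - SK_base_state u 4 2 - SK_base_state u 5 2
        - (SK_base_state u 6 2 - of_real pi ^ 2 / 6) - R u + of_real (ln u * ln (1 + u) + ln (1 + u) ^ 2 / 2)
        = SK_dilog_defect j (SK_base_state u)"
      using ev by eventually_elim
        (simp add: 3 SK_dilog_defect_def SK_base_9_6 R_def, simp add: field_simps power2_eq_square)
    ultimately have "((\<lambda>u. SK_dilog_defect j (SK_base_state u))
        \<longlongrightarrow> 0 - 0 - 0 - (of_real pi ^ 2 / 6 - of_real pi ^ 2 / 6) - 0 + of_real 0) (at_right 0)"
      by (rule Lim_transform_eventually)
    then show ?thesis by simp
  qed
qed

text \<open>
  As in weight two; the divergent terms of \<open>T\<^sub>7\<close> match the right-hand side of the equation.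
\<close>

lemma SK_base_defect:
  assumes "u \<in> {0<..<1}"
  shows "SK_defect (SK_base_state u) = 0"
proof (rule constant_tendsto_zero[OF _ _ assms, of "\<lambda>u. SK_defect (SK_base_state u)"])
  show "SK_defect (SK_base_state t) = SK_defect (SK_base_state s)"
    if "s \<in> {0<..<1}" "t \<in> {0<..<1}" for s t
    using SK_defect_constant[OF _ SK_flow_base that SK_base_log_relations SK_base_dilog] by simp
  have T: "((\<lambda>u. SK_base_state u i 3) \<longlongrightarrow> 0) (at_right 0)" if "i \<in> {1,2,3,4,5,8,9}" for i
    using SK_base_small[OF that, of 2] by (simp add: numeral_3_eq_3 numeral_2_eq_2)
  have T6: "((\<lambda>u. SK_base_state u 6 3) \<longlongrightarrow> zeta3) (at_right 0)"
    using SK_base_6[of 3] by (simp add: zeta3_def)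
  \<comment> \<open>the trilogarithm of \<open>f\<^sub>7\<close> without its divergent part\<close>
  define R where "R u = SK_base_state u 7 3 -
    of_real (pi ^ 2 / 6 * (ln u + ln (1 + u)) + (ln u + ln (1 + u)) ^ 3 / 6)" for u
  have R: "(R \<longlongrightarrow> 0) (at_right 0)" using SK_base_7(2) unfolding R_def .
  have ev: "\<forall>\<^sub>F u in at_right (0::real). u \<in> {0<..<1}" by (rule eventually_at_rightI[of _ 1]) auto
  \<comment> \<open>what the divergent part of \<open>T\<^sub>7\<close> and the right-hand side leave over\<close>
  define rest where "rest u = - (pi ^ 2 / 3) * ln (1 + u) - ln u * ln (1 + u) ^ 2 - ln (1 + u) ^ 3 / 3" for u :: real
  have "(rest \<longlongrightarrow> 0) (at_right 0)" unfolding rest_def by real_asymp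
  then have lim: "((\<lambda>u. complex_of_real (rest u)) \<longlongrightarrow> of_real 0) (at_right 0)" by (rule tendsto_of_real)
  let ?F = "\<lambda>u. SK_base_state u 1 3 + SK_base_state u 2 3 + SK_base_state u 3 3 - 2 * SK_base_state u 4 3
      - 2 * SK_base_state u 5 3 - 2 * (SK_base_state u 6 3 - zeta3) - 2 * R u
      - 2 * SK_base_state u 8 3 - 2 * SK_base_state u 9 3 + of_real (rest u)"
  have "(?F \<longlongrightarrow> 0 + 0 + 0 - 2 * 0 - 2 * 0 - 2 * (zeta3 - zeta3) - 2 * 0 - 2 * 0 - 2 * 0 + of_real 0) (at_right 0)"
    by (intro tendsto_intros T T6 R lim) auto
  moreover have "\<forall>\<^sub>F u in at_right 0. ?F u = SK_defect (SK_base_state u)"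
    using ev by eventually_elim
      (simp add: SK_defect_def SK_base_9_6 R_def rest_def, simp add: field_simps power2_eq_square power3_eq_cube)
  ultimately have "((\<lambda>u. SK_defect (SK_base_state u))
      \<longlongrightarrow> 0 + 0 + 0 - 2 * 0 - 2 * 0 - 2 * (zeta3 - zeta3) - 2 * 0 - 2 * 0 - 2 * 0 + of_real 0) (at_right 0)"
    by (rule Lim_transform_eventually)
  then show "((\<lambda>u. SK_defect (SK_base_state u)) \<longlongrightarrow> 0) (at_right 0)" by simp
qed

lemma SK_base_relations: "0 < u \<Longrightarrow> u < 1 \<Longrightarrow> SK_relations (SK_base_state u)"
  using SK_base_log_relations SK_base_dilog SK_base_defect by (simp add: SK_relations_def)


section \<open>The relations along an arbitrary path\<close>

lemma SK_relations_cong: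
  assumes "\<And>i. i \<in> {1..9} \<Longrightarrow> v i = w i"
  shows "SK_relations v \<longleftrightarrow> SK_relations w"
proof -
  have "v 1 = w 1" "v 2 = w 2" "v 3 = w 3" "v 4 = w 4" "v 5 = w 5" "v 6 = w 6" "v 7 = w 7" "v 8 = w 8" "v 9 = w 9"
    using assms by simp_all
  then show ?thesis
    using assms by (simp add: SK_relations_def SK_log_relations_def SK_dilog_defect_def SK_defect_def)
qed

text \<open>
  A path that is only continuous cannot be differentiated along; on a small convex piece of the
  surface nearby points are joined by segments instead.
\<close>

lemma SK_relations_along_segment:
  assumes seg: "closed_segment p q \<subseteq> V_an"
    and g: "\<And>i. i \<in> {1..9} \<Longrightarrow> polylog_system (U i) (g i)"
      "\<And>i w. i \<in> {1..9} \<Longrightarrow> w \<in> closed_segment p q \<Longrightarrow> SK_map i w \<in> U i"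
    and rel: "SK_relations (\<lambda>i k. g i k (SK_map i p))"
  shows "SK_relations (\<lambda>i k. g i k (SK_map i q))"
proof -
  define x where "x s = fst p + of_real s * (fst q - fst p)" for s
  define y where "y s = snd p + of_real s * (snd q - snd p)" for s
  have xy: "(x s, y s) = (1 - s) *\<^sub>R p + s *\<^sub>R q" for s
    by (auto simp: x_def y_def prod_eq_iff scaleR_conv_of_real algebra_simps)
  then have in_seg: "(x s, y s) \<in> closed_segment p q" if "s \<in> {0..1}" for s
    using that by (auto simp: closed_segment_def)
  have "(x has_vector_derivative fst q - fst p) (at s within {0..1})"
    "(y has_vector_derivative snd q - snd p) (at s within {0..1})" for s
    unfolding x_def y_def by (auto intro!: derivative_eq_intros has_vector_derivative_real_field)
  then have "SK_flow {0..1} (\<lambda>s i k. g i k (SK_map i (x s, y s)))"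
    using seg in_seg g by (intro SK_flow_along_curve[where U = U]) auto
  moreover have "SK_relations (\<lambda>i k. g i k (SK_map i (x 0, y 0)))" using rel by (simp add: x_def y_def)
  ultimately have "SK_relations (\<lambda>i k. g i k (SK_map i (x 1, y 1)))"
    using SK_relations_constant[of "{0..1}" "\<lambda>s i k. g i k (SK_map i (x s, y s))" 0 1] by simp
  then show ?thesis by (simp add: x_def y_def)
qed

text \<open>
  The relations hold near the start by the computation on the curve. They then propagate: near each
  time all nine continuations are given by solutions on neighbourhoods of the \<open>f\<^sub>i\<close>-images of one ball
  in the surface, and inside this ball they are transferred along segments.
\<close>

theorem SK_relations_along_path:
  assumes p: "p \<in> base_paths V_an base_v T"
    and lift: "\<And>i. i \<in> {1..9} \<Longrightarrow> polylog_lift (SK_map i \<circ> p) {0<..<1} (\<phi> i)"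
    and start: "\<And>i. i \<in> {1..9} \<Longrightarrow> \<forall>\<^sub>F t in at_right 0. \<phi> i t = (\<lambda>k. base_polylog k ((SK_map i \<circ> p) t))"
    and t: "t \<in> {0<..<1}"
  shows "SK_relations (\<lambda>i. \<phi> i t)"
proof -
  have "\<forall>\<^sub>F w in base_v. \<exists>u. 0 < u \<and> u < 1 \<and> w = (of_real u ^ 2, of_real u)"
    unfolding base_v_def eventually_filtermap by (rule eventually_at_rightI[of _ 1]) auto
  then have "\<forall>\<^sub>F t in at_right 0. \<exists>u. 0 < u \<and> u < 1 \<and> p t = (of_real u ^ 2, of_real u)"
    using base_pathsD(3)[OF p] unfolding filterlim_iff by blast
  moreover have "\<forall>\<^sub>F t in at_right 0. \<forall>i\<in>{1..9}. \<phi> i t = (\<lambda>k. base_polylog k ((SK_map i \<circ> p) t))"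
    using start by (intro eventually_ball_finite) auto
  ultimately have "\<forall>\<^sub>F t in at_right 0. SK_relations (\<lambda>i. \<phi> i t)"
  proof eventually_elim
    case (elim t)
    then obtain u where u: "0 < u" "u < 1" "p t = (of_real u ^ 2, of_real u)" by blast
    have "\<phi> i t = SK_base_state u i" if "i \<in> {1..9}" for i
      using elim(2) that u(3) by (auto simp: SK_base_state_def fun_eq_iff)
    then show ?case using SK_relations_cong SK_base_relations[OF u(1,2)] by metis
  qed
  then obtain a where a: "0 < a" "a < 1" "SK_relations (\<lambda>i. \<phi> i a)"
    unfolding eventually_at_right_0_iff by blast
  have "a \<in> {0<..<1}" using a by simp
  then show ?thesis
  proof (rule connected_induction_simple[where P = "\<lambda>t. SK_relations (\<lambda>i. \<phi> i t)", OF connected_Ioo _ t a(3)])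
    fix r :: real assume r: "r \<in> {0<..<1}"
    have "\<forall>i\<in>{1..9}. \<exists>U g d. polylog_system U g \<and> d > 0 \<and>
        (\<forall>s\<in>{0<..<1}. dist r s < d \<longrightarrow> SK_map i (p s) \<in> U \<and> \<phi> i s = (\<lambda>k. g k (SK_map i (p s))))"
    proof
      fix i :: nat assume "i \<in> {1..9}"
      then obtain U g d where *: "polylog_system U g" "d > 0"
        "\<And>s. s \<in> {0<..<1} \<Longrightarrow> dist r s < d \<Longrightarrow> (SK_map i \<circ> p) s \<in> U"
        "\<And>s. s \<in> {0<..<1} \<Longrightarrow> dist r s < d \<Longrightarrow> \<phi> i s = (\<lambda>k. g k ((SK_map i \<circ> p) s))"
        using polylog_liftE[OF lift r] by metis
      show "\<exists>U g d. polylog_system U g \<and> d > 0 \<and>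
        (\<forall>s\<in>{0<..<1}. dist r s < d \<longrightarrow> SK_map i (p s) \<in> U \<and> \<phi> i s = (\<lambda>k. g k (SK_map i (p s))))"
        by (rule exI[of _ U], rule exI[of _ g], rule exI[of _ d]) (use * in simp)
    qed
    then obtain U g d where Ugd: "\<forall>i\<in>{1..9}. polylog_system (U i) (g i) \<and> d i > (0::real) \<and>
        (\<forall>s\<in>{0<..<1}. dist r s < d i \<longrightarrow> SK_map i (p s) \<in> U i \<and> \<phi> i s = (\<lambda>k. g i k (SK_map i (p s))))"
      by metis
    have near: "SK_map i (p s) \<in> U i" "\<phi> i s = (\<lambda>k. g i k (SK_map i (p s)))"
      if "i \<in> {1..9}" "s \<in> {0<..<1}" "dist r s < d i" for i s
      using Ugd that by blast+
    define G where "G = V_an \<inter> (\<Inter>i\<in>{1..9}. V_an \<inter> SK_map i -` U i)"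
    have "open (V_an \<inter> SK_map i -` U i)" if "i \<in> {1..9}" for i
      using Ugd that polylog_systemD(1) continuous_on_SK_map[OF that] open_V_an
      by (intro continuous_open_preimage) blast+
    then have "open G" unfolding G_def using open_V_an by (intro open_Int open_INT) auto
    moreover have "p r \<in> G"
      using near(1)[OF _ r] Ugd base_pathsD(2)[OF p r] by (auto simp: G_def)
    ultimately obtain e where e: "e > 0" "ball (p r) e \<subseteq> G" by (meson open_contains_ball)
    obtain d' where d': "d' > 0" "\<forall>s\<in>{0<..<1}. dist s r < d' \<longrightarrow> dist (p s) (p r) < e"
      using base_pathsD(1)[OF p] r e(1) unfolding continuous_on_iff by blast
    define m where "m = min d' (Min (d ` {1..9}))"
    have "m > 0" using d'(1) Ugd by (auto simp: m_def)
    have m_le: "m \<le> d' \<and> m \<le> d i" if "i \<in> {1..9}" for i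
      using that by (auto simp: m_def intro: min.coboundedI2)
    define N where "N = {0<..<1} \<inter> ball r m"
    have step: "SK_relations (\<lambda>i. \<phi> i s')" if s: "s \<in> N" "s' \<in> N" "SK_relations (\<lambda>i. \<phi> i s)" for s s'
    proof -
      have in01: "s \<in> {0<..<1}" "s' \<in> {0<..<1}" and dist: "dist r s < m" "dist r s' < m"
        using s by (auto simp: N_def)
      have val: "\<phi> i s = (\<lambda>k. g i k (SK_map i (p s)))" "\<phi> i s' = (\<lambda>k. g i k (SK_map i (p s')))"
        if "i \<in> {1..9}" for i
        using near(2)[OF that in01(1)] near(2)[OF that in01(2)] dist m_le[OF that] by auto
      have "p s \<in> ball (p r) e" "p s' \<in> ball (p r) e"
      proof -
        have "dist s r < d'" "dist s' r < d'" using dist m_le[of 1] by (simp_all add: dist_commute)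
        then show "p s \<in> ball (p r) e" "p s' \<in> ball (p r) e"
          using d'(2) in01 by (metis dist_commute mem_ball)+
      qed
      then have "closed_segment (p s) (p s') \<subseteq> ball (p r) e"
        by (intro closed_segment_subset) auto
      then have seg: "closed_segment (p s) (p s') \<subseteq> G" using e(2) by blast
      have "SK_relations (\<lambda>i k. g i k (SK_map i (p s)))"
        using s(3) SK_relations_cong[of "\<lambda>i. \<phi> i s" "\<lambda>i k. g i k (SK_map i (p s))"] val(1) by blast
      then have "SK_relations (\<lambda>i k. g i k (SK_map i (p s')))"
        using seg Ugd by (intro SK_relations_along_segment[of "p s" "p s'" U g]) (auto simp: G_def)
      then show ?thesis
        using SK_relations_cong[of "\<lambda>i. \<phi> i s'" "\<lambda>i k. g i k (SK_map i (p s'))"] val(2) by blast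
    qed
    show "\<exists>T. openin (top_of_set {0<..<1}) T \<and> r \<in> T \<and>
        (\<forall>s\<in>T. \<forall>s'\<in>T. SK_relations (\<lambda>i. \<phi> i s) \<longrightarrow> SK_relations (\<lambda>i. \<phi> i s'))"
    proof (intro exI[of _ N] conjI ballI impI)
      show "openin (top_of_set {0<..<1}) N" by (simp add: N_def openin_open_Int)
      show "r \<in> N" using r \<open>m > 0\<close> by (simp add: N_def)
    qed (rule step)
  qed
qed

text \<open>
  The limit at the end of the path of the relation in weight three.
\<close>

theorem SK_defect_at_endpoint:
  assumes v: "v \<in> V_an" and p: "p \<in> base_paths V_an base_v (nhds v)"
  shows "\<exists>U h. (\<forall>i\<in>{1..9}. polylog_system (U i) (h i) \<and> SK_map i v \<in> U i \<and>
      transports (SK_map i \<circ> p) base_polylog (h i)) \<and> SK_defect (\<lambda>i k. h i k (SK_map i v)) = 0"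
proof -
  have push: "SK_map i \<circ> p \<in> base_paths P1_minus (SK_base i) (nhds (SK_map i v))" if i: "i \<in> {1..9}" for i
  proof -
    have "path_homotopic V_an base_v (nhds v) p (\<lambda>t. p (t ^ 1))" by (rule path_homotopic_power[OF p order_refl])
    from path_homotopic_push[OF this continuous_on_SK_map[OF i] _ filterlim_SK_map_base[OF i] filterlim_SK_map_point[OF i v]]
    have "path_homotopic P1_minus (SK_base i) (nhds (SK_map i v)) (SK_map i \<circ> p) (SK_map i \<circ> (\<lambda>t. p (t ^ 1)))"
      using SK_map_in_P1_minus[OF i] by blast
    then show ?thesis by (rule path_homotopic_base_paths)
  qed
  have "\<forall>i\<in>{1..9}. \<exists>U h. polylog_system U h \<and> SK_map i v \<in> U \<and> transports (SK_map i \<circ> p) base_polylog h"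
    using transports_to_point_exists[OF push SK_map_in_P1_minus[OF _ v] polylog_system_base SK_base_in_domain]
    by metis
  then obtain U h where h: "\<forall>i\<in>{1..9}. polylog_system (U i) (h i) \<and> SK_map i v \<in> U i \<and>
      transports (SK_map i \<circ> p) base_polylog (h i)"
    by metis
  then have "\<forall>i\<in>{1..9}. \<exists>\<phi>. polylog_lift (SK_map i \<circ> p) {0<..<1} \<phi> \<and>
      (\<forall>\<^sub>F t in at_right 0. \<phi> t = (\<lambda>k. base_polylog k ((SK_map i \<circ> p) t))) \<and>
      (\<forall>\<^sub>F t in at_left 1. \<phi> t = (\<lambda>k. h i k ((SK_map i \<circ> p) t)))"
    unfolding transports_def by blast
  from bchoice[OF this] obtain \<phi> where \<phi>: "\<forall>i\<in>{1..9}. polylog_lift (SK_map i \<circ> p) {0<..<1} (\<phi> i) \<and>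
      (\<forall>\<^sub>F t in at_right 0. \<phi> i t = (\<lambda>k. base_polylog k ((SK_map i \<circ> p) t))) \<and>
      (\<forall>\<^sub>F t in at_left 1. \<phi> i t = (\<lambda>k. h i k ((SK_map i \<circ> p) t)))"
    by blast
  have rel: "SK_defect (\<lambda>i. \<phi> i t) = 0" if "t \<in> {0<..<1}" for t
    using SK_relations_along_path[OF p _ _ that, of \<phi>] \<phi> by (simp add: SK_relations_def)
  have lim: "((\<lambda>t. \<phi> i t k) \<longlongrightarrow> h i k (SK_map i v)) (at_left 1)" if "i \<in> {1..9}" for i k
  proof -
    have "((\<lambda>t. h i k ((SK_map i \<circ> p) t)) \<longlongrightarrow> h i k (SK_map i v)) (at_left 1)"
      using h that by (intro tendsto_compose_end[OF _ _ base_pathsD(4)[OF push[OF that]]]) blast+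
    moreover have "\<forall>\<^sub>F t in at_left 1. \<phi> i t = (\<lambda>k. h i k ((SK_map i \<circ> p) t))" using \<phi> that by blast
    then have "\<forall>\<^sub>F t in at_left 1. h i k ((SK_map i \<circ> p) t) = \<phi> i t k" by eventually_elim simp
    ultimately show ?thesis by (rule Lim_transform_eventually)
  qed
  have "((\<lambda>t. SK_defect (\<lambda>i. \<phi> i t)) \<longlongrightarrow> SK_defect (\<lambda>i k. h i k (SK_map i v))) (at_left 1)"
    unfolding SK_defect_def by (intro tendsto_intros lim) auto
  moreover have "\<forall>\<^sub>F t in at_left 1. SK_defect (\<lambda>i. \<phi> i t) = 0"
    by (rule eventually_at_leftI[of 0], rule rel) simp_all
  ultimately have "((\<lambda>t::real. 0 :: complex) \<longlongrightarrow> SK_defect (\<lambda>i k. h i k (SK_map i v))) (at_left 1)"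
    by (rule Lim_transform_eventually)
  then have "SK_defect (\<lambda>i k. h i k (SK_map i v)) = 0"
    using tendsto_const_iff[of "at_left (1::real)" "0::complex"] by force
  with h show ?thesis by (intro exI conjI)
qed

theorem theorem0p1:
  fixes x y :: complex
    and \<gamma>\<^sub>0 :: "(real \<Rightarrow> complex \<times> complex) set"
    and \<gamma> :: "nat \<Rightarrow> (real \<Rightarrow> complex) set"
  assumes "(x, y) \<in> V_an"
    and "\<gamma>\<^sub>0 \<in> pi1 V_an base_v (nhds (x, y))"
    and "\<And>i. i \<in> {1..9} \<Longrightarrow>
           \<gamma> i = SK_delta i \<odot>
                 path_push (SK_map i) P1_minus (SK_base i) (nhds (SK_map i (x, y))) \<gamma>\<^sub>0"
  shows "Li 3 (x * (1 - y)^2 / (y * (1 - x)^2)) (\<gamma> 1)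
       + Li 3 (x * y) (\<gamma> 2)
       + Li 3 (x / y) (\<gamma> 3)
       - 2 * Li 3 (x * (1 - y) / (y * (1 - x))) (\<gamma> 4)
       - 2 * Li 3 (x * (1 - y) / (x - 1)) (\<gamma> 5)
       - 2 * Li 3 ((1 - y) / (1 - x)) (\<gamma> 6)
       - 2 * Li 3 ((1 - y) / (y * (x - 1))) (\<gamma> 7)
       - 2 * Li 3 x (\<gamma> 8)
       - 2 * Li 3 y (\<gamma> 9)
       + 2 * zeta3
     = (log_path y (\<gamma> 9))^2 * log_path ((1 - y) / (1 - x)) (\<gamma> 6)
       - of_real pi ^ 2 / 3 * log_path y (\<gamma> 9)
       - 1 / 3 * (log_path y (\<gamma> 9))^3"
proof -
  obtain p where p: "p \<in> base_paths V_an base_v (nhds (x, y))"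
    and \<gamma>\<^sub>0: "\<gamma>\<^sub>0 = {q. path_homotopic V_an base_v (nhds (x, y)) p q}"
    using assms(2) unfolding pi1_def by (auto elim!: quotientE)
  obtain U h where h: "\<forall>i\<in>{1..9}. polylog_system (U i) (h i) \<and> SK_map i (x, y) \<in> U i \<and>
      transports (SK_map i \<circ> p) base_polylog (h i)"
    and defect: "SK_defect (\<lambda>i k. h i k (SK_map i (x, y))) = 0"
    using SK_defect_at_endpoint[OF assms(1) p] by (elim exE conjE)
  have val: "Li 3 (SK_map i (x, y)) (\<gamma> i) = h i 3 (SK_map i (x, y))"
    "i = 6 \<or> i = 9 \<Longrightarrow> log_path (SK_map i (x, y)) (\<gamma> i) = h i 0 (SK_map i (x, y))" if i: "i \<in> {1..9}" for i
  proof -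
    have hi: "polylog_system (U i) (h i)" "SK_map i (x, y) \<in> U i" "transports (SK_map i \<circ> p) base_polylog (h i)"
      using bspec[OF h i] by simp_all
    note vals = SK_path_values[OF assms(1) p i hi]
    show "Li 3 (SK_map i (x, y)) (\<gamma> i) = h i 3 (SK_map i (x, y))"
      unfolding assms(3)[OF i] \<gamma>\<^sub>0 by (rule vals(1)) simp
    show "log_path (SK_map i (x, y)) (\<gamma> i) = h i 0 (SK_map i (x, y))" if "i = 6 \<or> i = 9"
      unfolding assms(3)[OF i] \<gamma>\<^sub>0 by (rule vals(2)[OF that])
  qed
  have Li: "Li 3 (x * (1 - y)^2 / (y * (1 - x)^2)) (\<gamma> 1) = h 1 3 (SK_map 1 (x, y))"
    "Li 3 (x * y) (\<gamma> 2) = h 2 3 (SK_map 2 (x, y))" "Li 3 (x / y) (\<gamma> 3) = h 3 3 (SK_map 3 (x, y))"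
    "Li 3 (x * (1 - y) / (y * (1 - x))) (\<gamma> 4) = h 4 3 (SK_map 4 (x, y))"
    "Li 3 (x * (1 - y) / (x - 1)) (\<gamma> 5) = h 5 3 (SK_map 5 (x, y))"
    "Li 3 ((1 - y) / (1 - x)) (\<gamma> 6) = h 6 3 (SK_map 6 (x, y))"
    "Li 3 ((1 - y) / (y * (x - 1))) (\<gamma> 7) = h 7 3 (SK_map 7 (x, y))"
    "Li 3 x (\<gamma> 8) = h 8 3 (SK_map 8 (x, y))" "Li 3 y (\<gamma> 9) = h 9 3 (SK_map 9 (x, y))"
    using val(1)[of 1] val(1)[of 2] val(1)[of 3] val(1)[of 4] val(1)[of 5]
      val(1)[of 6] val(1)[of 7] val(1)[of 8] val(1)[of 9]
    by (simp_all add: SK_map_simps)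
  have log: "log_path ((1 - y) / (1 - x)) (\<gamma> 6) = h 6 0 (SK_map 6 (x, y))"
    "log_path y (\<gamma> 9) = h 9 0 (SK_map 9 (x, y))"
    using val(2)[of 6] val(2)[of 9] by (simp_all add: SK_map_simps)
  show ?thesis
    using defect unfolding SK_defect_def Li log by (simp only: right_minus_eq)
qed

end
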